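(* Let $d\ge 1$, $\beta>0$, let $U:\mathbb{R}^d\to\mathbb{R}$ be a measurable external potential and $W\in L^\infty(\mathbb{R}^d)$ a symmetric ($W(-x)=W(x)$) interaction kernel, such that $\exp(-\beta E_N)\in L^1(\mathbb{R}^{Nd})$ for all $N\ge 2$. Let $\rho_N$ be the $N$-body Gibbs measure, $\rho_{N,k}$ its $k$-marginal, and $\rho$ a minimizer of the mean-field free energy $\mathcal{F}$ over probability densities on $\mathbb{R}^d$ (see context). If $\beta<(2e\sqrt2\,\|W\|_\infty)^{-1}$, then for any fixed $k\ge1$ and all $N$ large enough, $$\|\rho_{N,k}-\rho^{\otimes k}\|_{TV}\le\sqrt{2\mathcal{H}(\rho_{N,k}\mid\rho^{\otimes k})}\le\sqrt{\frac{2k}{N}\mathcal{H}(\rho_N\mid\rho^{\otimes N})}\lesssim\sqrt{\frac kN},$$ and, for the Wasserstein distance, $$W_1(\rho_{N,1},\rho)\lesssim\sqrt{\frac kN}.$$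
   Context: For $N\ge2$ and $x_1,\dots,x_N\in\mathbb{R}^d$, the energy is $$E_N(x_1,\dots,x_N)=\sum_{i=1}^N U(x_i)+\frac{1}{2(N-1)}\sum_{i\ne j}W(x_i-x_j).$$ The $N$-body Gibbs measure is the probability measure on $\mathbb{R}^{Nd}$ with density $\rho_N=\bar Z_N^{-1}\exp(-\beta E_N)$, $\bar Z_N$ the normalizing constant. Its $k$-marginal is $\rho_{N,k}(x_1,\dots,x_k)=\int\rho_N(x_1,\dots,x_N)\,dx_{k+1}\cdots dx_N$. The mean-field free energy of a probability density $\rho$ on $\mathbb{R}^d$ is $$\mathcal{F}(\rho)=\int_{\mathbb{R}^d}U\rho\,dx+\frac12\int_{\mathbb{R}^d}\rho\,(W*\rho)\,dx+\beta^{-1}\int_{\mathbb{R}^d}\rho\log\rho\,dx,$$ where $(W*\rho)(x)=\int W(x-y)\rho(y)\,dy$; the sum $\int (U\rho+\beta^{-1}\rho\log\rho)\,dx$ is understood as a single integral, with values in $(-\infty,+\infty]$. The relative entropy is $\mathcal{H}(\mu\mid\nu)=\int\log\frac{d\mu}{d\nu}\,d\mu$ if $\mu\ll\nu$ and $+\infty$ otherwise; $\rho^{\otimes k}(x_1,\dots,x_k)=\prod_{i=1}^k\rho(x_i)$. For densities $f,g$, $\|f-g\|_{TV}=\int|f-g|$. $W_1$ (with subscript, not to be confused with the kernel $W$) is the 1-Wasserstein distance for the Euclidean metric. $A\lesssim B$ means $A\le CB$ with $C$ independent of $N$. The convention $1/0=+\infty$ is used if $\|W\|_\infty=0$.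
   Formalization: The Wasserstein estimate is stated only when the minimizer ρ has a finite first moment; without that, W_1 is outside its usual domain, and read as an infimum over couplings it can be infinite for heavy-tailed ρ. *)

theory Defs
  imports "HOL-Probability.Probability"
begin

text \<open>Points of the configuration space are functions \<^term>\<open>x :: nat \<Rightarrow> 'a\<close>, where
  the Euclidean space \<^typ>\<open>'a\<close> plays the role of R^d, restricted to \<^term>\<open>{..<N}\<close>; particles
  are numbered from 0. The product measure below is Lebesgue measure on R^(Nd).\<close>

abbreviation lborel_pow :: "nat \<Rightarrow> (nat \<Rightarrow> 'a::euclidean_space) measure" where
  "lborel_pow N \<equiv> PiM {..<N} (\<lambda>_. lborel)"

definition energy ::
  "('a::euclidean_space \<Rightarrow> real) \<Rightarrow> ('a \<Rightarrow> real) \<Rightarrow> nat \<Rightarrow> (nat \<Rightarrow> 'a) \<Rightarrow> real" where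
  "energy U W N x =
     (\<Sum>i<N. U (x i)) + 1 / (2 * (real N - 1)) * (\<Sum>i<N. \<Sum>j\<in>{..<N} - {i}. W (x i - x j))"

definition partition_fn ::
  "real \<Rightarrow> ('a::euclidean_space \<Rightarrow> real) \<Rightarrow> ('a \<Rightarrow> real) \<Rightarrow> nat \<Rightarrow> real" where
  "partition_fn \<beta> U W N = (LINT x|lborel_pow N. exp (- \<beta> * energy U W N x))"

definition gibbs ::
  "real \<Rightarrow> ('a::euclidean_space \<Rightarrow> real) \<Rightarrow> ('a \<Rightarrow> real) \<Rightarrow> nat \<Rightarrow> (nat \<Rightarrow> 'a) \<Rightarrow> real" where
  "gibbs \<beta> U W N x = exp (- \<beta> * energy U W N x) / partition_fn \<beta> U W N"

text \<open>Meaningful for \<^term>\<open>k \<le> N\<close>: the coordinates \<^term>\<open>{k..<N}\<close> are integrated out.\<close>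

definition marginal ::
  "nat \<Rightarrow> nat \<Rightarrow> ((nat \<Rightarrow> 'a::euclidean_space) \<Rightarrow> real) \<Rightarrow> (nat \<Rightarrow> 'a) \<Rightarrow> real" where
  "marginal N k f x = (LINT y|PiM {k..<N} (\<lambda>_. lborel). f (merge {..<k} {k..<N} (x, y)))"

definition tensor_pow :: "nat \<Rightarrow> ('a \<Rightarrow> real) \<Rightarrow> (nat \<Rightarrow> 'a) \<Rightarrow> real" where
  "tensor_pow k \<rho> x = (\<Prod>i<k. \<rho> (x i))"

definition prob_density :: "('a::euclidean_space \<Rightarrow> real) \<Rightarrow> bool" where
  "prob_density \<rho> \<longleftrightarrow> \<rho> \<in> borel_measurable borel \<and> (\<forall>x. 0 \<le> \<rho> x) \<and>
     integrable lborel \<rho> \<and> (LINT x|lborel. \<rho> x) = 1"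

definition measure_of_density ::
  "nat \<Rightarrow> ((nat \<Rightarrow> 'a::euclidean_space) \<Rightarrow> real) \<Rightarrow> (nat \<Rightarrow> 'a) measure" where
  "measure_of_density k f = density (lborel_pow k) (\<lambda>x. ennreal (f x))"

text \<open>Integral of the positive part minus integral of the negative part. It is only used for
  integrands with integrable negative part, so that the value lies in (-\<infinity>, \<infinity>].\<close>

definition ext_integral :: "'b measure \<Rightarrow> ('b \<Rightarrow> real) \<Rightarrow> ereal" where
  "ext_integral M f =
     enn2ereal (\<integral>\<^sup>+x. ennreal (f x) \<partial>M) - enn2ereal (\<integral>\<^sup>+x. ennreal (- f x) \<partial>M)"

definition convol :: "('a::euclidean_space \<Rightarrow> real) \<Rightarrow> ('a \<Rightarrow> real) \<Rightarrow> 'a \<Rightarrow> real" where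
  "convol W \<rho> x = (LINT y|lborel. W (x - y) * \<rho> y)"

text \<open>The library value \<^prop>\<open>ln 0 = (0::real)\<close> gives the usual convention 0 log 0 = 0.\<close>

definition free_energy ::
  "real \<Rightarrow> ('a::euclidean_space \<Rightarrow> real) \<Rightarrow> ('a \<Rightarrow> real) \<Rightarrow> ('a \<Rightarrow> real) \<Rightarrow> ereal" where
  "free_energy \<beta> U W \<rho> =
     ext_integral lborel (\<lambda>x. U x * \<rho> x + 1 / \<beta> * (\<rho> x * ln (\<rho> x)))
     + ereal (1 / 2 * (LINT x|lborel. \<rho> x * convol W \<rho> x))"

definition free_energy_minimizer ::
  "real \<Rightarrow> ('a::euclidean_space \<Rightarrow> real) \<Rightarrow> ('a \<Rightarrow> real) \<Rightarrow> ('a \<Rightarrow> real) \<Rightarrow> bool" where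
  "free_energy_minimizer \<beta> U W \<rho> \<longleftrightarrow>
     prob_density \<rho> \<and> (\<forall>\<sigma>. prob_density \<sigma> \<longrightarrow> free_energy \<beta> U W \<rho> \<le> free_energy \<beta> U W \<sigma>)"

text \<open>In \<^const>\<open>absolutely_continuous\<close> and \<^const>\<open>RN_deriv\<close> the reference measure comes first.
  The derivative is finite almost everywhere when both measures are finite.\<close>

definition rel_entropy :: "'b measure \<Rightarrow> 'b measure \<Rightarrow> ereal" where
  "rel_entropy \<mu> \<nu> =
     (if absolutely_continuous \<nu> \<mu>
      then ext_integral \<mu> (\<lambda>x. ln (enn2real (RN_deriv \<nu> \<mu> x)))
      else \<infinity>)"

definition tv_dist ::
  "nat \<Rightarrow> ((nat \<Rightarrow> 'a::euclidean_space) \<Rightarrow> real) \<Rightarrow> ((nat \<Rightarrow> 'a) \<Rightarrow> real) \<Rightarrow> ereal" where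
  "tv_dist k f g = enn2ereal (\<integral>\<^sup>+x. ennreal \<bar>f x - g x\<bar> \<partial>lborel_pow k)"

text \<open>Square root on [0, \<infinity>].\<close>

definition sqrt_ereal :: "ereal \<Rightarrow> ereal" where
  "sqrt_ereal x = (if x = \<infinity> then \<infinity> else ereal (sqrt (real_of_ereal x)))"

definition Linf_norm :: "('a::euclidean_space \<Rightarrow> real) \<Rightarrow> ereal" where
  "Linf_norm W = esssup lborel (\<lambda>x. ereal \<bar>W x\<bar>)"

definition couplings ::
  "'a::euclidean_space measure \<Rightarrow> 'a measure \<Rightarrow> ('a \<times> 'a) measure set" where
  "couplings \<mu> \<nu> =
     {\<gamma>. sets \<gamma> = sets (borel \<Otimes>\<^sub>M borel) \<and> distr \<gamma> borel fst = \<mu> \<and> distr \<gamma> borel snd = \<nu>}"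

definition wasserstein1 :: "'a::euclidean_space measure \<Rightarrow> 'a measure \<Rightarrow> ennreal" where
  "wasserstein1 \<mu> \<nu> = (INF \<gamma>\<in>couplings \<mu> \<nu>. \<integral>\<^sup>+z. ennreal (dist (fst z) (snd z)) \<partial>\<gamma>)"

text \<open>Membership in P_1(R^d), the set of probability measures on which the 1-Wasserstein
  distance is defined.\<close>

definition finite_first_moment :: "'a::euclidean_space measure \<Rightarrow> bool" where
  "finite_first_moment \<mu> \<longleftrightarrow> (\<integral>\<^sup>+x. ennreal (norm x) \<partial>\<mu>) < \<infinity>"

end

theory Submission
  imports Defs
begin

text \<open>
  A minimizer satisfies the Euler-Lagrange equation \<open>\<rho> = exp (- \<beta> (U + W * \<rho>)) / Z\<^sub>\<rho>\<close>: on the segment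
  from \<open>\<rho>\<close> to the right-hand side \<open>\<sigma>\<close> the free energy decreases to first order by \<open>H(\<rho> | \<sigma>) / \<beta>\<close>.
  Hence the density of the Gibbs measure relative to the \<open>N\<close>-th tensor power of \<open>\<rho>\<close> is \<open>exp G / Z\<close>,
  where \<open>G = \<beta> / (2 (N - 1)) (\<Sum>i\<noteq>j. \<phi> (x i) (x j))\<close> is a U-statistic whose bounded kernel \<open>\<phi>\<close> has mean
  zero in each variable. Jensen's inequality gives \<open>1 \<le> Z\<close>, so the relative entropy is at most the
  expectation of \<open>G exp G \<le> exp (2 G)\<close> under the tensor power.

  This expectation is bounded uniformly in \<open>N\<close>: decoupling over random cuts of the index set makes
  one half of the variables independent of the other; conditionally on one half, the exponential moment
  is controlled by that of the square of a centred sum, which is sub-Gaussian by Hoeffding's lemma.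
  The argument needs \<open>2 \<surd>2 p \<beta> \<parallel>W\<parallel> < 1\<close> for the moment \<open>exp (p G)\<close>, up to a factor tending to 1, and the
  factor \<open>e > 2\<close> in the hypothesis leaves room for \<open>p = 2\<close>.

  The passage to \<open>k\<close> particles is Han's inequality: by exchangeability the entropies \<open>h k\<close> of the
  marginals form a convex sequence, so \<open>h k / k\<close> increases. The total variation bound is Pinsker's
  inequality. For the Wasserstein bound, the density of the first marginal relative to \<open>\<rho>\<close> is
  \<open>1 + O(1 / sqrt N)\<close> uniformly in space, so a finite first moment of \<open>\<rho>\<close> suffices.
\<close>

section \<open>Entropy inequalities\<close>

text \<open>Degeneracy keeps the moments bounded: \<open>G\<close> has about N^2 terms with a
  prefactor of order 1/N, so a kernel with nonzero one-variable means would give exponents growing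
  with N. Subtracting those means is possible because they assemble to the field in the
  Euler-Lagrange equation. The threshold arises as follows: the subtracted kernel oscillates by at
  most 4 L in one variable, L being the sup norm, and s = \<beta> / (2 (N - 1)), so the condition 2
  (p s)^2 N^2 (4 L)^2 < 1 of \<open>exp_ustat\<close> tends to 8 p^2 \<beta>^2 L^2 < 1. The value p
  = 2 serves twice: for the entropy integrand and for the square of exp G in the one-particle
  estimate. For each N the density relative to the product is bounded above and away from 0; these
  bounds are not uniform in N, but they make all entropies integrals of bounded functions. Since
  \<open>W\<close> is bounded and even only almost everywhere, it is exchanged for a pointwise
  version; this alters the Gibbs density on a null set, so the final estimates speak of any density
  \<open>f\<close> of the same measure.\<close>

lemma young_exp_ineq:
  fixes a y :: real
  assumes "0 \<le> a"
  shows "a * y \<le> a * ln a - a + exp y"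
proof (cases "a = 0")
  case False
  with assms have a: "a > 0" by simp
  have "1 + (y - ln a) \<le> exp (y - ln a)" by (rule exp_ge_add_one_self)
  also have "\<dots> = exp y / a" using a by (simp add: exp_diff)
  finally have "a * (1 + (y - ln a)) \<le> a * (exp y / a)" using a by (intro mult_left_mono) auto
  with a show ?thesis by (simp add: algebra_simps)
qed simp

lemma (in prob_space) integrable_bounded:
  fixes f :: "'a \<Rightarrow> real"
  assumes "f \<in> borel_measurable M" "\<And>x. x \<in> space M \<Longrightarrow> \<bar>f x\<bar> \<le> B"
  shows "integrable M f"
  by (rule integrable_const_bound[where B = B]) (use assms in auto)

lemma (in prob_space) integral_le_const':
  fixes f :: "'a \<Rightarrow> real"
  assumes "integrable M f" "\<And>x. x \<in> space M \<Longrightarrow> f x \<le> B"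
  shows "expectation f \<le> B"
  using assms by (intro integral_le_const) auto

text \<open>Only the length \<open>b\<close> of the range enters, not its position, so a negative
  \<open>t\<close> is reduced to a positive one by passing to \<open>- f\<close>.\<close>

lemma (in prob_space) hoeffding_mgf:
  fixes f :: "'a \<Rightarrow> real"
  assumes [measurable]: "f \<in> borel_measurable M"
    and bd: "\<And>x. x \<in> space M \<Longrightarrow> f x \<in> {c..c + b}" and mean: "expectation f = 0"
  shows "expectation (\<lambda>x. exp (t * f x)) \<le> exp (t\<^sup>2 * b\<^sup>2 / 8)"
proof -
  have pos: "expectation (\<lambda>x. exp (s * g x)) \<le> exp (s\<^sup>2 * b\<^sup>2 / 8)"
    if [measurable]: "g \<in> borel_measurable M" and bdg: "\<And>x. x \<in> space M \<Longrightarrow> g x \<in> {e..e + b}"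
      and mg: "expectation g = 0" and s: "s > 0" for g :: "'a \<Rightarrow> real" and s e
  proof -
    interpret I: interval_bounded_random_variable M g e "e + b"
      by unfold_locales (use bdg in auto)
    have le: "(\<integral>\<^sup>+x. exp (s * g x) \<partial>M) \<le> ennreal (exp (s\<^sup>2 * b\<^sup>2 / 8))"
      using I.Hoeffdings_lemma_nn_integral_0[OF s mg] by simp
    have "expectation (\<lambda>x. exp (s * g x)) = enn2real (\<integral>\<^sup>+x. exp (s * g x) \<partial>M)"
      by (rule integral_eq_nn_integral) auto
    also have "\<dots> \<le> enn2real (ennreal (exp (s\<^sup>2 * b\<^sup>2 / 8)))"
      using le by (intro enn2real_mono) auto
    finally show ?thesis by simp
  qed
  consider "t > 0" | "t = 0" | "t < 0" by linarith
  then show ?thesis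
  proof cases
    case 1 then show ?thesis using pos[of f c t] bd mean by simp
  next
    case 2 then show ?thesis by (simp add: prob_space)
  next
    case 3
    have "expectation (\<lambda>x. exp (- t * (- f x))) \<le> exp ((- t)\<^sup>2 * b\<^sup>2 / 8)"
      using pos[of "\<lambda>x. - f x" "- c - b" "- t"] 3 bd mean by (auto simp: algebra_simps)
    then show ?thesis by simp
  qed
qed

text \<open>By duality, the entropy dominates the mean of \<open>r * y\<close> for every bounded
  \<open>y\<close> such that \<open>exp y\<close> has mean at most 1. The test function is affine in
  the sign of \<open>r - 1\<close>, and Hoeffding's lemma provides its normalization.\<close>

lemma (in prob_space) pinsker:
  fixes r :: "'a \<Rightarrow> real"
  assumes r: "integrable M r" "expectation r = 1" "\<And>x. 0 \<le> r x"
    and ent: "integrable M (\<lambda>x. r x * ln (r x))"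
  shows "(expectation (\<lambda>x. \<bar>r x - 1\<bar>))\<^sup>2 \<le> 2 * expectation (\<lambda>x. r x * ln (r x))"
proof -
  have [measurable]: "r \<in> borel_measurable M" using r by auto
  define f where "f x = (if r x \<ge> 1 then 1 else - 1 :: real)" for x
  have [measurable]: "f \<in> borel_measurable M" unfolding f_def by measurable
  have fb: "\<bar>f x\<bar> = 1" for x by (simp add: f_def)
  have intf: "integrable M f" by (rule integrable_bounded[where B = 1]) (simp_all add: fb)
  have intrf: "integrable M (\<lambda>x. r x * f x)"
    by (rule Bochner_Integration.integrable_bound[OF r(1)]) (auto simp: abs_mult fb)
  define m where "m = expectation f"
  define \<delta> where "\<delta> = expectation (\<lambda>x. \<bar>r x - 1\<bar>)"
  have \<delta>: "\<delta> = expectation (\<lambda>x. r x * f x) - m"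
  proof -
    have "\<delta> = expectation (\<lambda>x. r x * f x - f x)"
      unfolding \<delta>_def by (intro Bochner_Integration.integral_cong) (auto simp: f_def)
    then show ?thesis using intrf intf by (simp add: m_def)
  qed
  \<comment> \<open>The slope \<open>\<delta>\<close> maximizes t \<delta> - t^2 / 2 over t; the
    subtracted \<open>\<delta>\<^sup>2 / 2\<close> is Hoeffding's exponent for a function with range
    of length 2.\<close>
  define y where "y x = \<delta> * (f x - m) - \<delta>\<^sup>2 / 2" for x
  have [measurable]: "y \<in> borel_measurable M" unfolding y_def by measurable
  have "expectation (\<lambda>x. exp (\<delta> * (f x - m))) \<le> exp (\<delta>\<^sup>2 * 2\<^sup>2 / 8)"
  proof (rule hoeffding_mgf)
    show "f x - m \<in> {- 1 - m..- 1 - m + 2}" for x using fb[of x] by auto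
    show "expectation (\<lambda>x. f x - m) = 0" using intf by (simp add: m_def prob_space)
  qed measurable
  then have "expectation (\<lambda>x. exp (\<delta> * (f x - m))) * exp (- (\<delta>\<^sup>2 / 2)) \<le> exp (\<delta>\<^sup>2 * 2\<^sup>2 / 8) * exp (- (\<delta>\<^sup>2 / 2))"
    by (rule mult_right_mono) simp
  moreover have eyx: "exp (y x) = exp (\<delta> * (f x - m)) * exp (- (\<delta>\<^sup>2 / 2))" for x
    unfolding y_def exp_add[symmetric] by simp
  then have "expectation (\<lambda>x. exp (y x)) = expectation (\<lambda>x. exp (\<delta> * (f x - m))) * exp (- (\<delta>\<^sup>2 / 2))"
    by simp
  moreover have "exp (\<delta>\<^sup>2 * 2\<^sup>2 / 8) * exp (- (\<delta>\<^sup>2 / 2)) = 1"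
    by (simp flip: exp_add)
  ultimately have ey: "expectation (\<lambda>x. exp (y x)) \<le> 1"
    by linarith
  have y_bd: "\<bar>y x\<bar> \<le> \<bar>\<delta>\<bar> * (1 + \<bar>m\<bar>) + \<delta>\<^sup>2 / 2" for x
  proof -
    have "\<bar>y x\<bar> \<le> \<bar>\<delta>\<bar> * \<bar>f x - m\<bar> + \<delta>\<^sup>2 / 2" unfolding y_def abs_mult[symmetric]
      by (rule order_trans[OF abs_triangle_ineq4]) simp
    also have "\<dots> \<le> \<bar>\<delta>\<bar> * (1 + \<bar>m\<bar>) + \<delta>\<^sup>2 / 2"
      using fb[of x] by (intro add_right_mono mult_left_mono) auto
    finally show ?thesis .
  qed
  have inty: "integrable M (\<lambda>x. exp (y x))"
    by (rule integrable_bounded[where B = "exp (\<bar>\<delta>\<bar> * (1 + \<bar>m\<bar>) + \<delta>\<^sup>2 / 2)"])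
       (use y_bd in \<open>auto simp: abs_le_iff\<close>)
  have ry: "r x * y x = \<delta> * (r x * f x) - (\<delta> * m + \<delta>\<^sup>2 / 2) * r x" for x
    by (simp add: y_def algebra_simps)
  have int_ry: "integrable M (\<lambda>x. r x * y x)"
    unfolding ry using intrf r by simp
  \<comment> \<open>Pointwise duality of a ln a - a and exp, at a = \<open>r x\<close>; the term
    \<open>- r x\<close> has mean -1 and cancels the mean of \<open>exp y\<close>, which is at most
    1. The left-hand side evaluates to \<open>\<delta>\<^sup>2 / 2\<close>.\<close>
  have "expectation (\<lambda>x. r x * y x) \<le> expectation (\<lambda>x. r x * ln (r x) - r x + exp (y x))"
    using r(1,3) ent inty int_ry by (intro integral_mono) (auto simp: young_exp_ineq)
  also have "\<dots> \<le> expectation (\<lambda>x. r x * ln (r x))"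
    using ent inty r ey by simp
  also have "expectation (\<lambda>x. r x * y x) = \<delta> * (\<delta> + m) - (\<delta> * m + \<delta>\<^sup>2 / 2)"
    using intrf r \<delta> unfolding ry by simp
  finally show ?thesis unfolding \<delta>_def[symmetric] by (simp add: algebra_simps power2_eq_square)
qed

section \<open>Product spaces\<close>

text \<open>Both arguments may be points of the full product, so marginals on all index subsets
  become functions on one common space and can be multiplied and compared there.\<close>

definition mix :: "nat set \<Rightarrow> nat set \<Rightarrow> (nat \<Rightarrow> 'b) \<Rightarrow> (nat \<Rightarrow> 'b) \<Rightarrow> nat \<Rightarrow> 'b" where
  "mix I S x y = (\<lambda>i\<in>I. if i \<in> S then x i else y i)"

lemma mix_apply: "i \<in> I \<Longrightarrow> mix I S x y i = (if i \<in> S then x i else y i)"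
  by (simp add: mix_def)

lemma measurable_mix[measurable (raw)]:
  assumes S: "S \<subseteq> J" and f: "f \<in> measurable N (PiM J (\<lambda>_. M))" and g: "g \<in> measurable N (PiM I (\<lambda>_. M))"
  shows "(\<lambda>w. mix I S (f w) (g w)) \<in> measurable N (PiM I (\<lambda>_. M))"
  unfolding mix_def
proof (rule measurable_restrict)
  fix i assume i: "i \<in> I"
  have 1: "(\<lambda>w. g w i) \<in> measurable N M"
    using measurable_compose[OF g measurable_component_singleton[OF i]] .
  have 2: "(\<lambda>w. f w i) \<in> measurable N M" if "i \<in> S"
    using measurable_compose[OF f measurable_component_singleton[of i J]] that S by auto
  show "(\<lambda>w. if i \<in> S then f w i else g w i) \<in> measurable N M"
    by (cases "i \<in> S") (use 1 2 in auto)
qed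

text \<open>Only indices in both sets keep their value from \<open>x\<close>. This is the pointwise
  form of the rule that conditioning on two index sets in turn amounts to conditioning on their
  intersection.\<close>

lemma mix_mix: "mix I S (mix I T x y) z = mix I (S \<inter> T) x (mix I S y z)"
  by (auto simp: mix_def fun_eq_iff)

lemma mix_in_space: 
  assumes "S \<subseteq> J" "x \<in> space (PiM J (\<lambda>_. M))" "y \<in> space (PiM I (\<lambda>_. M))"
  shows "mix I S x y \<in> space (PiM I (\<lambda>_. M))"
  using assms by (auto simp: space_PiM mix_def PiE_iff)

locale iid = M: prob_space M for M :: "'b measure" +
  fixes I :: "nat set"
  assumes fin: "finite I"
begin

sublocale Pr: product_prob_space "\<lambda>_::nat. M" I
  by (rule product_prob_spaceI) (rule M.prob_space_axioms)

abbreviation P :: "(nat \<Rightarrow> 'b) measure" where "P \<equiv> PiM I (\<lambda>_. M)"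

lemma sigma_finite_P: "sigma_finite_measure P"
  by (rule prob_space_imp_sigma_finite) (rule prob_space_PiM, rule M.prob_space_axioms)

sublocale PP: pair_prob_space P P ..

text \<open>Resampling the coordinates outside \<open>S\<close> independently does not change a
  product measure: the preimage of a box is a product of two boxes, each with the whole space in the
  coordinates that it does not control.\<close>

lemma distr_mix:
  assumes S: "S \<subseteq> I"
  shows "distr (P \<Otimes>\<^sub>M P) P (\<lambda>(x, y). mix I S x y) = P"
proof (rule Pr.PiM_eqI[OF fin])
  have [measurable]: "(\<lambda>(x, y). mix I S x y) \<in> measurable (P \<Otimes>\<^sub>M P) P"
    using S by measurable
  fix A :: "nat \<Rightarrow> 'b set" assume A: "\<And>i. i \<in> I \<Longrightarrow> A i \<in> sets M"
  have ms: "Pi\<^sub>E I B \<in> sets P" if "\<And>i. i \<in> I \<Longrightarrow> B i \<in> sets M" for B :: "nat \<Rightarrow> 'b set"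
    using that fin by (intro sets_PiM_I_finite) auto
  define B C where "B i = (if i \<in> S then A i else space M)" and "C i = (if i \<in> S then space M else A i)" for i
  have BC: "B i \<in> sets M" "C i \<in> sets M" if "i \<in> I" for i using A that by (auto simp: B_def C_def)
  have sub: "A i \<subseteq> space M" if "i \<in> I" for i using sets.sets_into_space[OF A[OF that]] .
  have "emeasure (distr (P \<Otimes>\<^sub>M P) P (\<lambda>(x, y). mix I S x y)) (Pi\<^sub>E I A) =
     emeasure (P \<Otimes>\<^sub>M P) ((\<lambda>(x, y). mix I S x y) -` Pi\<^sub>E I A \<inter> space (P \<Otimes>\<^sub>M P))"
    by (rule emeasure_distr) (use ms[OF A] in auto)
  also have "(\<lambda>(x, y). mix I S x y) -` Pi\<^sub>E I A \<inter> space (P \<Otimes>\<^sub>M P) = Pi\<^sub>E I B \<times> Pi\<^sub>E I C"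
  proof (intro set_eqI iffI)
    fix z assume "z \<in> (\<lambda>(x, y). mix I S x y) -` Pi\<^sub>E I A \<inter> space (P \<Otimes>\<^sub>M P)"
    then obtain x y where z: "z = (x, y)" "mix I S x y \<in> Pi\<^sub>E I A" "x \<in> Pi\<^sub>E I (\<lambda>_. space M)" "y \<in> Pi\<^sub>E I (\<lambda>_. space M)"
      by (cases z) (auto simp: space_pair_measure space_PiM)
    have "i \<in> S \<Longrightarrow> x i \<in> A i" "i \<notin> S \<Longrightarrow> y i \<in> A i" if "i \<in> I" for i
      using PiE_mem[OF z(2) that] that by (simp_all add: mix_apply)
    then show "z \<in> Pi\<^sub>E I B \<times> Pi\<^sub>E I C"
      using z(1,3,4) by (auto simp: B_def C_def PiE_iff split: if_splits)
  next
    fix z assume "z \<in> Pi\<^sub>E I B \<times> Pi\<^sub>E I C"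
    then obtain x y where z: "z = (x, y)" "x \<in> Pi\<^sub>E I B" "y \<in> Pi\<^sub>E I C" by auto
    have x: "x i \<in> B i" "y i \<in> C i" if "i \<in> I" for i using z that by auto
    have "x i \<in> space M" "y i \<in> space M" if "i \<in> I" for i 
      using x[OF that] sub[OF that] by (auto simp: B_def C_def split: if_splits)
    moreover have "mix I S x y \<in> Pi\<^sub>E I A"
      using x by (fastforce simp: mix_def B_def C_def)
    ultimately show "z \<in> (\<lambda>(x, y). mix I S x y) -` Pi\<^sub>E I A \<inter> space (P \<Otimes>\<^sub>M P)"
      using z by (auto simp: space_pair_measure space_PiM PiE_iff)
  qed
  also have "emeasure (P \<Otimes>\<^sub>M P) (Pi\<^sub>E I B \<times> Pi\<^sub>E I C) = emeasure P (Pi\<^sub>E I B) * emeasure P (Pi\<^sub>E I C)"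
    by (rule sigma_finite_measure.emeasure_pair_measure_Times[OF sigma_finite_P]) (use ms BC in auto)
  also have "\<dots> = (\<Prod>i\<in>I. emeasure M (B i)) * (\<Prod>i\<in>I. emeasure M (C i))"
    using fin BC by (simp add: Pr.emeasure_PiM)
  also have "\<dots> = (\<Prod>i\<in>I. emeasure M (A i))"
    unfolding prod.distrib[symmetric]
    by (intro prod.cong) (auto simp: B_def C_def M.emeasure_space_1)
  finally show "emeasure (distr (P \<Otimes>\<^sub>M P) P (\<lambda>(x, y). mix I S x y)) (Pi\<^sub>E I A) = (\<Prod>i\<in>I. emeasure M (A i))" .
qed simp

lemma integral_mix:
  fixes f :: "(nat \<Rightarrow> 'b) \<Rightarrow> real"
  assumes S: "S \<subseteq> I" and f: "integrable P f"
  shows "(\<integral>x. f x \<partial>P) = (\<integral>x. \<integral>y. f (mix I S x y) \<partial>P \<partial>P)"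
proof -
  have [measurable]: "f \<in> borel_measurable P" using f by auto
  have [measurable]: "(\<lambda>(x, y). mix I S x y) \<in> measurable (P \<Otimes>\<^sub>M P) P"
    using S by measurable
  have "integrable (P \<Otimes>\<^sub>M P) (\<lambda>z. f ((\<lambda>(x, y). mix I S x y) z))"
    by (rule integrable_distr[of _ _ P]) (use f in \<open>auto simp: distr_mix[OF S]\<close>)
  then have int: "integrable (P \<Otimes>\<^sub>M P) (\<lambda>(x, y). f (mix I S x y))" by (simp add: case_prod_beta')
  have "(\<integral>x. f x \<partial>P) = (\<integral>x. f x \<partial>distr (P \<Otimes>\<^sub>M P) P (\<lambda>(x, y). mix I S x y))"
    by (simp add: distr_mix[OF S])
  also have "\<dots> = (\<integral>z. (\<lambda>(x, y). f (mix I S x y)) z \<partial>(P \<Otimes>\<^sub>M P))"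
    by (subst integral_distr) (auto simp: case_prod_beta')
  also have "\<dots> = (\<integral>x. \<integral>y. f (mix I S x y) \<partial>P \<partial>P)"
    using PP.integral_fst'[OF int] by simp
  finally show ?thesis .
qed

lemma integral_comp_perm:
  fixes f :: "(nat \<Rightarrow> 'b) \<Rightarrow> real"
  assumes \<tau>: "bij_betw \<tau> I I" and [measurable]: "f \<in> borel_measurable P"
  shows "(\<integral>x. f (\<lambda>i\<in>I. x (\<tau> i)) \<partial>P) = (\<integral>x. f x \<partial>P)"
proof -
  have [measurable]: "(\<lambda>x. \<lambda>i\<in>I. x (\<tau> i)) \<in> measurable P P"
    using \<tau> by (intro measurable_restrict measurable_component_singleton) (auto dest: bij_betwE)
  have "distr P P (\<lambda>x. \<lambda>i\<in>I. x (\<tau> i)) = P"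
    using distr_PiM_reindex[of I "\<lambda>_. M" \<tau> I] \<tau> M.prob_space_axioms
    by (auto simp: bij_betw_def)
  then have "(\<integral>x. f x \<partial>P) = (\<integral>x. f x \<partial>distr P P (\<lambda>x. \<lambda>i\<in>I. x (\<tau> i)))" by simp
  also have "\<dots> = (\<integral>x. f (\<lambda>i\<in>I. x (\<tau> i)) \<partial>P)"
    by (rule integral_distr) auto
  finally show ?thesis by simp
qed

lemma integral_component:
  fixes f :: "'b \<Rightarrow> real"
  assumes i: "i \<in> I" and [measurable]: "f \<in> borel_measurable M"
  shows "(\<integral>x. f (x i) \<partial>P) = (\<integral>x. f x \<partial>M)"
proof -
  have d: "distr P M (\<lambda>x. x i) = M"
    using distr_PiM_component[of I "\<lambda>_. M" i] i M.prob_space_axioms by auto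
  have "(\<integral>x. f x \<partial>M) = (\<integral>x. f x \<partial>distr P M (\<lambda>x. x i))" by (simp add: d)
  also have "\<dots> = (\<integral>x. f (x i) \<partial>P)" by (rule integral_distr) (use i in auto)
  finally show ?thesis by simp
qed

lemma integral_prod_subset:
  fixes f :: "nat \<Rightarrow> 'b \<Rightarrow> real"
  assumes S: "S \<subseteq> I" and f: "\<And>i. i \<in> S \<Longrightarrow> integrable M (f i)"
  shows "(\<integral>x. (\<Prod>i\<in>S. f i (x i)) \<partial>P) = (\<Prod>i\<in>S. \<integral>x. f i x \<partial>M)"
proof -
  define g where "g i = (if i \<in> S then f i else (\<lambda>_. 1))" for i
  have "(\<integral>x. (\<Prod>i\<in>I. g i (x i)) \<partial>P) = (\<Prod>i\<in>I. \<integral>x. g i x \<partial>M)"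
    by (rule Pr.product_integral_prod[OF fin]) (use f in \<open>auto simp: g_def\<close>)
  moreover have "(\<Prod>i\<in>I. g i (x i)) = (\<Prod>i\<in>S. f i (x i))" for x
    by (rule prod.mono_neutral_cong_right) (use S fin in \<open>auto simp: g_def\<close>)
  moreover have "(\<Prod>i\<in>I. \<integral>x. g i x \<partial>M) = (\<Prod>i\<in>S. \<integral>x. f i x \<partial>M)"
    by (rule prod.mono_neutral_cong_right) (use S fin in \<open>auto simp: g_def M.prob_space\<close>)
  ultimately show ?thesis by simp
qed

end

section \<open>Exponential moments of degenerate U-statistics\<close>

text \<open>Meant for centred \<open>z\<close>: the linear term integrates to 0 and a first-order
  exponential moment becomes one of the square. On [-1, 1] the intermediate bound is 1 + z +
  z^2.\<close>

lemma exp_le_add_exp_square: "exp z \<le> z + exp (z\<^sup>2)" for z :: real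
proof -
  have sq: "1 + z\<^sup>2 \<le> exp (z\<^sup>2)" by (rule exp_ge_add_one_self)
  consider "z \<ge> 1" | "0 \<le> z" "z \<le> 1" | "- 1 \<le> z" "z \<le> 0" | "z \<le> - 1" by linarith
  then show ?thesis
  proof cases
    case 1
    then have "z \<le> z\<^sup>2" by (simp add: power2_eq_square)
    then have "exp z \<le> exp (z\<^sup>2)" by simp
    with 1 show ?thesis by linarith
  next
    case 2
    then have "exp z \<le> 1 + z + z\<^sup>2" by (rule exp_bound)
    with sq show ?thesis by linarith
  next
    case 3
    have "1 - z \<le> exp (- z)" using exp_ge_add_one_self[of "- z"] by simp
    then have "exp z * (1 - z) \<le> exp z * exp (- z)" by (intro mult_left_mono) auto
    then have "exp z * (1 - z) \<le> 1" by (simp flip: exp_add)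
    also have "1 \<le> (1 + z + z\<^sup>2) * (1 - z)"
    proof -
      have "(1 + z + z\<^sup>2) * (1 - z) = 1 + (- z) ^ 3" by (simp add: algebra_simps power2_eq_square power3_eq_cube)
      moreover have "(- z) ^ 3 \<ge> 0" using 3 by (intro zero_le_power) auto
      ultimately show ?thesis by simp
    qed
    finally have "exp z \<le> 1 + z + z\<^sup>2" using 3 by (simp add: mult_le_cancel_right)
    with sq show ?thesis by linarith
  next
    case 4
    then have "0 \<le> z * (z + 1)" by (intro mult_nonpos_nonpos) auto
    then have "0 \<le> z + z\<^sup>2" by (simp add: power2_eq_square algebra_simps)
    then have "1 \<le> z + exp (z\<^sup>2)" using sq by linarith
    moreover have "exp z \<le> 1" using 4 by simp
    ultimately show ?thesis by linarith
  qed
qed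

section \<open>Exponential moments of squares by Gaussian linearization\<close>

lemma nn_integral_normal_density: "\<sigma> > 0 \<Longrightarrow> (\<integral>\<^sup>+x. ennreal (normal_density \<mu> \<sigma> x) \<partial>lborel) = 1"
  by (subst nn_integral_eq_integral) auto

lemma nn_integral_std_normal_exp:
  "(\<integral>\<^sup>+x. ennreal (std_normal_density x * exp (u * x)) \<partial>lborel) = ennreal (exp (u\<^sup>2 / 2))"
proof -
  have "std_normal_density x * exp (u * x) = exp (u\<^sup>2 / 2) * normal_density u 1 x" for x
  proof -
    have "- x\<^sup>2 / 2 + u * x = u\<^sup>2 / 2 + - (x - u)\<^sup>2 / 2"
      by (simp add: power2_eq_square field_simps)
    then have "exp (- x\<^sup>2 / 2) * exp (u * x) = exp (u\<^sup>2 / 2) * exp (- (x - u)\<^sup>2 / 2)"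
      unfolding exp_add[symmetric] by simp
    then show ?thesis by (simp add: normal_density_def)
  qed
  then show ?thesis
    by (simp add: ennreal_mult nn_integral_cmult nn_integral_normal_density)
qed

lemma nn_integral_std_normal_exp_square:
  assumes "c < 1"
  shows "(\<integral>\<^sup>+x. ennreal (std_normal_density x * exp (c * x\<^sup>2 / 2)) \<partial>lborel) = ennreal (1 / sqrt (1 - c))"
proof -
  define \<sigma> where "\<sigma> = 1 / sqrt (1 - c)"
  have \<sigma>: "\<sigma> > 0" "\<sigma>\<^sup>2 = 1 / (1 - c)" using assms by (auto simp: \<sigma>_def power_divide)
  have "std_normal_density x * exp (c * x\<^sup>2 / 2) = \<sigma> * normal_density 0 \<sigma> x" for x
  proof -
    have "- x\<^sup>2 / 2 + c * x\<^sup>2 / 2 = - (x\<^sup>2) / (2 * \<sigma>\<^sup>2)"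
      using assms by (simp add: \<sigma>(2) field_simps)
    then have "exp (- x\<^sup>2 / 2) * exp (c * x\<^sup>2 / 2) = exp (- (x\<^sup>2) / (2 * \<sigma>\<^sup>2))"
      unfolding exp_add[symmetric] by simp
    moreover have "sqrt (2 * pi * \<sigma>\<^sup>2) = sqrt (2 * pi) * \<sigma>" using \<sigma>(1) by (simp only: real_sqrt_mult real_sqrt_abs abs_of_pos)
    ultimately show ?thesis using \<sigma>(1) by (simp add: normal_density_def)
  qed
  then have "(\<integral>\<^sup>+x. ennreal (std_normal_density x * exp (c * x\<^sup>2 / 2)) \<partial>lborel) = ennreal \<sigma>"
    using \<sigma>(1) by (simp add: ennreal_mult nn_integral_cmult nn_integral_normal_density)
  then show ?thesis by (simp add: \<sigma>_def)
qed

text \<open>The square is linearized: exp (a S^2) is the mean of exp (sqrt (2 a) S g) over a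
  standard Gaussian \<open>g\<close>. After Tonelli the assumed bound on the moment generating
  function applies for each \<open>g\<close>, and what remains is a Gaussian integral, finite
  exactly when 2 a v < 1.\<close>

lemma (in prob_space) exp_square_subgaussian:
  fixes S :: "'a \<Rightarrow> real"
  assumes [measurable]: "S \<in> borel_measurable M" and bd: "\<And>x. \<bar>S x\<bar> \<le> B"
    and mgf: "\<And>t. expectation (\<lambda>x. exp (t * S x)) \<le> exp (t\<^sup>2 * v / 2)"
    and a: "0 \<le> a" "2 * a * v < 1"
  shows "expectation (\<lambda>x. exp (a * (S x)\<^sup>2)) \<le> 1 / sqrt (1 - 2 * a * v)"
proof -
  interpret L: pair_sigma_finite M lborel ..
  let ?J = "\<integral>\<^sup>+x. ennreal (exp (a * (S x)\<^sup>2)) \<partial>M"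
  let ?E = "\<lambda>g. \<integral>\<^sup>+x. ennreal (std_normal_density g * exp (sqrt (2 * a) * S x * g)) \<partial>M"
  have int: "integrable M (\<lambda>x. exp (t * S x))" for t
  proof (rule integrable_bounded)
    have "\<bar>t * S x\<bar> \<le> \<bar>t\<bar> * B" for x unfolding abs_mult by (intro mult_left_mono bd) auto
    then show "\<bar>exp (t * S x)\<bar> \<le> exp (\<bar>t\<bar> * B)" for x by (simp add: abs_le_iff)
  qed measurable
  have "?J
      = (\<integral>\<^sup>+x. (\<integral>\<^sup>+g. ennreal (std_normal_density g * exp (sqrt (2 * a) * S x * g)) \<partial>lborel) \<partial>M)"
    unfolding nn_integral_std_normal_exp using a by (simp add: power_mult_distrib)
  also have "\<dots> = (\<integral>\<^sup>+g. ?E g \<partial>lborel)"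
    by (rule L.Fubini'[symmetric]) measurable
  also have "\<dots> \<le> (\<integral>\<^sup>+g. ennreal (std_normal_density g * exp ((2 * a * v) * g\<^sup>2 / 2)) \<partial>lborel)"
  proof (rule nn_integral_mono)
    fix g :: real
    have "?E g
       = ennreal (std_normal_density g) * (\<integral>\<^sup>+x. ennreal (exp ((sqrt (2 * a) * g) * S x)) \<partial>M)"
      by (simp add: ennreal_mult nn_integral_cmult mult_ac)
    also have "(\<integral>\<^sup>+x. ennreal (exp ((sqrt (2 * a) * g) * S x)) \<partial>M) = ennreal (expectation (\<lambda>x. exp ((sqrt (2 * a) * g) * S x)))"
      by (rule nn_integral_eq_integral[OF int]) simp
    also have "\<dots> \<le> ennreal (exp ((sqrt (2 * a) * g)\<^sup>2 * v / 2))"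
      by (intro ennreal_leI mgf)
    also have "(sqrt (2 * a) * g)\<^sup>2 * v / 2 = (2 * a * v) * g\<^sup>2 / 2"
      using a by (simp add: power_mult_distrib)
    finally show "?E g
       \<le> ennreal (std_normal_density g * exp ((2 * a * v) * g\<^sup>2 / 2))"
      by (simp add: ennreal_mult mult_left_mono)
  qed
  also have "\<dots> = ennreal (1 / sqrt (1 - 2 * a * v))"
    by (rule nn_integral_std_normal_exp_square[OF a(2)])
  finally have "?J \<le> ennreal (1 / sqrt (1 - 2 * a * v))" .
  then have "enn2real ?J \<le> enn2real (ennreal (1 / sqrt (1 - 2 * a * v)))"
    by (intro enn2real_mono) auto
  moreover have "expectation (\<lambda>x. exp (a * (S x)\<^sup>2)) = enn2real ?J"
    by (rule integral_eq_nn_integral) auto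
  ultimately show ?thesis using a by simp
qed

lemma (in prob_space) power_expectation_le:
  fixes h :: "'a \<Rightarrow> real"
  assumes "integrable M h" "\<And>x. 0 < h x" "integrable M (\<lambda>x. h x ^ n)"
  shows "expectation h ^ n \<le> expectation (\<lambda>x. h x ^ n)"
proof (rule jensens_inequality[where I = "{0<..}"])
  show "convex_on {0<..} (\<lambda>x::real. x ^ n)"
    by (cases "even n") (auto intro: convex_on_subset[OF convex_power_even] convex_on_subset[OF convex_power_odd])
qed (use assms in auto)

section \<open>Decoupling over random cuts of the index set\<close>

lemma card_cuts:
  assumes "finite I" "i \<in> I" "j \<in> I" "i \<noteq> j"
  shows "4 * card {A \<in> Pow I. i \<in> A \<and> j \<notin> A} = 2 ^ card I"
proof -
  have "{A \<in> Pow I. i \<in> A \<and> j \<notin> A} = insert i ` Pow (I - {i, j})"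
  proof (intro equalityI subsetI)
    fix A assume "A \<in> {A \<in> Pow I. i \<in> A \<and> j \<notin> A}"
    then show "A \<in> insert i ` Pow (I - {i, j})"
      by (intro image_eqI[of _ _ "A - {i}"]) auto
  qed (use assms in auto)
  moreover have "inj_on (insert i) (Pow (I - {i, j}))"
    by (auto simp: inj_on_def dest!: insert_ident[THEN iffD1, rotated 2])
  ultimately have "card {A \<in> Pow I. i \<in> A \<and> j \<notin> A} = 2 ^ card (I - {i, j})"
    using assms by (simp add: card_image card_Pow)
  moreover have "card I = Suc (Suc (card (I - {i, j})))"
    using assms by (metis card.remove finite_Diff insertCI insertE insert_Diff Diff_insert2)
  ultimately show ?thesis by simp
qed

lemma sum_over_cuts:
  fixes c :: "nat \<Rightarrow> nat \<Rightarrow> real"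
  assumes "finite I"
  shows "(\<Sum>A\<in>Pow I. 4 * (\<Sum>i\<in>A. \<Sum>j\<in>I - A. c i j)) = 2 ^ card I * (\<Sum>i\<in>I. \<Sum>j\<in>I - {i}. c i j)"
proof -
  have "(\<Sum>i\<in>A. \<Sum>j\<in>I - A. c i j) = (\<Sum>i\<in>I. \<Sum>j\<in>I. if i \<in> A \<and> j \<notin> A then c i j else 0)" if "A \<in> Pow I" for A
  proof -
    have "(\<Sum>j\<in>I. if i \<in> A \<and> j \<notin> A then c i j else 0) = (if i \<in> A then \<Sum>j\<in>I - A. c i j else 0)" for i
      using assms by (auto intro!: sum.mono_neutral_cong_right)
    then show ?thesis using assms that by (auto intro!: sum.mono_neutral_cong_left)
  qed
  then have "(\<Sum>A\<in>Pow I. 4 * (\<Sum>i\<in>A. \<Sum>j\<in>I - A. c i j))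
     = (\<Sum>A\<in>Pow I. \<Sum>i\<in>I. \<Sum>j\<in>I. if i \<in> A \<and> j \<notin> A then 4 * c i j else 0)"
    by (auto simp: sum_distrib_left intro!: sum.cong)
  also have "\<dots> = (\<Sum>i\<in>I. \<Sum>A\<in>Pow I. \<Sum>j\<in>I. if i \<in> A \<and> j \<notin> A then 4 * c i j else 0)"
    by (rule sum.swap)
  also have "\<dots> = (\<Sum>i\<in>I. \<Sum>j\<in>I. \<Sum>A\<in>Pow I. if i \<in> A \<and> j \<notin> A then 4 * c i j else 0)"
    by (intro sum.cong refl sum.swap)
  also have "\<dots> = (\<Sum>i\<in>I. \<Sum>j\<in>I. real (4 * card {A \<in> Pow I. i \<in> A \<and> j \<notin> A}) * c i j)"
    using assms by (auto simp: sum.If_cases Int_def intro!: sum.cong)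
  also have "\<dots> = (\<Sum>i\<in>I. \<Sum>j\<in>I - {i}. real (4 * card {A \<in> Pow I. i \<in> A \<and> j \<notin> A}) * c i j)"
    using assms by (intro sum.cong refl sum.mono_neutral_cong_right) auto
  also have "\<dots> = (\<Sum>i\<in>I. \<Sum>j\<in>I - {i}. 2 ^ card I * c i j)"
    using card_cuts[OF assms] by (intro sum.cong refl) (auto simp del: of_nat_mult)
  finally show ?thesis by (simp add: sum_distrib_left)
qed

text \<open>Decoupling: a uniformly random cut \<open>(A, I - A)\<close> separates an ordered pair with
  probability 1/4, so this is Jensen's inequality for \<open>exp\<close>.\<close>

lemma exp_sum_le_cuts:
  fixes c :: "nat \<Rightarrow> nat \<Rightarrow> real"
  assumes "finite I"
  shows "exp (s * (\<Sum>i\<in>I. \<Sum>j\<in>I - {i}. c i j))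
    \<le> (\<Sum>A\<in>Pow I. 1 / 2 ^ card I * exp (4 * s * (\<Sum>i\<in>A. \<Sum>j\<in>I - A. c i j)))"
proof -
  have "s * (\<Sum>i\<in>I. \<Sum>j\<in>I - {i}. c i j) = s / 2 ^ card I * (2 ^ card I * (\<Sum>i\<in>I. \<Sum>j\<in>I - {i}. c i j))"
    by simp
  also have "\<dots> = (\<Sum>A\<in>Pow I. (1 / 2 ^ card I) *\<^sub>R (4 * s * (\<Sum>i\<in>A. \<Sum>j\<in>I - A. c i j)))"
    unfolding sum_over_cuts[OF assms, symmetric] by (simp add: sum_distrib_left mult_ac)
  also have "exp \<dots> \<le> (\<Sum>A\<in>Pow I. 1 / 2 ^ card I * exp (4 * s * (\<Sum>i\<in>A. \<Sum>j\<in>I - A. c i j)))"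
    using assms by (intro convex_on_sum[OF _ _ exp_convex]) (auto simp: card_Pow)
  finally show ?thesis .
qed


text \<open>The means vanish at every point rather than almost everywhere, so the estimates hold for
  each fixed configuration. The oscillation \<open>b\<close> governs the sub-Gaussian bounds;
  \<open>B\<close> yields integrability and, later, a pointwise bound on the interaction felt by one
  particle.\<close>

locale degenerate_kernel = iid M I for M :: "'b measure" and I +
  fixes \<phi> :: "'b \<Rightarrow> 'b \<Rightarrow> real" and b B :: real
  assumes kernel_measurable: "case_prod \<phi> \<in> borel_measurable (M \<Otimes>\<^sub>M M)"
    and kernel_bound: "\<And>x y. \<bar>\<phi> x y\<bar> \<le> B"
    and kernel_osc: "\<And>x. \<exists>c. \<forall>y. \<phi> x y \<in> {c..c + b}"
    and kernel_mean_left: "\<And>y. (\<integral>x. \<phi> x y \<partial>M) = 0"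
    and kernel_mean_right: "\<And>x. (\<integral>y. \<phi> x y \<partial>M) = 0"
begin

lemma measurable_kernel[measurable (raw)]:
  assumes "f \<in> measurable N M" "g \<in> measurable N M"
  shows "(\<lambda>w. \<phi> (f w) (g w)) \<in> borel_measurable N"
  using measurable_compose[OF measurable_Pair[OF assms] kernel_measurable] by simp

lemma measurable_kernel_right: "u \<in> space M \<Longrightarrow> \<phi> u \<in> borel_measurable M"
  by measurable

lemma B_nonneg: "0 \<le> B"
  using kernel_bound[of undefined undefined] by linarith

lemma sum_kernel_bound: "\<bar>\<Sum>j\<in>J. \<phi> u (x j)\<bar> \<le> card J * B"
  by (rule order_trans[OF sum_abs]) (rule sum_bounded_above[OF kernel_bound])

text \<open>For fixed \<open>u\<close> the summands are independent, centred and confined to an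
  interval of length \<open>b\<close>, so each contributes the variance proxy b^2 / 4 of Hoeffding's
  lemma.\<close>

lemma subgaussian_row:
  assumes J: "J \<subseteq> I" and u: "u \<in> space M"
  shows "(\<integral>x. exp (t * (\<Sum>j\<in>J. \<phi> u (x j))) \<partial>P) \<le> exp (t\<^sup>2 * (card J * b\<^sup>2 / 4) / 2)"
proof -
  have finJ: "finite J" using J fin by (rule finite_subset)
  obtain c where c: "\<And>y. \<phi> u y \<in> {c..c + b}" using kernel_osc[of u] by blast
  have "(\<integral>x. exp (t * (\<Sum>j\<in>J. \<phi> u (x j))) \<partial>P) = (\<integral>x. (\<Prod>j\<in>J. exp (t * \<phi> u (x j))) \<partial>P)"
    using finJ by (simp add: sum_distrib_left exp_sum)
  also have "\<dots> = (\<Prod>j\<in>J. \<integral>v. exp (t * \<phi> u v) \<partial>M)"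
  proof (rule integral_prod_subset[OF J])
    fix j
    have "\<bar>t * \<phi> u v\<bar> \<le> \<bar>t\<bar> * B" for v unfolding abs_mult by (intro mult_left_mono kernel_bound) auto
    then show "integrable M (\<lambda>v. exp (t * \<phi> u v))"
      by (intro M.integrable_bounded[where B = "exp (\<bar>t\<bar> * B)"]) (use u in \<open>auto simp: abs_le_iff\<close>)
  qed
  also have "\<dots> \<le> (\<Prod>j\<in>J. exp (t\<^sup>2 * b\<^sup>2 / 8))"
    using c kernel_mean_right u
    by (intro prod_mono conjI M.hoeffding_mgf[where c = c] integral_nonneg) auto
  also have "\<dots> = exp (t\<^sup>2 * (card J * b\<^sup>2 / 4) / 2)"
    by (simp flip: exp_of_nat_mult)
  finally show ?thesis .
qed

lemma exp_square_row:
  assumes J: "J \<subseteq> I" and u: "u \<in> space M" and a: "0 \<le> a" "a * (card J * b\<^sup>2) / 2 < 1"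
  shows "(\<integral>x. exp (a * (\<Sum>j\<in>J. \<phi> u (x j))\<^sup>2) \<partial>P) \<le> 1 / sqrt (1 - a * (card J * b\<^sup>2) / 2)"
proof -
  have "(\<integral>x. exp (a * (\<Sum>j\<in>J. \<phi> u (x j))\<^sup>2) \<partial>P) \<le> 1 / sqrt (1 - 2 * a * (card J * b\<^sup>2 / 4))"
  proof (rule Pr.exp_square_subgaussian[OF _ sum_kernel_bound subgaussian_row[OF J u] a(1)])
    show "(\<lambda>x. \<Sum>j\<in>J. \<phi> u (x j)) \<in> borel_measurable P"
      by (intro borel_measurable_sum measurable_kernel) (use J u in auto)
  qed (use a in auto)
  then show ?thesis by simp
qed

text \<open>Given the \<open>J\<close>-coordinates \<open>x\<close>, the \<open>A\<close>-coordinates are independent and centred; with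
  \<open>f u = (\<Sum>j\<in>J. \<phi> u (x j))\<close> their contribution is \<open>(\<integral>exp (s f))\<^sup>n \<le> (\<integral>exp (s\<^sup>2 f\<^sup>2))\<^sup>n \<le> \<integral>exp (n s\<^sup>2 f\<^sup>2)\<close>,
  and \<open>f u\<close> is sub-Gaussian in \<open>x\<close>.\<close>

lemma exp_cut:
  fixes s :: real
  assumes A: "A \<subseteq> I" and J: "J \<subseteq> I" "A \<inter> J = {}"
    and small: "card A * s\<^sup>2 * (card J * b\<^sup>2) / 2 < 1"
  shows "(\<integral>x. exp (s * (\<Sum>i\<in>A. \<Sum>j\<in>J. \<phi> (x i) (x j))) \<partial>P)
    \<le> 1 / sqrt (1 - card A * s\<^sup>2 * (card J * b\<^sup>2) / 2)"
proof -
  define n where "n = card A"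
  define f where "f u x = (\<Sum>j\<in>J. \<phi> u (x j))" for u x
  define D where "D = card J * B"
  have finA: "finite A" using A fin by (rule finite_subset)
  have f_bd: "\<bar>f u x\<bar> \<le> D" for u x unfolding f_def D_def by (rule sum_kernel_bound)
  have D0: "0 \<le> D" using B_nonneg by (simp add: D_def)
  have f_sq: "(f u x)\<^sup>2 \<le> D\<^sup>2" for u x using f_bd[of u x] D0 by (metis abs_of_nonneg abs_le_square_iff)
  have meas_f: "(\<lambda>w. f (g w) (h w)) \<in> borel_measurable N"
    if "g \<in> measurable N M" "h \<in> measurable N P" for g h and N :: "'c measure"
    unfolding f_def
    by (intro borel_measurable_sum measurable_kernel that(1) measurable_compose[OF that(2)] measurable_component_singleton)
       (use J in auto)
  have fu: "(\<lambda>u. f u x) \<in> borel_measurable M" if "x \<in> space P" for x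
    using meas_f[of "\<lambda>u. u" M "\<lambda>_. x"] that by simp
  have fpair: "(\<lambda>(x, u). f u x) \<in> borel_measurable (P \<Otimes>\<^sub>M M)"
    using meas_f[of snd "P \<Otimes>\<^sub>M M" fst] by (simp add: case_prod_beta')
  have int_es: "integrable M (\<lambda>u. exp (r * f u x))" if "x \<in> space P" for x r
  proof -
    have "\<bar>r * f u x\<bar> \<le> \<bar>r\<bar> * D" for u unfolding abs_mult by (intro mult_left_mono f_bd) auto
    then show ?thesis using fu[OF that]
      by (intro M.integrable_bounded[where B = "exp (\<bar>r\<bar> * D)"]) (auto simp: abs_le_iff)
  qed
  have int_esq: "integrable M (\<lambda>u. exp (r * (f u x)\<^sup>2))" if "x \<in> space P" "r \<ge> 0" for x r
    using fu[OF that(1)] that(2) f_sq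
    by (intro M.integrable_bounded[where B = "exp (r * D\<^sup>2)"]) (auto intro!: mult_left_mono)
  define a where "a = n * s\<^sup>2"
  have a0: "a \<ge> 0" by (simp add: a_def)
  have step: "(\<integral>y. exp (s * (\<Sum>i\<in>A. f (y i) x)) \<partial>P) \<le> (\<integral>u. exp (a * (f u x)\<^sup>2) \<partial>M)" if x: "x \<in> space P" for x
  proof (cases "n = 0")
    case True
    then have "A = {}" using finA by (simp add: n_def)
    with True show ?thesis by (simp add: a_def Pr.prob_space M.prob_space)
  next
    case False
    have "(\<integral>y. exp (s * (\<Sum>i\<in>A. f (y i) x)) \<partial>P) = (\<integral>y. (\<Prod>i\<in>A. exp (s * f (y i) x)) \<partial>P)"
      using finA by (simp add: sum_distrib_left exp_sum)
    also have "\<dots> = (\<Prod>i\<in>A. \<integral>u. exp (s * f u x) \<partial>M)"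
      by (rule integral_prod_subset[OF A]) (rule int_es[OF x])
    also have "\<dots> = (\<integral>u. exp (s * f u x) \<partial>M) ^ n" by (simp add: n_def)
    also have "\<dots> \<le> (\<integral>u. exp (s\<^sup>2 * (f u x)\<^sup>2) \<partial>M) ^ n"
    proof (rule power_mono)
      have int_f: "integrable M (\<lambda>u. f u x)"
        using fu[OF x] f_bd by (intro M.integrable_bounded[where B = D]) auto
      have "(\<integral>u. f u x \<partial>M) = (\<Sum>j\<in>J. \<integral>u. \<phi> u (x j) \<partial>M)"
        unfolding f_def
      proof (rule Bochner_Integration.integral_sum)
        fix j assume "j \<in> J"
        then have "x j \<in> space M" using x J by (auto simp: space_PiM)
        then show "integrable M (\<lambda>u. \<phi> u (x j))"
          using kernel_bound by (intro M.integrable_bounded[where B = B]) auto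
      qed
      then have f0: "(\<integral>u. f u x \<partial>M) = 0" by (simp add: kernel_mean_left)
      have "(\<integral>u. exp (s * f u x) \<partial>M) \<le> (\<integral>u. s * f u x + exp (s\<^sup>2 * (f u x)\<^sup>2) \<partial>M)"
        using exp_le_add_exp_square[of "s * f _ x"]
        by (intro integral_mono int_es[OF x] Bochner_Integration.integrable_add integrable_mult_right int_f int_esq[OF x])
           (auto simp: power_mult_distrib)
      also have "\<dots> = (\<integral>u. exp (s\<^sup>2 * (f u x)\<^sup>2) \<partial>M)"
        by (subst Bochner_Integration.integral_add) (use int_f f0 int_esq[OF x] in auto)
      finally show "(\<integral>u. exp (s * f u x) \<partial>M) \<le> (\<integral>u. exp (s\<^sup>2 * (f u x)\<^sup>2) \<partial>M)" .
    qed (auto intro: integral_nonneg)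
    also have "\<dots> \<le> (\<integral>u. exp (s\<^sup>2 * (f u x)\<^sup>2) ^ n \<partial>M)"
    proof (rule M.power_expectation_le)
      show "integrable M (\<lambda>u. exp (s\<^sup>2 * (f u x)\<^sup>2) ^ n)"
        unfolding exp_of_nat_mult[symmetric] using int_esq[OF x a0] by (simp add: a_def mult.assoc)
    qed (auto intro: int_esq[OF x])
    also have "\<dots> = (\<integral>u. exp (a * (f u x)\<^sup>2) \<partial>M)"
      unfolding exp_of_nat_mult[symmetric] by (simp add: a_def mult.assoc)
    finally show ?thesis .
  qed
  define F where "F x = exp (s * (\<Sum>i\<in>A. \<Sum>j\<in>J. \<phi> (x i) (x j)))" for x
  have F_bd: "\<bar>F x\<bar> \<le> exp (\<bar>s\<bar> * (n * D))" for x
  proof -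
    have "\<bar>\<Sum>i\<in>A. f (x i) x\<bar> \<le> n * D" unfolding n_def
      by (rule order_trans[OF sum_abs]) (rule sum_bounded_above[OF f_bd])
    then have "\<bar>s * (\<Sum>i\<in>A. f (x i) x)\<bar> \<le> \<bar>s\<bar> * (n * D)" unfolding abs_mult by (rule mult_left_mono) auto
    then show ?thesis by (simp add: F_def f_def abs_le_iff)
  qed
  have F_meas: "F \<in> borel_measurable P"
    unfolding F_def using A J
    by (intro borel_measurable_exp borel_measurable_times borel_measurable_const borel_measurable_sum
       measurable_kernel measurable_component_singleton measurable_compose[OF _ borel_measurable_exp]) auto
  have intF: "integrable P F" by (rule Pr.integrable_bounded[OF F_meas F_bd])
  \<comment> \<open>Disjointness of \<open>A\<close> and \<open>J\<close> is used here: in the mixed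
    point the \<open>J\<close>-coordinates come from \<open>x\<close> and the
    \<open>A\<close>-coordinates from \<open>y\<close>.\<close>
  have Fmix: "F (mix I J x y) = exp (s * (\<Sum>i\<in>A. f (y i) x))" for x y
  proof -
    have "(\<Sum>j\<in>J. \<phi> (mix I J x y i) (mix I J x y j)) = f (y i) x" if "i \<in> A" for i
    proof -
      have "i \<in> I" "i \<notin> J" using that A J by blast+
      then have "mix I J x y i = y i" by (simp add: mix_apply)
      moreover have "mix I J x y j = x j" if "j \<in> J" for j
        using that subsetD[OF J(1) that] by (simp add: mix_apply)
      ultimately show ?thesis by (simp add: f_def)
    qed
    then show ?thesis by (simp add: F_def)
  qed
  interpret PM: pair_prob_space P M ..
  have esq_bd: "\<bar>exp (a * (f u x)\<^sup>2)\<bar> \<le> exp (a * D\<^sup>2)" for u x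
    using f_sq a0 by (auto intro: mult_left_mono)
  have esq_meas: "(\<lambda>(x, u). exp (a * (f u x)\<^sup>2)) \<in> borel_measurable (P \<Otimes>\<^sub>M M)"
    using fpair unfolding case_prod_beta by measurable
  have esq_int: "integrable (P \<Otimes>\<^sub>M M) (\<lambda>(x, u). exp (a * (f u x)\<^sup>2))"
    by (rule PM.P.integrable_bounded[OF esq_meas, where B = "exp (a * D\<^sup>2)"]) (use esq_bd in auto)
  have "(\<integral>x. F x \<partial>P) = (\<integral>x. \<integral>y. F (mix I J x y) \<partial>P \<partial>P)"
    by (rule integral_mix[OF J(1) intF])
  also have "\<dots> \<le> (\<integral>x. \<integral>u. exp (a * (f u x)\<^sup>2) \<partial>M \<partial>P)"
  proof (rule integral_mono)
    have mF: "(\<lambda>z. F (mix I J (fst z) (snd z))) \<in> borel_measurable (P \<Otimes>\<^sub>M P)"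
      by (rule measurable_compose[OF _ F_meas]) (use J in measurable)
    have "integrable (P \<Otimes>\<^sub>M P) (\<lambda>z. F (mix I J (fst z) (snd z)))"
      by (rule PP.P.integrable_bounded[OF mF F_bd])
    from PP.integrable_fst'[OF this] show "integrable P (\<lambda>x. \<integral>y. F (mix I J x y) \<partial>P)"
      by simp
    show "integrable P (\<lambda>x. \<integral>u. exp (a * (f u x)\<^sup>2) \<partial>M)"
      using PM.integrable_fst'[OF esq_int] by simp
  qed (use step in \<open>simp add: Fmix\<close>)
  \<comment> \<open>After the exchange \<open>u\<close> is fixed and the inner integral runs over
    \<open>x\<close>; the bound of \<open>exp_square_row\<close> is uniform in \<open>u\<close>, so
    no integration over \<open>u\<close> is left to do.\<close>
  also have "\<dots> = (\<integral>u. \<integral>x. exp (a * (f u x)\<^sup>2) \<partial>P \<partial>M)"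
    using PM.Fubini_integral[OF esq_int] by simp
  also have "\<dots> \<le> 1 / sqrt (1 - a * (card J * b\<^sup>2) / 2)"
  proof (rule M.integral_le_const')
    show "integrable M (\<lambda>u. \<integral>x. exp (a * (f u x)\<^sup>2) \<partial>P)"
      using PM.integrable_snd[OF esq_int] by simp
    show "(\<integral>x. exp (a * (f u x)\<^sup>2) \<partial>P) \<le> 1 / sqrt (1 - a * (card J * b\<^sup>2) / 2)" if "u \<in> space M" for u
      unfolding f_def by (rule exp_square_row[OF J(1) that a0]) (use small in \<open>simp add: a_def n_def\<close>)
  qed
  finally show ?thesis by (simp add: F_def a_def n_def)
qed

text \<open>Each cut is estimated by \<open>exp_cut\<close> with \<open>4 * s\<close> in place of
  \<open>s\<close>, and 4 |A| |J - A| <= |J|^2. The factor 2 is 16 from the square of 4, times 1/4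
  from this inequality, times 1/2 from \<open>exp_cut\<close>. A general \<open>J\<close> is allowed
  because the one-particle estimate needs the system without particle 0.\<close>

lemma exp_ustat:
  fixes s :: real
  assumes J: "J \<subseteq> I" and small: "2 * s\<^sup>2 * (card J)\<^sup>2 * b\<^sup>2 < 1"
  shows "(\<integral>x. exp (s * (\<Sum>i\<in>J. \<Sum>j\<in>J - {i}. \<phi> (x i) (x j))) \<partial>P)
    \<le> 1 / sqrt (1 - 2 * s\<^sup>2 * (card J)\<^sup>2 * b\<^sup>2)"
proof -
  let ?V = "\<lambda>A C x. \<Sum>i\<in>A. \<Sum>j\<in>C i. \<phi> (x i) (x j)"
  let ?U = "\<lambda>A. ?V A (\<lambda>_. J - A)"
  define q where "q = 2 * s\<^sup>2 * (card J)\<^sup>2 * b\<^sup>2"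
  have finJ: "finite J" using J fin by (rule finite_subset)
  have cut: "(\<integral>x. exp (4 * s * (?U A x)) \<partial>P) \<le> 1 / sqrt (1 - q)"
    if A: "A \<in> Pow J" for A
  proof -
    have "card J = card A + card (J - A)"
      using A finJ by (metis Pow_iff card_Diff_subset card_mono finite_subset le_add_diff_inverse)
    then have "(card J :: real)\<^sup>2 = (card A + card (J - A))\<^sup>2" by simp
    moreover have "(real (card A) - card (J - A))\<^sup>2 \<ge> 0" by simp
    ultimately have "4 * (real (card A) * card (J - A)) \<le> (card J)\<^sup>2"
      by (simp add: power2_eq_square algebra_simps)
    then have "4 * (real (card A) * card (J - A)) * (2 * s\<^sup>2 * b\<^sup>2) \<le> (card J)\<^sup>2 * (2 * s\<^sup>2 * b\<^sup>2)"
      by (rule mult_right_mono) simp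
    then have le: "card A * (4 * s)\<^sup>2 * (card (J - A) * b\<^sup>2) / 2 \<le> q"
      by (simp add: q_def power_mult_distrib algebra_simps)
    have "(\<integral>x. exp (4 * s * (?U A x)) \<partial>P)
       \<le> 1 / sqrt (1 - card A * (4 * s)\<^sup>2 * (card (J - A) * b\<^sup>2) / 2)"
      using A J by (intro exp_cut le_less_trans[OF le small[folded q_def]]) auto
    also have "\<dots> \<le> 1 / sqrt (1 - q)"
      using le le_less_trans[OF le small[folded q_def]] small[folded q_def]
      by (intro divide_left_mono mult_pos_pos real_sqrt_gt_zero real_sqrt_le_mono) linarith+
    finally show ?thesis .
  qed
  have meas: "(\<lambda>x. ?V A C x) \<in> borel_measurable P" if "A \<subseteq> I" "\<And>i. C i \<subseteq> I" for A C
    using that by (intro borel_measurable_sum measurable_kernel measurable_component_singleton) auto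
  have int: "integrable P (\<lambda>x. exp (r * ?V A C x))" if "A \<subseteq> I" "\<And>i. C i \<subseteq> I" for A C r
  proof (rule Pr.integrable_bounded)
    show "(\<lambda>x. exp (r * ?V A C x)) \<in> borel_measurable P"
      using meas[OF that] by measurable
    fix x
    have "\<bar>?V A C x\<bar> \<le> (\<Sum>i\<in>A. real (card (C i)) * B)"
      by (rule order_trans[OF sum_abs]) (intro sum_mono sum_kernel_bound)
    then have "\<bar>r * ?V A C x\<bar> \<le> \<bar>r\<bar> * (\<Sum>i\<in>A. real (card (C i)) * B)"
      unfolding abs_mult by (rule mult_left_mono) auto
    then show "\<bar>exp (r * ?V A C x)\<bar> \<le> exp (\<bar>r\<bar> * (\<Sum>i\<in>A. real (card (C i)) * B))"
      by (simp add: abs_le_iff)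
  qed
  have "(\<integral>x. exp (s * (\<Sum>i\<in>J. \<Sum>j\<in>J - {i}. \<phi> (x i) (x j))) \<partial>P)
     \<le> (\<integral>x. (\<Sum>A\<in>Pow J. 1 / 2 ^ card J * exp (4 * s * (?U A x))) \<partial>P)"
    using J by (intro integral_mono Bochner_Integration.integrable_sum integrable_mult_right int exp_sum_le_cuts[OF finJ]) auto
  also have "\<dots> = (\<Sum>A\<in>Pow J. 1 / 2 ^ card J * (\<integral>x. exp (4 * s * (?U A x)) \<partial>P))"
  proof (subst Bochner_Integration.integral_sum)
    show "integrable P (\<lambda>x. 1 / 2 ^ card J * exp (4 * s * (?U A x)))"
      if "A \<in> Pow J" for A
      using that J by (intro integrable_mult_right int) auto
  qed simp
  also have "\<dots> \<le> (\<Sum>A\<in>Pow J. 1 / 2 ^ card J * (1 / sqrt (1 - q)))"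
    by (intro sum_mono mult_left_mono cut) auto
  also have "\<dots> = 1 / sqrt (1 - q)" using finJ by (simp add: card_Pow)
  finally show ?thesis by (simp add: q_def)
qed

end

section \<open>Relative entropy of marginals\<close>

context iid
begin

text \<open>The conditional expectation given the coordinates in \<open>S\<close>. If \<open>f\<close> is a probability density
  with respect to \<open>P\<close>, this is the density of its marginal on \<open>S\<close>.\<close>

definition cexp :: "nat set \<Rightarrow> ((nat \<Rightarrow> 'b) \<Rightarrow> real) \<Rightarrow> (nat \<Rightarrow> 'b) \<Rightarrow> real" where
  "cexp S f x = (\<integral>y. f (mix I S x y) \<partial>P)"

lemma measurable_comp_mix:
  assumes "S \<subseteq> J" "f \<in> borel_measurable P"
  shows "(\<lambda>z. f (mix I S (fst z) (snd z))) \<in> borel_measurable (PiM J (\<lambda>_. M) \<Otimes>\<^sub>M P)"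
  by (rule measurable_compose[OF _ assms(2)]) (use assms(1) in measurable)

lemma measurable_comp_mix':
  assumes "S \<subseteq> J" "f \<in> borel_measurable P" "x \<in> space (PiM J (\<lambda>_. M))"
  shows "(\<lambda>y. f (mix I S x y)) \<in> borel_measurable P"
  using measurable_compose[OF measurable_Pair1'[OF assms(3)] measurable_comp_mix[OF assms(1,2)]] by simp

lemma measurable_cexp:
  assumes "S \<subseteq> J" "f \<in> borel_measurable P"
  shows "cexp S f \<in> borel_measurable (PiM J (\<lambda>_. M))"
  unfolding cexp_def
  using Pr.borel_measurable_lebesgue_integral[of "\<lambda>x y. f (mix I S x y)" "PiM J (\<lambda>_. M)"]
    measurable_comp_mix[OF assms] by (simp add: case_prod_beta')

lemma cexp_bounds:
  assumes "S \<subseteq> J" "f \<in> borel_measurable P" "x \<in> space (PiM J (\<lambda>_. M))" "\<And>x. a \<le> f x" "\<And>x. f x \<le> b"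
  shows "a \<le> cexp S f x" "cexp S f x \<le> b"
proof -
  have "\<bar>f x\<bar> \<le> max \<bar>a\<bar> \<bar>b\<bar>" for x using assms(4)[of x] assms(5)[of x] by linarith
  then have int: "integrable P (\<lambda>y. f (mix I S x y))"
    by (intro Pr.integrable_bounded[OF measurable_comp_mix'[OF assms(1-3)]])
  show "a \<le> cexp S f x" "cexp S f x \<le> b"
    unfolding cexp_def using assms int by (auto intro!: Pr.integral_ge_const Pr.integral_le_const)
qed

lemma cexp_cong: "S \<subseteq> I \<Longrightarrow> (\<And>i. i \<in> S \<Longrightarrow> x i = x' i) \<Longrightarrow> cexp S f x = cexp S f x'"
proof -
  assume "S \<subseteq> I" "\<And>i. i \<in> S \<Longrightarrow> x i = x' i"
  then have "mix I S x y = mix I S x' y" for y by (auto simp: mix_def fun_eq_iff)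
  then show ?thesis by (simp add: cexp_def)
qed

lemma cexp_mix: "S \<subseteq> T \<Longrightarrow> T \<subseteq> I \<Longrightarrow> cexp S f (mix I T x y) = cexp S f x"
  by (rule cexp_cong) (auto simp: mix_def)

text \<open>The defining property of a conditional expectation. That \<open>g\<close> depends on the
  \<open>S\<close>-coordinates only is expressed as invariance under resampling all others.\<close>

lemma integral_cexp_mult:
  assumes S: "S \<subseteq> I" and f: "f \<in> borel_measurable P" "\<And>x. x \<in> space P \<Longrightarrow> \<bar>f x\<bar> \<le> B"
    and g: "g \<in> borel_measurable P" "\<And>x. x \<in> space P \<Longrightarrow> \<bar>g x\<bar> \<le> C" "\<And>x y. g (mix I S x y) = g x"
  shows "(\<integral>x. g x * f x \<partial>P) = (\<integral>x. g x * cexp S f x \<partial>P)"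
proof -
  have "integrable P (\<lambda>x. g x * f x)"
  proof (rule Pr.integrable_bounded)
    show "\<bar>g x * f x\<bar> \<le> C * B" if "x \<in> space P" for x
      unfolding abs_mult by (intro mult_mono' f g that) auto
  qed (use f g in measurable)
  from integral_mix[OF S this] show ?thesis
    by (simp add: g(3) cexp_def)
qed

text \<open>This rests on independence of the coordinates: for a measure that is not a product,
  conditioning on \<open>S\<close> and then on \<open>T\<close> would not reduce to the
  intersection.\<close>

lemma cexp_cexp:
  assumes S: "S \<subseteq> I" and f: "f \<in> borel_measurable P" "\<And>x. \<bar>f x\<bar> \<le> B" and x: "x \<in> space P" and T: "T \<subseteq> I"
  shows "cexp T (cexp S f) x = cexp (S \<inter> T) f x"
proof -
  have ST: "S \<inter> T \<subseteq> I" using S by auto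
  have m: "(\<lambda>w. f (mix I (S \<inter> T) x w)) \<in> borel_measurable P"
    by (rule measurable_comp_mix'[OF ST f(1) x])
  have "cexp (S \<inter> T) f x = (\<integral>y. \<integral>z. f (mix I (S \<inter> T) x (mix I S y z)) \<partial>P \<partial>P)"
    unfolding cexp_def by (rule integral_mix[OF S Pr.integrable_bounded[OF m f(2)]])
  then show ?thesis by (simp add: cexp_def mix_mix)
qed

lemma cexp_full: "x \<in> space P \<Longrightarrow> cexp I f x = f x"
proof -
  assume "x \<in> space P"
  then have "mix I I x y = x" for y by (auto simp: mix_def space_PiM PiE_iff extensional_def fun_eq_iff)
  then show ?thesis
    by (simp add: cexp_def prob_space.prob_space[OF prob_space_PiM[OF M.prob_space_axioms]])
qed

lemma cexp_empty: "cexp {} f x = (\<integral>y. f y \<partial>P)"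
  unfolding cexp_def
  by (rule Bochner_Integration.integral_cong) (auto simp: mix_def space_PiM PiE_iff extensional_def fun_eq_iff intro!: arg_cong[of _ _ f])

end

text \<open>Because the bounds hold pointwise, every marginal inherits them, and its logarithm is a
  bounded function; the entropies below need no further integrability argument.\<close>

locale bounded_density = iid M I for M :: "'b measure" and I +
  fixes r :: "(nat \<Rightarrow> 'b) \<Rightarrow> real" and c C :: real
  assumes r_meas[measurable]: "r \<in> borel_measurable P"
    and c_pos: "0 < c" and r_ge: "\<And>x. c \<le> r x" and r_le: "\<And>x. r x \<le> C"
    and r_int: "(\<integral>x. r x \<partial>P) = 1"
begin

lemma r_abs: "\<bar>r x\<bar> \<le> C" using r_ge[of x] r_le[of x] c_pos by auto

lemma marg_bounds:
  assumes "S \<subseteq> J" "x \<in> space (PiM J (\<lambda>_. M))"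
  shows "c \<le> cexp S r x" "cexp S r x \<le> C" "0 < cexp S r x" "\<bar>ln (cexp S r x)\<bar> \<le> \<bar>ln c\<bar> + \<bar>ln C\<bar>"
    "\<bar>cexp S r x\<bar> \<le> C"
proof -
  show b: "c \<le> cexp S r x" "cexp S r x \<le> C"
    by (rule cexp_bounds[OF assms(1) r_meas assms(2) r_ge r_le])+
  then show p: "0 < cexp S r x" using c_pos by linarith
  have "ln c \<le> ln (cexp S r x)" "ln (cexp S r x) \<le> ln C" using b c_pos by auto
  then show "\<bar>ln (cexp S r x)\<bar> \<le> \<bar>ln c\<bar> + \<bar>ln C\<bar>" by linarith
  show "\<bar>cexp S r x\<bar> \<le> C" using b p by linarith
qed

lemma cexp_abs: "S \<subseteq> I \<Longrightarrow> x \<in> space P \<Longrightarrow> \<bar>cexp S r x\<bar> \<le> C"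
  by (rule marg_bounds(5))

lemma measurable_marg: "S \<subseteq> J \<Longrightarrow> cexp S r \<in> borel_measurable (PiM J (\<lambda>_. M))"
  by (rule measurable_cexp[OF _ r_meas])

definition ent :: "nat set \<Rightarrow> real" where
  "ent S = (\<integral>x. cexp S r x * ln (cexp S r x) \<partial>P)"

text \<open>Consistency of marginals: both sides are the integral of \<open>g\<close> against the
  full density \<open>r\<close>, since a function of the \<open>S\<close>-coordinates is also one of
  the \<open>U\<close>-coordinates.\<close>

lemma integral_marg_mult:
  assumes SU: "S \<subseteq> U" "U \<subseteq> I"
    and g: "g \<in> borel_measurable P" "\<And>x. x \<in> space P \<Longrightarrow> \<bar>g x\<bar> \<le> B" "\<And>x y. g (mix I S x y) = g x"
  shows "(\<integral>x. g x * cexp U r x \<partial>P) = (\<integral>x. g x * cexp S r x \<partial>P)"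
proof -
  have S: "S \<subseteq> I" using SU by auto
  have gU: "g (mix I U x y) = g x" for x y
  proof -
    have "g (mix I U x y) = g (mix I S (mix I U x y) y)" by (simp add: g(3))
    also have "\<dots> = g (mix I S x (mix I S y y))" using SU by (simp add: mix_mix Int_absorb2)
    finally show ?thesis by (simp add: g(3))
  qed
  have "(\<integral>x. g x * cexp U r x \<partial>P) = (\<integral>x. g x * r x \<partial>P)"
    by (rule integral_cexp_mult[OF SU(2) r_meas r_abs g(1,2) gU, symmetric])
  also have "\<dots> = (\<integral>x. g x * cexp S r x \<partial>P)"
    by (rule integral_cexp_mult[OF S r_meas r_abs g])
  finally show ?thesis .
qed

text \<open>Lets entropies on different index sets be written as integrals against one and the same
  density \<open>cexp U r\<close>, so that they can be combined under a single integral.\<close>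

lemma ent_eq:
  assumes SU: "S \<subseteq> U" "U \<subseteq> I"
  shows "(\<integral>x. ln (cexp S r x) * cexp U r x \<partial>P) = ent S"
proof -
  have S: "S \<subseteq> I" using SU by auto
  have "(\<integral>x. ln (cexp S r x) * cexp U r x \<partial>P) = (\<integral>x. ln (cexp S r x) * cexp S r x \<partial>P)"
    by (rule integral_marg_mult[OF SU _ marg_bounds(4)[OF S]])
       (use measurable_marg[OF S] in \<open>simp_all add: cexp_mix S\<close>)
  then show ?thesis by (simp add: ent_def mult.commute)
qed

lemma integral_marg: "S \<subseteq> I \<Longrightarrow> (\<integral>x. cexp S r x \<partial>P) = 1"
  using integral_cexp_mult[of S r C "\<lambda>_. 1" 1] r_abs r_int by simp

lemma integrable_ln_marg:
  assumes "S \<subseteq> I" "U \<subseteq> I"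
  shows "integrable P (\<lambda>x. ln (cexp S r x) * cexp U r x)"
proof (rule Pr.integrable_bounded)
  show "(\<lambda>x. ln (cexp S r x) * cexp U r x) \<in> borel_measurable P"
    using measurable_marg[OF assms(1)] measurable_marg[OF assms(2)] by measurable
  show "\<bar>ln (cexp S r x) * cexp U r x\<bar> \<le> (\<bar>ln c\<bar> + \<bar>ln C\<bar>) * C" if "x \<in> space P" for x
    unfolding abs_mult using marg_bounds[OF assms(1) that] marg_bounds[OF assms(2) that]
    by (intro mult_mono') auto
qed

text \<open>Nonnegativity of conditional mutual information. With U the union and V the
  intersection, \<open>q = r_S r_T / r_V\<close> is the density that makes the two parts
  conditionally independent given V; it has total mass 1, and the claim says that the entropy of
  \<open>r_U\<close> relative to \<open>q\<close> is nonnegative.\<close>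

lemma ent_supermodular:
  assumes S: "S \<subseteq> I" and T: "T \<subseteq> I"
  shows "ent S + ent T \<le> ent (S \<union> T) + ent (S \<inter> T)"
proof -
  define U V where "U = S \<union> T" and "V = S \<inter> T"
  have UV: "U \<subseteq> I" "V \<subseteq> I" "S \<subseteq> U" "T \<subseteq> U" "V \<subseteq> U" "V \<subseteq> S" "V \<subseteq> T"
    using S T by (auto simp: U_def V_def)
  define q where "q x = cexp S r x * (cexp T r x / cexp V r x)" for x
  have mS: "cexp X r \<in> borel_measurable P" if "X \<subseteq> I" for X by (rule measurable_marg[OF that])
  define g where "g x = cexp T r x / cexp V r x" for x
  have g_meas: "g \<in> borel_measurable P" unfolding g_def using mS T UV by measurable
  have g_bd: "\<bar>g x\<bar> \<le> C / c" if "x \<in> space P" for x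
    unfolding g_def abs_divide using marg_bounds[OF T that] marg_bounds[OF UV(2) that] c_pos
    by (intro frac_le) auto
  have g_mix: "g (mix I T x y) = g x" for x y
    using T UV by (simp add: g_def cexp_mix)
  have int_q: "integrable P q"
  proof (rule Pr.integrable_bounded)
    show "q \<in> borel_measurable P" unfolding q_def using mS S T UV by measurable
    show "\<bar>q x\<bar> \<le> C * (C / c)" if "x \<in> space P" for x
      using g_bd[OF that] cexp_abs[OF S that] unfolding q_def g_def[symmetric] abs_mult
      by (intro mult_mono') auto
  qed
  text \<open>The integral of \<open>q\<close> is computed by conditioning first on the coordinates in \<open>T\<close>.\<close>
  have "(\<integral>x. q x \<partial>P) = (\<integral>x. g x * cexp S r x \<partial>P)" by (simp add: q_def g_def mult.commute)
  also have "\<dots> = (\<integral>x. g x * cexp T (cexp S r) x \<partial>P)"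
    by (rule integral_cexp_mult[OF T mS[OF S] cexp_abs[OF S] g_meas g_bd g_mix])
  also have "\<dots> = (\<integral>x. g x * cexp V r x \<partial>P)"
    unfolding V_def
    by (rule Bochner_Integration.integral_cong) (simp_all add: cexp_cexp[OF S r_meas r_abs _ T])
  also have "\<dots> = (\<integral>x. cexp T r x \<partial>P)"
    by (rule Bochner_Integration.integral_cong) (use marg_bounds(3)[OF UV(2)] in \<open>auto simp: g_def less_imp_neq[symmetric]\<close>)
  finally have q1: "(\<integral>x. q x \<partial>P) = 1" by (simp add: integral_marg T)
  have "(\<integral>x. cexp U r x - q x \<partial>P) \<le> (\<integral>x. ln (cexp U r x) * cexp U r x + ln (cexp V r x) * cexp U r x
      - ln (cexp S r x) * cexp U r x - ln (cexp T r x) * cexp U r x \<partial>P)"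
  proof (rule integral_mono)
    show "integrable P (\<lambda>x. cexp U r x - q x)"
      by (rule Bochner_Integration.integrable_diff[OF Pr.integrable_bounded[OF mS[OF UV(1)] cexp_abs[OF UV(1)]] int_q])
    show "integrable P (\<lambda>x. ln (cexp U r x) * cexp U r x + ln (cexp V r x) * cexp U r x
      - ln (cexp S r x) * cexp U r x - ln (cexp T r x) * cexp U r x)"
      using S T UV by (intro Bochner_Integration.integrable_diff Bochner_Integration.integrable_add integrable_ln_marg)
    fix x assume x: "x \<in> space P"
    have p: "0 < cexp S r x" "0 < cexp T r x" "0 < cexp U r x" "0 < cexp V r x"
      using marg_bounds(3)[OF _ x] S T UV by auto
    \<comment> \<open>The duality inequality at a = \<open>cexp U r x\<close> and y =
      \<open>ln (q x)\<close>. Both \<open>cexp U r\<close> and \<open>q\<close> have integral 1, so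
      the linear terms disappear after integration.\<close>
    have "cexp U r x * ln (q x) \<le> cexp U r x * ln (cexp U r x) - cexp U r x + exp (ln (q x))"
      using p by (intro young_exp_ineq) auto
    also have "exp (ln (q x)) = q x" using p by (simp add: q_def)
    also have "ln (q x) = ln (cexp S r x) + ln (cexp T r x) - ln (cexp V r x)"
      unfolding q_def using p by (subst ln_mult_pos) (simp_all add: ln_div)
    finally show "cexp U r x - q x \<le> ln (cexp U r x) * cexp U r x + ln (cexp V r x) * cexp U r x
      - ln (cexp S r x) * cexp U r x - ln (cexp T r x) * cexp U r x"
      by (simp add: algebra_simps)
  qed
  also have "\<dots> = ent U + ent V - ent S - ent T"
    using S T UV by (simp add: integrable_ln_marg ent_eq)
  also have "(\<integral>x. cexp U r x - q x \<partial>P) = 0"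
  proof (subst Bochner_Integration.integral_diff)
    show "integrable P (cexp U r)"
      using mS[OF UV(1)] cexp_abs[OF UV(1)] by (intro Pr.integrable_bounded[where B = C]) auto
  qed (use int_q q1 integral_marg[OF UV(1)] in auto)
  finally show ?thesis by (simp add: U_def V_def)
qed

lemma ent_perm:
  assumes S: "S \<subseteq> I" and \<tau>: "bij_betw \<tau> I I" and sym: "\<And>x. x \<in> space P \<Longrightarrow> r (\<lambda>i\<in>I. x (\<tau> i)) = r x"
  shows "ent (\<tau> ` S) = ent S"
proof -
  have \<tau>I: "\<tau> i \<in> I" if "i \<in> I" for i using \<tau> that by (auto dest: bij_betwE)
  have \<tau>S: "\<tau> ` S \<subseteq> I" using S \<tau>I by auto
  have inj: "\<tau> i \<in> \<tau> ` S \<longleftrightarrow> i \<in> S" if "i \<in> I" for i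
    using \<tau> S that by (meson bij_betw_imp_inj_on inj_on_image_mem_iff)
  have rel: "cexp S r (\<lambda>i\<in>I. x (\<tau> i)) = cexp (\<tau> ` S) r x" if x: "x \<in> space P" for x
  proof -
    have x\<tau>: "(\<lambda>i\<in>I. x (\<tau> i)) \<in> space P" using x \<tau>I by (auto simp: space_PiM PiE_iff)
    have "cexp S r (\<lambda>i\<in>I. x (\<tau> i)) = (\<integral>y. r (mix I S (\<lambda>i\<in>I. x (\<tau> i)) (\<lambda>i\<in>I. y (\<tau> i))) \<partial>P)"
      unfolding cexp_def
      by (rule integral_comp_perm[OF \<tau>, symmetric]) (rule measurable_comp_mix'[OF S r_meas x\<tau>])
    also have "\<dots> = cexp (\<tau> ` S) r x"
      unfolding cexp_def
    proof (rule Bochner_Integration.integral_cong)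
      fix y assume y: "y \<in> space P"
      have "mix I S (\<lambda>i\<in>I. x (\<tau> i)) (\<lambda>i\<in>I. y (\<tau> i)) = (\<lambda>i\<in>I. mix I (\<tau> ` S) x y (\<tau> i))"
        using inj \<tau>I by (auto simp: mix_def fun_eq_iff)
      then show "r (mix I S (\<lambda>i\<in>I. x (\<tau> i)) (\<lambda>i\<in>I. y (\<tau> i))) = r (mix I (\<tau> ` S) x y)"
        using sym[OF mix_in_space[OF \<tau>S x y]] by simp
    qed simp
    finally show ?thesis .
  qed
  have "ent S = (\<integral>x. cexp S r (\<lambda>i\<in>I. x (\<tau> i)) * ln (cexp S r (\<lambda>i\<in>I. x (\<tau> i))) \<partial>P)"
    unfolding ent_def
    by (rule integral_comp_perm[OF \<tau>, symmetric]) (use measurable_marg[OF S] in measurable)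
  also have "\<dots> = ent (\<tau> ` S)"
    unfolding ent_def by (rule Bochner_Integration.integral_cong) (simp_all add: rel)
  finally show ?thesis by simp
qed

lemma ent_empty: "ent {} = 0"
  by (simp add: ent_def cexp_empty r_int)

end

text \<open>A convex sequence that starts at 0 has nondecreasing ratios h j / j. Consecutive ratios
  are compared first, by induction with the convexity inequality, and then chained; the
  cross-multiplied form avoids division by index 0.\<close>

lemma convex_seq_ratio_mono:
  fixes h :: "nat \<Rightarrow> real"
  assumes h0: "h 0 = 0" and conv: "\<And>j. Suc (Suc j) \<le> N \<Longrightarrow> 2 * h (Suc j) \<le> h (Suc (Suc j)) + h j"
    and k: "k \<le> N"
  shows "N * h k \<le> k * h N"
proof -
  have step_ineq: "real (Suc j) * h j \<le> j * h (Suc j)" if "Suc j \<le> N" for j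
    using that
  proof (induction j)
    case (Suc j)
    have "(j + 1) * (2 * h (Suc j)) \<le> (j + 1) * (h (Suc (Suc j)) + h j)"
      using conv[OF Suc.prems] by (intro mult_left_mono) auto
    with Suc show ?case by (simp add: algebra_simps)
  qed (simp add: h0)
  have "m * h k \<le> k * h m" if "k \<le> m" "m \<le> N" for m
    using that
  proof (induction m rule: dec_induct)
    case (step n)
    show ?case
    proof (cases "n = 0")
      case False
      have "Suc n * (n * h k) \<le> Suc n * (k * h n)"
        using step by (intro mult_left_mono) auto
      moreover have "k * (Suc n * h n) \<le> k * (n * h (Suc n))"
        using step.prems by (intro mult_left_mono step_ineq) auto
      ultimately have "real n * (Suc n * h k) \<le> n * (k * h (Suc n))" by (simp only: mult_ac)
      then show ?thesis using False by simp
    qed (use step h0 in auto)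
  qed simp
  then show ?thesis using k by simp
qed

text \<open>Convexity of the entropies of initial segments follows from supermodularity for two
  index sets of size j + 1 that share j elements and have equal entropy by exchangeability.\<close>

lemma (in bounded_density) ent_han:
  assumes I: "I = {..<N}" and k: "k \<le> N"
    and sym: "\<And>\<tau> x. bij_betw \<tau> I I \<Longrightarrow> x \<in> space P \<Longrightarrow> r (\<lambda>i\<in>I. x (\<tau> i)) = r x"
  shows "N * ent {..<k} \<le> k * ent {..<N}"
proof (rule convex_seq_ratio_mono[where h = "\<lambda>j. ent {..<j}"])
  fix j assume j: "Suc (Suc j) \<le> N"
  \<comment> \<open>\<open>T\<close> is the segment \<open>{..<Suc j}\<close> with its last index
    replaced by the next one; the transposition \<open>\<tau>\<close> carries one to the
    other.\<close>
  define T where "T = insert (Suc j) {..<j}"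
  define \<tau> where "\<tau> i = (if i = j then Suc j else if i = Suc j then j else i)" for i
  have \<tau>: "bij_betw \<tau> I I"
    by (rule bij_betw_byWitness[where f' = \<tau>]) (use j in \<open>auto simp: I \<tau>_def\<close>)
  have "\<tau> ` {..<Suc j} = T"
    unfolding \<tau>_def T_def lessThan_Suc by (auto simp: image_iff)
  with ent_perm[OF _ \<tau> sym[OF \<tau>], of "{..<Suc j}"] j have "ent T = ent {..<Suc j}" by (auto simp: I)
  moreover have "{..<Suc j} \<union> T = {..<Suc (Suc j)}" "{..<Suc j} \<inter> T = {..<j}" by (auto simp: T_def)
  ultimately show "2 * ent {..<Suc j} \<le> ent {..<Suc (Suc j)} + ent {..<j}"
    using ent_supermodular[of "{..<Suc j}" T] j by (auto simp: I T_def)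
qed (use k ent_empty in auto)

section \<open>Gibbs densities relative to the product measure\<close>

lemma abs_exp_minus_one_le: "\<bar>exp x - 1\<bar> \<le> \<bar>x\<bar> * exp \<bar>x\<bar>" for x :: real
proof (cases "x \<ge> 0")
  case True
  have "exp x * (1 - x) \<le> exp x * exp (- x)"
    using exp_ge_add_one_self[of "- x"] by (intro mult_left_mono) auto
  also have "\<dots> = 1" by (simp flip: exp_add)
  finally have "exp x - 1 \<le> x * exp x" by (simp add: algebra_simps)
  with True show ?thesis by simp
next
  case False
  have "1 - exp x \<le> - x" using exp_ge_add_one_self[of x] by linarith
  also have "\<dots> \<le> - x * exp (- x)" using False by (intro mult_left_le[of "exp (- x)" "- x", THEN order_trans] mult_le_cancel_left1[THEN iffD2]) auto
  finally show ?thesis using False by simp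
qed

lemma square_le_exp: "x\<^sup>2 \<le> 2 * (exp x + exp (- x))" for x :: real
proof -
  have pos: "y\<^sup>2 \<le> 2 * (exp y + exp (- y))" if "y \<ge> 0" for y :: real
  proof -
    have "2 * (1 + y + y\<^sup>2 / 2) \<le> 2 * exp y" using exp_lower_Taylor_quadratic[OF that] by simp
    then have "y\<^sup>2 \<le> 2 * exp y" using that by (simp add: distrib_left)
    moreover have "0 < exp (- y)" by simp
    ultimately show ?thesis unfolding distrib_left by linarith
  qed
  show ?thesis
  proof (cases "x \<ge> 0")
    case False
    then show ?thesis using pos[of "- x"] by (simp add: add.commute)
  qed (rule pos)
qed

text \<open>\<open>s_small\<close> is sized for the moment of exponent 2: replacing \<open>s\<close>
  by \<open>2 * s\<close> in \<open>exp_ustat\<close> gives the condition 8 s^2 N^2 b^2 < 1, and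
  1/10 leaves 4/5. In the application \<open>s\<close> is of order 1/N, so the bound can hold for
  all large N.\<close>

locale mean_field = degenerate_kernel M "{..<N}" \<phi> b B for M :: "'b measure" and N and \<phi> b B +
  fixes s :: real
  assumes kernel_sym: "\<And>x y. \<phi> x y = \<phi> y x"
    and s_nonneg: "0 \<le> s" and s_small: "s\<^sup>2 * (real N)\<^sup>2 * b\<^sup>2 \<le> 1 / 10"
    and N_pos: "0 < N"
begin

text \<open>The index set is a parameter so that the interaction of all particles and that of the
  particles other than 0 are instances of one definition.\<close>

definition G :: "nat set \<Rightarrow> (nat \<Rightarrow> 'b) \<Rightarrow> real" where
  "G J x = s * (\<Sum>i\<in>J. \<Sum>j\<in>J - {i}. \<phi> (x i) (x j))"

definition Z :: real where "Z = (\<integral>x. exp (G {..<N} x) \<partial>P)"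

definition r :: "(nat \<Rightarrow> 'b) \<Rightarrow> real" where "r x = exp (G {..<N} x) / Z"

lemma G_measurable: "J \<subseteq> {..<N} \<Longrightarrow> G J \<in> borel_measurable P"
  unfolding G_def
  by (intro borel_measurable_times borel_measurable_const borel_measurable_sum measurable_kernel
      measurable_component_singleton) auto

lemma G_bound: 
  assumes "J \<subseteq> {..<N}"
  shows "\<bar>G J x\<bar> \<le> s * (N * (N * B))"
proof -
  have card: "card K \<le> N" if "K \<subseteq> {..<N}" for K using card_mono[OF _ that] by simp
  have "\<bar>\<Sum>j\<in>J - {i}. \<phi> (x i) (x j)\<bar> \<le> N * B" for i
  proof -
    have "card (J - {i}) \<le> N" using assms by (intro card) auto
    then have "card (J - {i}) * B \<le> N * B" using B_nonneg by (intro mult_right_mono) auto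
    with sum_kernel_bound show ?thesis by (rule order_trans)
  qed
  then have "\<bar>\<Sum>i\<in>J. \<Sum>j\<in>J - {i}. \<phi> (x i) (x j)\<bar> \<le> card J * (N * B)"
    by (rule order_trans[OF sum_abs sum_bounded_above])
  also have "\<dots> \<le> N * (N * B)" using card[OF assms] B_nonneg by (intro mult_right_mono) auto
  finally show ?thesis unfolding G_def abs_mult using s_nonneg by (simp add: mult_left_mono)
qed

lemma integrable_G: "J \<subseteq> {..<N} \<Longrightarrow> integrable P (G J)"
  by (rule Pr.integrable_bounded[OF G_measurable G_bound])

lemma integrable_exp_G:
  assumes "J \<subseteq> {..<N}"
  shows "integrable P (\<lambda>x. exp (t * G J x))"
proof (rule Pr.integrable_bounded)
  show "(\<lambda>x. exp (t * G J x)) \<in> borel_measurable P" using G_measurable[OF assms] by measurable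
  have "\<bar>t * G J x\<bar> \<le> \<bar>t\<bar> * (s * (N * (N * B)))" for x
    unfolding abs_mult by (intro mult_left_mono G_bound assms) auto
  then show "\<bar>exp (t * G J x)\<bar> \<le> exp (\<bar>t\<bar> * (s * (N * (N * B))))" for x by (simp add: abs_le_iff)
qed

lemma integral_phi_pair:
  assumes "i < N" "j < N" "i \<noteq> j"
  shows "(\<integral>x. \<phi> (x i) (x j) \<partial>P) = 0"
proof -
  have m: "(\<lambda>x. \<phi> (x i) (x j)) \<in> borel_measurable P"
    by (intro measurable_kernel measurable_component_singleton) (use assms in auto)
  have "(\<integral>x. \<phi> (x i) (x j) \<partial>P) = (\<integral>x. \<integral>y. \<phi> (mix {..<N} {i} x y i) (mix {..<N} {i} x y j) \<partial>P \<partial>P)"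
    by (rule integral_mix) (use assms in \<open>auto intro: Pr.integrable_bounded[OF m kernel_bound]\<close>)
  also have "\<dots> = (\<integral>x. 0 \<partial>P)"
  proof (rule Bochner_Integration.integral_cong)
    fix x assume x: "x \<in> space P"
    then have xi: "x i \<in> space M" using assms by (auto simp: space_PiM)
    have "(\<integral>y. \<phi> (x i) (y j) \<partial>P) = (\<integral>y. \<phi> (x i) y \<partial>M)"
      using assms xi by (intro integral_component measurable_kernel_right) auto
    then show "(\<integral>y. \<phi> (mix {..<N} {i} x y i) (mix {..<N} {i} x y j) \<partial>P) = 0"
      using assms by (simp add: mix_apply kernel_mean_right)
  qed simp
  finally show ?thesis by simp
qed

lemma Z_ge_1: "1 \<le> Z"
proof -
  have "(\<integral>x. G {..<N} x \<partial>P) = s * (\<Sum>i<N. \<Sum>j\<in>{..<N} - {i}. \<integral>x. \<phi> (x i) (x j) \<partial>P)"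
    unfolding G_def
    by (subst integral_mult_right_zero, subst Bochner_Integration.integral_sum)
       (auto intro!: Bochner_Integration.integral_sum Bochner_Integration.integrable_sum sum.cong Pr.integrable_bounded[OF _ kernel_bound] measurable_kernel measurable_component_singleton)
  then have G0: "(\<integral>x. G {..<N} x \<partial>P) = 0" by (simp add: integral_phi_pair)
  have "(\<integral>x. 1 + G {..<N} x \<partial>P) \<le> Z"
    unfolding Z_def using integrable_exp_G[of "{..<N}" 1] integrable_G[of "{..<N}"]
    by (intro integral_mono Bochner_Integration.integrable_add) (auto intro: exp_ge_add_one_self)
  moreover have "(\<integral>x. 1 + G {..<N} x \<partial>P) = 1 + (\<integral>x. G {..<N} x \<partial>P)"
    using integrable_G[of "{..<N}"]
    by (subst Bochner_Integration.integral_add) (auto simp: prob_space.prob_space[OF prob_space_PiM[OF M.prob_space_axioms]])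
  ultimately show ?thesis by (simp add: G0)
qed

lemma exp_moment:
  assumes "J \<subseteq> {..<N}"
  shows "(\<integral>x. exp (2 * G J x) \<partial>P) \<le> 3"
proof -
  define q where "q = 2 * (2 * s)\<^sup>2 * (card J)\<^sup>2 * b\<^sup>2"
  have "card J \<le> N" using card_mono[OF _ assms] by simp
  then have "q \<le> 2 * (2 * s)\<^sup>2 * (real N)\<^sup>2 * b\<^sup>2"
    unfolding q_def by (intro mult_right_mono mult_left_mono) (auto intro!: power_mono)
  also have "\<dots> = 8 * (s\<^sup>2 * (real N)\<^sup>2 * b\<^sup>2)" by (simp add: power_mult_distrib)
  also have "\<dots> \<le> 4 / 5" using s_small by linarith
  finally have q: "q \<le> 4 / 5" .
  have "(\<integral>x. exp (2 * G J x) \<partial>P) = (\<integral>x. exp ((2 * s) * (\<Sum>i\<in>J. \<Sum>j\<in>J - {i}. \<phi> (x i) (x j))) \<partial>P)"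
    by (simp add: G_def mult.assoc)
  also have "\<dots> \<le> 1 / sqrt (1 - q)"
    unfolding q_def by (rule exp_ustat[OF assms le_less_trans[OF q[unfolded q_def]]]) simp
  \<comment> \<open>Here 1 - q is at least 1/5; the weaker 1/9 is chosen because its root is
    rational.\<close>
  also have "\<dots> \<le> 1 / sqrt (1 / 9)"
    using q by (intro divide_left_mono mult_pos_pos real_sqrt_le_mono real_sqrt_gt_zero) linarith+
  also have "\<dots> = 3" by (simp add: real_sqrt_divide)
  finally show ?thesis .
qed

text \<open>These bounds deteriorate exponentially with N and are used for finiteness; the constants
  that are uniform in N come from the exponential moment estimates.\<close>

sublocale bounded_density M "{..<N}" r "exp (- (s * (N * (N * B)))) / Z" "exp (s * (N * (N * B))) / Z"
proof
  show "r \<in> borel_measurable P" unfolding r_def using G_measurable[of "{..<N}"] by measurable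
  show "0 < exp (- (s * (N * (N * B)))) / Z" using Z_ge_1 by simp
  have G: "- (s * (N * (N * B))) \<le> G {..<N} x" "G {..<N} x \<le> s * (N * (N * B))" for x
    using G_bound[of "{..<N}" x] by (auto simp: abs_le_iff)
  show "exp (- (s * (N * (N * B)))) / Z \<le> r x" "r x \<le> exp (s * (N * (N * B))) / Z" for x
    unfolding r_def using G[of x] Z_ge_1 by (intro divide_right_mono; simp)+
  show "(\<integral>x. r x \<partial>P) = 1"
    unfolding r_def using Z_ge_1 by (simp add: Z_def)
qed

lemma r_perm:
  assumes \<tau>: "bij_betw \<tau> {..<N} {..<N}"
  shows "r (\<lambda>i\<in>{..<N}. x (\<tau> i)) = r x"
proof -
  have "(\<Sum>i<N. \<Sum>j\<in>{..<N} - {i}. \<phi> (x (\<tau> i)) (x (\<tau> j))) = (\<Sum>i<N. \<Sum>j\<in>{..<N} - {i}. \<phi> (x i) (x j))"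
  proof (subst sum.reindex_bij_betw[OF \<tau>, of "\<lambda>i. \<Sum>j\<in>{..<N} - {i}. \<phi> (x i) (x j)", symmetric], rule sum.cong)
    fix i assume i: "i \<in> {..<N}"
    have "bij_betw \<tau> ({..<N} - {i}) ({..<N} - {\<tau> i})"
      by (rule bij_betw_DiffI[OF \<tau>]) (use i bij_betwE[OF \<tau>] in auto)
    from sum.reindex_bij_betw[OF this, of "\<lambda>j. \<phi> (x (\<tau> i)) (x j)"]
    show "(\<Sum>j\<in>{..<N} - {i}. \<phi> (x (\<tau> i)) (x (\<tau> j))) = (\<Sum>j\<in>{..<N} - {\<tau> i}. \<phi> (x (\<tau> i)) (x j))" .
  qed simp
  then show ?thesis by (simp add: r_def G_def)
qed

lemma ent_full: "ent {..<N} = (\<integral>x. r x * ln (r x) \<partial>P)"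
  unfolding ent_def by (rule Bochner_Integration.integral_cong) (simp_all add: cexp_full)

lemma integrable_ent: "S \<subseteq> {..<N} \<Longrightarrow> integrable P (\<lambda>x. cexp S r x * ln (cexp S r x))"
  using integrable_ln_marg[of S S] by (simp add: mult.commute)

text \<open>Since Z >= 1, both ln r <= G and r <= exp G. With the crude G <= exp G the integrand is
  at most exp (2 G) pointwise.\<close>

lemma ent_le_3: "ent {..<N} \<le> 3"
proof -
  have "(\<integral>x. r x * ln (r x) \<partial>P) \<le> (\<integral>x. exp (2 * G {..<N} x) \<partial>P)"
  proof (rule integral_mono)
    show "integrable P (\<lambda>x. r x * ln (r x))"
      using integrable_ent[of "{..<N}"] by (subst Bochner_Integration.integrable_cong[OF refl]) (auto simp: cexp_full)
    show "integrable P (\<lambda>x. exp (2 * G {..<N} x))" by (rule integrable_exp_G) simp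
    fix x
    have "ln (r x) \<le> G {..<N} x" using Z_ge_1 by (simp add: r_def ln_div)
    also have "\<dots> \<le> exp (G {..<N} x)" using exp_ge_add_one_self[of "G {..<N} x"] by linarith
    finally have "r x * ln (r x) \<le> r x * exp (G {..<N} x)"
      by (rule mult_left_mono) (rule less_imp_le[OF less_le_trans[OF c_pos r_ge]])
    also have "\<dots> \<le> exp (G {..<N} x) * exp (G {..<N} x)"
      by (rule mult_right_mono) (use Z_ge_1 in \<open>simp_all add: r_def divide_le_eq\<close>)
    also have "\<dots> = exp (2 * G {..<N} x)" by (simp flip: exp_add)
    finally show "r x * ln (r x) \<le> exp (2 * G {..<N} x)" .
  qed
  with exp_moment[of "{..<N}"] show ?thesis by (simp add: ent_full)
qed

lemma ent_marginal: "k \<le> N \<Longrightarrow> N * ent {..<k} \<le> k * ent {..<N}"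
  by (rule ent_han[OF refl]) (use r_perm in auto)

text \<open>Singling out particle 0 splits the exponent into its interaction \<open>S\<close> with
  the others, a sum of independent centred terms of total size 1 / sqrt N, and \<open>G J\<close>,
  which does not see it. So Z times the marginal density is within O(1 / sqrt N) of the constant
  \<open>Y\<close>, uniformly in the position. Averaging over the position shows that Z is equally
  close to \<open>Y\<close>, and Z >= 1 permits the division.\<close>

lemma one_marginal_bound:
  assumes x: "x \<in> space (PiM {..<1} (\<lambda>_. M))"
  shows "\<bar>cexp {..<1} r x - 1\<bar> \<le> 12 * exp (2 * s * (N * B)) / sqrt N"
proof -
  define J where "J = {..<N} - {0}"
  define D where "D = 2 * s * (N * B)"
  define Y where "Y = (\<integral>y. exp (G J y) \<partial>P)"
  have J: "J \<subseteq> {..<N}" "{..<N} = insert 0 J" "0 \<notin> J" "finite J" using N_pos by (auto simp: J_def)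
  have cardJ: "card J \<le> N" using card_mono[OF _ J(1)] by simp
  have main: "\<bar>Z * cexp {..<1} r x - Y\<bar> \<le> 6 * exp D / sqrt N" if v: "x 0 \<in> space M" for x
  proof -
    define T where "T y = (\<Sum>j\<in>J. \<phi> (x 0) (y j))" for y
    \<comment> \<open>The factor 2 appears because particle 0 enters the double sum as first and as
      second index and the kernel is symmetric.\<close>
    define S where "S y = 2 * s * T y" for y
    have T_meas: "T \<in> borel_measurable P"
      unfolding T_def by (intro borel_measurable_sum measurable_kernel) (use v J in auto)
    have S_meas[measurable]: "S \<in> borel_measurable P" unfolding S_def using T_meas by measurable
    have G_meas[measurable]: "G J \<in> borel_measurable P" by (rule G_measurable[OF J(1)])
    have S_bd: "\<bar>S y\<bar> \<le> D" for y
    proof -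
      have "\<bar>T y\<bar> \<le> card J * B" unfolding T_def by (rule sum_kernel_bound)
      also have "\<dots> \<le> N * B" using cardJ B_nonneg by (intro mult_right_mono) auto
      finally show ?thesis unfolding S_def D_def abs_mult using s_nonneg by (simp add: mult_left_mono)
    qed
    have G_split: "G {..<N} (mix {..<N} {..<1} x y) = S y + G J y" for y
    proof -
      let ?m = "mix {..<N} {..<1} x y"
      have m0: "?m 0 = x 0" using N_pos by (simp add: mix_apply)
      have mj: "?m j = y j" if "j \<in> J" for j using that by (auto simp: mix_apply J_def)
      have "(\<Sum>i<N. \<Sum>j\<in>{..<N} - {i}. \<phi> (?m i) (?m j))
         = (\<Sum>j\<in>J. \<phi> (?m 0) (?m j)) + (\<Sum>i\<in>J. \<Sum>j\<in>{..<N} - {i}. \<phi> (?m i) (?m j))"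
        unfolding J(2) using J(3,4) by (simp add: insert_Diff_if)
      also have "(\<Sum>i\<in>J. \<Sum>j\<in>{..<N} - {i}. \<phi> (?m i) (?m j))
        = (\<Sum>i\<in>J. \<phi> (?m i) (?m 0) + (\<Sum>j\<in>J - {i}. \<phi> (?m i) (?m j)))"
      proof (rule sum.cong)
        fix i assume i: "i \<in> J"
        then have "{..<N} - {i} = insert 0 (J - {i})" using J by auto
        then show "(\<Sum>j\<in>{..<N} - {i}. \<phi> (?m i) (?m j)) = \<phi> (?m i) (?m 0) + (\<Sum>j\<in>J - {i}. \<phi> (?m i) (?m j))"
          using J by simp
      qed simp
      finally show ?thesis
        using mj m0 by (simp add: G_def S_def T_def sum.distrib kernel_sym[of _ "x 0"] algebra_simps)
    qed
    have int_e: "integrable P (\<lambda>y. exp (S y + G J y))"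
    proof (rule Pr.integrable_bounded)
      show "\<bar>exp (S y + G J y)\<bar> \<le> exp (D + s * (N * (N * B)))" for y
        using S_bd[of y] G_bound[OF J(1), of y] by (simp add: abs_le_iff)
    qed measurable
    have int_G: "integrable P (\<lambda>y. exp (G J y))" using integrable_exp_G[OF J(1), of 1] by simp
    have int_S: "integrable P (\<lambda>y. exp (t * S y))" for t
    proof (rule Pr.integrable_bounded)
      have "\<bar>t * S y\<bar> \<le> \<bar>t\<bar> * D" for y unfolding abs_mult by (intro mult_left_mono S_bd) auto
      then show "\<bar>exp (t * S y)\<bar> \<le> exp (\<bar>t\<bar> * D)" for y by (simp add: abs_le_iff)
    qed measurable
    \<comment> \<open>The range of \<open>t\<close> reaches sqrt N: there the sub-Gaussian exponent
      is at most s^2 N^2 b^2 / 2, hence at most 1/20, which says that sqrt N times \<open>S\<close>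
      has exponential moments of order one.\<close>
    have mgf: "(\<integral>y. exp (t * S y) \<partial>P) \<le> 2" if "t\<^sup>2 \<le> N" for t :: real
    proof -
      have "(\<integral>y. exp (t * S y) \<partial>P) = (\<integral>y. exp ((2 * s * t) * (\<Sum>j\<in>J. \<phi> (x 0) (y j))) \<partial>P)"
        by (simp add: S_def T_def mult_ac)
      also have "\<dots> \<le> exp ((2 * s * t)\<^sup>2 * (card J * b\<^sup>2 / 4) / 2)"
        by (rule subgaussian_row[OF J(1) v])
      also have "(2 * s * t)\<^sup>2 * (card J * b\<^sup>2 / 4) / 2 = s\<^sup>2 * (t\<^sup>2 * card J) * b\<^sup>2 / 2"
        by (simp add: power_mult_distrib)
      also have "exp \<dots> \<le> exp (s\<^sup>2 * (real N)\<^sup>2 * b\<^sup>2 / 2)"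
      proof -
        have "t\<^sup>2 * card J \<le> real N * real N" using that cardJ by (intro mult_mono) auto
        then have "s\<^sup>2 * (t\<^sup>2 * card J) * b\<^sup>2 \<le> s\<^sup>2 * (real N)\<^sup>2 * b\<^sup>2"
          by (intro mult_right_mono mult_left_mono) (auto simp: power2_eq_square)
        then show ?thesis by simp
      qed
      also have "\<dots> \<le> exp (1 / 20)" unfolding exp_le_cancel_iff using s_small by linarith
      also have "\<dots> \<le> 2" using exp_bound[of "1 / 20"] by (simp add: power2_eq_square)
      finally show ?thesis .
    qed
    have eq: "Z * cexp {..<1} r x = (\<integral>y. exp (S y + G J y) \<partial>P)"
      unfolding cexp_def r_def G_split using Z_ge_1 by simp
    \<comment> \<open>The majorant combines |exp S - 1| <= |S| exp D with 2 a b <= a^2 + b^2 for a =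
      sqrt N |S| and b = exp (G J); a^2 is then bounded by exponentials. Its integral is at most (11
      / 2) exp D / sqrt N, rounded up to 6.\<close>
    let ?H = "\<lambda>y. exp D / (2 * sqrt N) * (2 * (exp (sqrt N * S y) + exp (- sqrt N * S y)) + exp (2 * G J y))"
    have "\<bar>Z * cexp {..<1} r x - Y\<bar> = \<bar>\<integral>y. exp (S y + G J y) - exp (G J y) \<partial>P\<bar>"
      unfolding eq Y_def using int_e int_G by simp
    also have "\<dots> \<le> (\<integral>y. \<bar>exp (S y + G J y) - exp (G J y)\<bar> \<partial>P)"
      by (rule integral_abs_bound)
    also have "\<dots> \<le> (\<integral>y. ?H y \<partial>P)"
    proof (rule integral_mono)
      show "integrable P (\<lambda>y. \<bar>exp (S y + G J y) - exp (G J y)\<bar>)" using int_e int_G by simp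
      show "integrable P (\<lambda>y. ?H y)"
        by (intro integrable_mult_right Bochner_Integration.integrable_add int_S integrable_exp_G J(1))
      fix y
      have N0: "sqrt N > 0" using N_pos by simp
      have "\<bar>exp (S y + G J y) - exp (G J y)\<bar> = \<bar>exp (S y) - 1\<bar> * exp (G J y)"
        by (simp add: exp_add left_diff_distrib abs_mult[symmetric, of _ "exp (G J y)", simplified])
      also have "\<dots> \<le> (\<bar>S y\<bar> * exp \<bar>S y\<bar>) * exp (G J y)"
        by (intro mult_right_mono abs_exp_minus_one_le) auto
      also have "\<dots> \<le> (\<bar>S y\<bar> * exp D) * exp (G J y)"
        using S_bd by (intro mult_right_mono mult_left_mono) auto
      also have "\<dots> = exp D / (2 * sqrt N) * (2 * (sqrt N * \<bar>S y\<bar>) * exp (G J y))"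
        using N0 by simp
      also have "\<dots> \<le> exp D / (2 * sqrt N) * ((sqrt N * \<bar>S y\<bar>)\<^sup>2 + (exp (G J y))\<^sup>2)"
        using N0 by (intro mult_left_mono sum_squares_bound) auto
      also have "(sqrt N * \<bar>S y\<bar>)\<^sup>2 = (sqrt N * S y)\<^sup>2" by (simp add: power_mult_distrib)
      also have "(exp (G J y))\<^sup>2 = exp (2 * G J y)" by (simp add: exp_double)
      also have "exp D / (2 * sqrt N) * ((sqrt N * S y)\<^sup>2 + exp (2 * G J y))
         \<le> ?H y"
        using N0 square_le_exp[of "sqrt N * S y"] by (intro mult_left_mono) auto
      finally show "\<bar>exp (S y + G J y) - exp (G J y)\<bar>
         \<le> ?H y" .
    qed
    also have "\<dots> = exp D / (2 * sqrt N) * (2 * ((\<integral>y. exp (sqrt N * S y) \<partial>P) + (\<integral>y. exp (- sqrt N * S y) \<partial>P))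
        + (\<integral>y. exp (2 * G J y) \<partial>P))"
    proof -
      have "(\<integral>y. 2 * (exp (sqrt N * S y) + exp (- sqrt N * S y)) + exp (2 * G J y) \<partial>P)
        = 2 * ((\<integral>y. exp (sqrt N * S y) \<partial>P) + (\<integral>y. exp (- sqrt N * S y) \<partial>P)) + (\<integral>y. exp (2 * G J y) \<partial>P)"
        using int_S[of "sqrt N"] int_S[of "- sqrt N"] integrable_exp_G[OF J(1), of 2]
        by (subst Bochner_Integration.integral_add) auto
      then show ?thesis by (simp only: integral_mult_right_zero)
    qed
    also have "\<dots> \<le> exp D / (2 * sqrt N) * (2 * (2 + 2) + 3)"
      by (intro mult_left_mono add_mono mgf exp_moment J(1)) auto
    also have "\<dots> \<le> 6 * exp D / sqrt N"
    proof -
      have "0 \<le> exp D / sqrt N" by simp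
      then show ?thesis by (simp add: field_split_simps)
    qed
    finally show ?thesis .
  qed
  have m: "cexp {..<1} r \<in> borel_measurable P" by (rule measurable_marg) (use N_pos in auto)
  \<comment> \<open>The marginal density has mean 1, so averaging the uniform bound
    \<open>main\<close> compares the two constants; using it twice turns 6 into 12.\<close>
  have "Z - Y = (\<integral>x. Z * cexp {..<1} r x - Y \<partial>P)"
  proof -
    have "integrable P (cexp {..<1} r)"
      by (rule Pr.integrable_bounded[OF m cexp_abs]) (use N_pos in auto)
    then show ?thesis using integral_marg[of "{..<1}"] N_pos
      by (simp add: prob_space.prob_space[OF prob_space_PiM[OF M.prob_space_axioms]])
  qed
  also have "\<bar>\<dots>\<bar> \<le> 6 * exp D / sqrt N"
  proof -
    have "\<bar>\<integral>x. Z * cexp {..<1} r x - Y \<partial>P\<bar> \<le> (\<integral>x. \<bar>Z * cexp {..<1} r x - Y\<bar> \<partial>P)"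
      by (rule integral_abs_bound)
    also have "\<dots> \<le> 6 * exp D / sqrt N"
    proof (rule Pr.integral_le_const')
      show bd: "\<bar>Z * cexp {..<1} r x - Y\<bar> \<le> 6 * exp D / sqrt N" if "x \<in> space P" for x
        by (rule main) (use that N_pos in \<open>auto simp: space_PiM\<close>)
      then show "integrable P (\<lambda>x. \<bar>Z * cexp {..<1} r x - Y\<bar>)"
        using m by (intro Pr.integrable_bounded[where B = "6 * exp D / sqrt N"]) auto
    qed
    finally show ?thesis .
  qed
  finally have ZY: "\<bar>Z - Y\<bar> \<le> 6 * exp D / sqrt N" .
  have "x 0 \<in> space M" using x by (auto simp: space_PiM)
  from main[of x, OF this] ZY have "\<bar>Z * cexp {..<1} r x - Z\<bar> \<le> 12 * exp D / sqrt N" by linarith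
  moreover have "\<bar>cexp {..<1} r x - 1\<bar> \<le> Z * \<bar>cexp {..<1} r x - 1\<bar>"
    using Z_ge_1 by (intro mult_le_cancel_right1[THEN iffD2]) auto
  moreover have "Z * \<bar>cexp {..<1} r x - 1\<bar> = \<bar>Z * cexp {..<1} r x - Z\<bar>"
    using Z_ge_1 abs_mult[of Z "cexp {..<1} r x - 1"] by (simp add: right_diff_distrib)
  ultimately show ?thesis by (simp add: D_def)
qed

end

section \<open>Densities on configuration space\<close>

lemma AE_lborel_affine:
  fixes t :: "'a::euclidean_space"
  assumes c: "c \<noteq> 0" and [measurable]: "Measurable.pred borel Q" and AE: "AE x in lborel. Q x"
  shows "AE x in lborel. Q (t + c *\<^sub>R x)"
proof -
  have "AE x in density (distr lborel borel (\<lambda>x. t + c *\<^sub>R x)) (\<lambda>_. ennreal (\<bar>c\<bar>^DIM('a))). Q x"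
    unfolding lborel_affine[OF c, of t, symmetric] by (rule AE)
  then have "AE x in distr lborel borel (\<lambda>x. t + c *\<^sub>R x). Q x"
    using c by (simp add: AE_density)
  then show ?thesis by (subst (asm) AE_distr_iff) auto
qed

lemma product_sigma_finite_lborel: "product_sigma_finite (\<lambda>_. lborel)"
  by standard

lemma measurable_lborel_component:
  "i < N \<Longrightarrow> (\<lambda>x. x i) \<in> borel_measurable (lborel_pow N)"
  using measurable_component_singleton[of i "{..<N}" "\<lambda>_. lborel"] by simp

text \<open>Tonelli in coordinate \<open>i\<close>: with the other coordinates fixed, the difference
  is a translate of \<open>x i\<close>. Distinct indices are essential, since \<open>Q\<close> may
  fail at 0.\<close>

lemma AE_lborel_pow_diff:
  fixes Q :: "'a::euclidean_space \<Rightarrow> bool"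
  assumes [measurable]: "Measurable.pred borel Q" and AE: "AE x in lborel. Q x"
    and ij: "i < N" "j < N" "i \<noteq> j"
  shows "AE x in lborel_pow N. Q (x i - x j)"
proof -
  interpret product_sigma_finite "\<lambda>_::nat. lborel :: 'a measure" by (rule product_sigma_finite_lborel)
  define J where "J = {..<N} - {i}"
  have J: "{..<N} = insert i J" "i \<notin> J" "finite J" "j \<in> J" using ij by (auto simp: J_def)
  define f where "f x = (indicator {x. \<not> Q x} (x i - x j) :: ennreal)" for x
  have [measurable]: "(\<lambda>x. x i) \<in> borel_measurable (lborel_pow N)" "(\<lambda>x. x j) \<in> borel_measurable (lborel_pow N)"
    using ij by (auto intro!: measurable_lborel_component)
  have [measurable]: "f \<in> borel_measurable (lborel_pow N)"
    unfolding f_def by measurable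
  have "(\<integral>\<^sup>+x. f x \<partial>lborel_pow N) = (\<integral>\<^sup>+x. \<integral>\<^sup>+y. f (x(i := y)) \<partial>lborel \<partial>PiM J (\<lambda>_. lborel))"
    unfolding J(1) by (rule product_nn_integral_insert) (use J in \<open>simp_all flip: J(1)\<close>)
  also have "\<dots> = (\<integral>\<^sup>+x. 0 \<partial>PiM J (\<lambda>_. lborel :: 'a measure))"
  proof (rule nn_integral_cong)
    fix x
    have "AE y in lborel. Q (- x j + 1 *\<^sub>R y)" by (rule AE_lborel_affine[OF _ _ AE]) simp_all
    then have "AE y in lborel. f (x(i := y)) = 0"
      by eventually_elim (use ij in \<open>simp add: f_def algebra_simps\<close>)
    then show "(\<integral>\<^sup>+y. f (x(i := y)) \<partial>lborel) = 0"
      by (subst nn_integral_cong_AE[of _ "\<lambda>_. 0"]) auto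
  qed
  finally have "(\<integral>\<^sup>+x. f x \<partial>lborel_pow N) = 0" by simp
  then have "AE x in lborel_pow N. f x = 0" by (subst (asm) nn_integral_0_iff_AE) auto
  then show ?thesis by eventually_elim (auto simp: f_def indicator_def split: if_splits)
qed

text \<open>An essential supremum controls \<open>W\<close> only off a null set, whereas the kernel
  conditions above are pointwise. All later objects see \<open>W\<close> only up to null sets, so
  this version can replace it.\<close>

lemma Linf_bounded_version:
  fixes W :: "'a::euclidean_space \<Rightarrow> real"
  assumes [measurable]: "W \<in> borel_measurable borel" and fin: "Linf_norm W < \<infinity>"
    and sym: "AE x in lborel. W (- x) = W x"
  obtains W' where "W' \<in> borel_measurable borel" "\<And>x. \<bar>W' x\<bar> \<le> real_of_ereal (Linf_norm W)"
    "\<And>x. W' (- x) = W' x" "AE x in lborel. W x = W' x" "0 \<le> Linf_norm W"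
proof -
  have nz: "emeasure lborel (space lborel :: 'a set) \<noteq> 0" by simp
  have "esssup lborel (\<lambda>x::'a. 0 :: ereal) \<le> Linf_norm W"
    unfolding Linf_norm_def by (rule esssup_mono) auto
  then have ge0: "0 \<le> Linf_norm W" using esssup_const[OF nz, of "0::ereal"] by simp
  define L where "L = real_of_ereal (Linf_norm W)"
  have L: "Linf_norm W = ereal L" using ge0 fin by (cases "Linf_norm W") (auto simp: L_def)
  have L0: "0 \<le> L" using ge0 L by simp
  have bd: "AE x in lborel. \<bar>W x\<bar> \<le> L"
    using esssup_AE[of "\<lambda>x. ereal \<bar>W x\<bar>" lborel] by (simp add: Linf_norm_def[symmetric] L)
  have bd': "AE x in lborel. \<bar>W (0 + (- 1) *\<^sub>R x)\<bar> \<le> L"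
    by (rule AE_lborel_affine[OF _ _ bd]) simp_all
  \<comment> \<open>The set on which \<open>W\<close> is kept is invariant under reflection, so
    putting 0 elsewhere does not destroy evenness.\<close>
  define W' where "W' x = (if \<bar>W x\<bar> \<le> L \<and> \<bar>W (- x)\<bar> \<le> L \<and> W (- x) = W x then W x else 0)" for x
  show ?thesis
  proof
    show "W' \<in> borel_measurable borel" unfolding W'_def by measurable
    show "\<bar>W' x\<bar> \<le> real_of_ereal (Linf_norm W)" for x using L0 by (auto simp: W'_def L)
    show "W' (- x) = W' x" for x by (auto simp: W'_def)
    show "AE x in lborel. W x = W' x"
      using bd bd' sym by eventually_elim (auto simp: W'_def)
  qed (rule ge0)
qed

section \<open>Tensor powers and marginals as measures\<close>

lemma prob_space_density_prob_density:
  "prob_density \<rho> \<Longrightarrow> prob_space (density lborel (\<lambda>x. ennreal (\<rho> x)))"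
  by (rule prob_spaceI) (simp add: prob_density_def emeasure_density nn_integral_eq_integral)

lemma measurable_tensor_pow:
  "\<rho> \<in> borel_measurable borel \<Longrightarrow> tensor_pow k \<rho> \<in> borel_measurable (lborel_pow k)"
  unfolding tensor_pow_def
  by (intro borel_measurable_prod measurable_compose[OF measurable_lborel_component]) auto

lemma PiM_density_tensor_pow:
  fixes \<rho> :: "'a::euclidean_space \<Rightarrow> real"
  assumes \<rho>: "prob_density \<rho>"
  shows "PiM {..<k} (\<lambda>_. density lborel (\<lambda>x. ennreal (\<rho> x))) = measure_of_density k (tensor_pow k \<rho>)"
proof -
  let ?D = "density lborel (\<lambda>x. ennreal (\<rho> x))"
  have [measurable]: "\<rho> \<in> borel_measurable borel" and nn: "\<And>x. 0 \<le> \<rho> x"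
    using \<rho> by (auto simp: prob_density_def)
  interpret D: prob_space ?D using \<rho> by (rule prob_space_density_prob_density)
  interpret PD: product_prob_space "\<lambda>_::nat. ?D" "{..<k}" by (rule product_prob_spaceI) (rule D.prob_space_axioms)
  interpret L: product_sigma_finite "\<lambda>_::nat. lborel :: 'a measure" by (rule product_sigma_finite_lborel)
  have "measure_of_density k (tensor_pow k \<rho>) = PiM {..<k} (\<lambda>_. ?D)"
  proof (rule PD.PiM_eqI)
    show "sets (measure_of_density k (tensor_pow k \<rho>)) = sets (PiM {..<k} (\<lambda>_. ?D))"
      by (auto simp: measure_of_density_def intro!: sets_PiM_cong)
    fix A assume A: "\<And>i. i \<in> {..<k} \<Longrightarrow> A i \<in> sets ?D"
    have As: "Pi\<^sub>E {..<k} A \<in> sets (lborel_pow k)"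
      by (rule sets_PiM_I_finite) (use A in auto)
    have "emeasure (measure_of_density k (tensor_pow k \<rho>)) (Pi\<^sub>E {..<k} A)
       = (\<integral>\<^sup>+x. ennreal (tensor_pow k \<rho> x) * indicator (Pi\<^sub>E {..<k} A) x \<partial>lborel_pow k)"
      unfolding measure_of_density_def
      by (rule emeasure_density) (use As measurable_tensor_pow[of \<rho> k] in auto)
    also have "\<dots> = (\<integral>\<^sup>+x. (\<Prod>i<k. ennreal (\<rho> (x i)) * indicator (A i) (x i)) \<partial>lborel_pow k)"
    proof (rule nn_integral_cong)
      fix x :: "nat \<Rightarrow> 'a" assume "x \<in> space (lborel_pow k)"
      then have "indicator (Pi\<^sub>E {..<k} A) x = (\<Prod>i<k. indicator (A i) (x i) :: ennreal)"
        by (auto simp: indicator_def space_PiM PiE_iff prod_zero_iff)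
      then show "ennreal (tensor_pow k \<rho> x) * indicator (Pi\<^sub>E {..<k} A) x = (\<Prod>i<k. ennreal (\<rho> (x i)) * indicator (A i) (x i))"
        using nn by (simp add: tensor_pow_def prod.distrib prod_ennreal)
    qed
    also have "\<dots> = (\<Prod>i<k. \<integral>\<^sup>+x. ennreal (\<rho> x) * indicator (A i) x \<partial>lborel)"
      by (rule L.product_nn_integral_prod) (use A in auto)
    also have "\<dots> = (\<Prod>i<k. emeasure ?D (A i))"
      using A by (intro prod.cong) (auto simp: emeasure_density)
    finally show "emeasure (measure_of_density k (tensor_pow k \<rho>)) (Pi\<^sub>E {..<k} A) = (\<Prod>i<k. emeasure ?D (A i))" .
  qed simp
  then show ?thesis by simp
qed

lemma measure_of_density_marginal:
  fixes f :: "(nat \<Rightarrow> 'a::euclidean_space) \<Rightarrow> real"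
  assumes k: "k \<le> N" and f: "integrable (lborel_pow N) f" and nn: "\<And>x. 0 \<le> f x"
  shows "measure_of_density k (marginal N k f)
    = distr (measure_of_density N f) (lborel_pow k) (\<lambda>x. restrict x {..<k})"
    and "marginal N k f \<in> borel_measurable (lborel_pow k)"
proof -
  interpret L: product_sigma_finite "\<lambda>_::nat. lborel :: 'a measure" by (rule product_sigma_finite_lborel)
  let ?L1 = "PiM {..<k} (\<lambda>_. lborel :: 'a measure)" and ?L2 = "PiM {k..<N} (\<lambda>_. lborel :: 'a measure)"
  let ?mrg = "merge {..<k} {k..<N} :: (nat \<Rightarrow> 'a) \<times> (nat \<Rightarrow> 'a) \<Rightarrow> nat \<Rightarrow> 'a"
  interpret L1: sigma_finite_measure ?L1 by (rule L.sigma_finite) simp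
  interpret L2: sigma_finite_measure ?L2 by (rule L.sigma_finite) simp
  interpret P: pair_sigma_finite ?L1 ?L2 ..
  have un: "{..<k} \<union> {k..<N} = {..<N}" and dis: "{..<k} \<inter> {k..<N} = {}" using k by auto
  have [measurable]: "f \<in> borel_measurable (lborel_pow N)" using f by auto
  have mm: "?mrg \<in> measurable (?L1 \<Otimes>\<^sub>M ?L2) (lborel_pow N)"
    using measurable_merge[of "{..<k}" "{k..<N}" "\<lambda>_. lborel"] by (simp add: un)
  have dm: "distr (?L1 \<Otimes>\<^sub>M ?L2) (lborel_pow N) (?mrg) = lborel_pow N"
    using L.distr_merge[OF dis] by (simp add: un)
  have fm: "(\<lambda>z. f (?mrg z)) \<in> borel_measurable (?L1 \<Otimes>\<^sub>M ?L2)"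
    by (rule measurable_compose[OF mm]) simp
  have int: "integrable (?L1 \<Otimes>\<^sub>M ?L2) (\<lambda>z. f (?mrg z))"
    by (rule integrable_distr[OF mm]) (simp add: dm f)
  show marg_meas: "marginal N k f \<in> borel_measurable (lborel_pow k)"
    unfolding marginal_def
    by (rule L2.borel_measurable_lebesgue_integral) (use fm in \<open>simp add: case_prod_beta'\<close>)
  have rm: "(\<lambda>x. restrict x {..<k}) \<in> measurable (lborel_pow N) ?L1"
    by (rule measurable_restrict_subset) (use k in auto)
  \<comment> \<open>The Bochner integral in \<open>marginal\<close> takes the default value 0 on
    fibres where \<open>f\<close> is not integrable; Fubini makes these a null set, so the marginal
    agrees there with the Tonelli integral up to null sets.\<close>
  have AE: "AE x in ?L1. ennreal (marginal N k f x) = (\<integral>\<^sup>+y. ennreal (f (?mrg (x, y))) \<partial>?L2)"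
    using P.AE_integrable_fst'[OF int]
  proof eventually_elim
    case (elim x)
    then show ?case
      unfolding marginal_def using nn by (subst nn_integral_eq_integral) auto
  qed
  show "measure_of_density k (marginal N k f) = distr (measure_of_density N f) (lborel_pow k) (\<lambda>x. restrict x {..<k})"
  proof (rule measure_eqI)
    fix A assume "A \<in> sets (measure_of_density k (marginal N k f))"
    then have A[measurable]: "A \<in> sets ?L1" by (simp add: measure_of_density_def)
    have m1: "(\<lambda>x. restrict x {..<k}) \<in> measurable (measure_of_density N f) ?L1"
      using rm by (simp add: measure_of_density_def)
    have "emeasure (distr (measure_of_density N f) ?L1 (\<lambda>x. restrict x {..<k})) A
      = (\<integral>\<^sup>+x. indicator A (restrict x {..<k}) \<partial>measure_of_density N f)"
      using m1 A by (simp add: nn_integral_distr flip: nn_integral_indicator)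
    also have "\<dots> = (\<integral>\<^sup>+x. ennreal (f x) * indicator A (restrict x {..<k}) \<partial>lborel_pow N)"
      unfolding measure_of_density_def
      by (rule nn_integral_density) (use rm A in measurable)
    also have "\<dots> = (\<integral>\<^sup>+x. \<integral>\<^sup>+y. ennreal (f (?mrg (x, y)))
        * indicator A (restrict (?mrg (x, y)) {..<k}) \<partial>?L2 \<partial>?L1)"
      using L.product_nn_integral_fold[OF dis, of "\<lambda>x. ennreal (f x) * indicator A (restrict x {..<k})"] rm A
      by (simp add: un)
    also have "\<dots> = (\<integral>\<^sup>+x. \<integral>\<^sup>+y. ennreal (f (?mrg (x, y))) * indicator A x \<partial>?L2 \<partial>?L1)"
    proof (intro nn_integral_cong)
      fix x y assume "x \<in> space ?L1"
      then have "restrict (?mrg (x, y)) {..<k} = x"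
        by (auto simp: space_PiM PiE_iff extensional_def restrict_def merge_def fun_eq_iff)
      then show "ennreal (f (?mrg (x, y))) * indicator A (restrict (?mrg (x, y)) {..<k})
        = ennreal (f (?mrg (x, y))) * indicator A x" by simp
    qed
    also have "\<dots> = (\<integral>\<^sup>+x. (\<integral>\<^sup>+y. ennreal (f (?mrg (x, y))) \<partial>?L2) * indicator A x \<partial>?L1)"
    proof (intro nn_integral_cong nn_integral_multc)
      fix x assume x: "x \<in> space ?L1"
      show "(\<lambda>y. ennreal (f (?mrg (x, y)))) \<in> borel_measurable ?L2"
        using measurable_compose[OF measurable_Pair1'[OF x] fm] by simp
    qed
    also have "\<dots> = (\<integral>\<^sup>+x. ennreal (marginal N k f x) * indicator A x \<partial>?L1)"
      by (rule nn_integral_cong_AE) (use AE in eventually_elim, simp)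
    also have "\<dots> = emeasure (measure_of_density k (marginal N k f)) A"
      unfolding measure_of_density_def using marg_meas A by (simp add: emeasure_density)
    finally show "emeasure (measure_of_density k (marginal N k f)) A
      = emeasure (distr (measure_of_density N f) (lborel_pow k) (\<lambda>x. restrict x {..<k})) A" by simp
  qed (simp add: measure_of_density_def)
qed

section \<open>Relative entropy, total variation and Wasserstein distance\<close>

lemma ext_integral_integrable:
  assumes "integrable M f"
  shows "ext_integral M f = ereal (\<integral>x. f x \<partial>M)"
proof -
  have fin: "(\<integral>\<^sup>+x. ennreal (f x) \<partial>M) \<noteq> \<infinity>" "(\<integral>\<^sup>+x. ennreal (- f x) \<partial>M) \<noteq> \<infinity>"
    using assms by (auto simp: real_integrable_def)
  obtain a where a: "(\<integral>\<^sup>+x. ennreal (f x) \<partial>M) = ennreal a" "0 \<le> a"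
    using fin(1) by (cases "\<integral>\<^sup>+x. ennreal (f x) \<partial>M") auto
  obtain b where b: "(\<integral>\<^sup>+x. ennreal (- f x) \<partial>M) = ennreal b" "0 \<le> b"
    using fin(2) by (cases "\<integral>\<^sup>+x. ennreal (- f x) \<partial>M") auto
  show ?thesis
    using real_lebesgue_integral_def[OF assms] a b by (simp add: ext_integral_def)
qed

text \<open>Uniqueness of the Radon-Nikodym derivative identifies it with \<open>g\<close> almost
  everywhere, and the two-sided bound makes ln g bounded, so the extended integral is an ordinary
  one.\<close>

lemma rel_entropy_density:
  assumes Q: "prob_space Q" and g[measurable]: "g \<in> borel_measurable Q"
    and bd: "\<And>x. x \<in> space Q \<Longrightarrow> c \<le> g x" "\<And>x. x \<in> space Q \<Longrightarrow> g x \<le> C" and c: "0 < c"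
    and g1: "(\<integral>x. g x \<partial>Q) = 1"
  shows "rel_entropy (density Q (\<lambda>x. ennreal (g x))) Q = ereal (\<integral>x. g x * ln (g x) \<partial>Q)"
proof -
  interpret Q: prob_space Q by fact
  let ?D = "density Q (\<lambda>x. ennreal (g x))"
  have int_g: "integrable Q g"
  proof (rule Q.integrable_bounded[OF g])
    show "\<bar>g x\<bar> \<le> C" if "x \<in> space Q" for x using bd[OF that] c by linarith
  qed
  have g_nn: "AE x in Q. 0 \<le> g x"
    using bd(1) c by (intro AE_I2) (meson less_imp_le order_trans)
  have "emeasure ?D (space ?D) = 1"
    using int_g g_nn g1 by (simp add: emeasure_density nn_integral_eq_integral cong: nn_integral_cong)
  then interpret D: prob_space ?D by (rule prob_spaceI)
  have ac: "absolutely_continuous Q ?D" by (rule absolutely_continuousI_density) simp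
  have RN: "AE x in Q. ennreal (g x) = RN_deriv Q ?D x"
    by (rule RN_deriv_unique_sigma_finite) (auto intro: D.sigma_finite_measure_axioms)
  have "AE x in Q. ln (enn2real (RN_deriv Q ?D x)) = ln (g x)"
    using RN g_nn by eventually_elim (metis enn2real_ennreal)
  then have AE: "AE x in ?D. ln (enn2real (RN_deriv Q ?D x)) = ln (g x)"
    by (subst AE_density) (auto elim: eventually_mono)
  have "ext_integral ?D (\<lambda>x. ln (enn2real (RN_deriv Q ?D x))) = ext_integral ?D (\<lambda>x. ln (g x))"
    unfolding ext_integral_def
    by (intro arg_cong2[where f = "(-)"] arg_cong[where f = enn2ereal] nn_integral_cong_AE)
       (use AE in \<open>eventually_elim, simp\<close>)+
  also have "\<dots> = ereal (\<integral>x. ln (g x) \<partial>?D)"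
  proof (intro ext_integral_integrable D.integrable_bounded)
    show "\<bar>ln (g x)\<bar> \<le> \<bar>ln c\<bar> + \<bar>ln C\<bar>" if "x \<in> space ?D" for x
    proof -
      have "ln c \<le> ln (g x)" "ln (g x) \<le> ln C" using bd[of x] that c by auto
      then show ?thesis by linarith
    qed
  qed measurable
  also have "(\<integral>x. ln (g x) \<partial>?D) = (\<integral>x. g x * ln (g x) \<partial>Q)"
    using g_nn by (subst integral_density) auto
  finally show ?thesis using ac by (simp add: rel_entropy_def)
qed

text \<open>The marginal is known as a measure only; sigma-finiteness of Lebesgue measure upgrades
  the equality of measures to f = tensor power times \<open>g\<close> almost everywhere, which is
  all that an L^1 distance needs.\<close>

lemma tv_dist_density:
  fixes f \<rho> g
  assumes \<rho>: "prob_density (\<rho> :: 'a::euclidean_space \<Rightarrow> real)"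
    and f: "f \<in> borel_measurable (lborel_pow k)" "\<And>x. 0 \<le> f x"
    and g: "g \<in> borel_measurable (lborel_pow k)" "\<And>x. x \<in> space (lborel_pow k) \<Longrightarrow> 0 \<le> g x"
    and eq: "measure_of_density k f = density (measure_of_density k (tensor_pow k \<rho>)) (\<lambda>x. ennreal (g x))"
    and int: "integrable (measure_of_density k (tensor_pow k \<rho>)) g"
  shows "tv_dist k f (tensor_pow k \<rho>) = ereal (\<integral>x. \<bar>g x - 1\<bar> \<partial>measure_of_density k (tensor_pow k \<rho>))"
proof -
  interpret L: product_sigma_finite "\<lambda>_::nat. lborel :: 'a measure" by (rule product_sigma_finite_lborel)
  interpret Lk: sigma_finite_measure "lborel_pow k :: (nat \<Rightarrow> 'a) measure" by (rule L.sigma_finite) simp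
  note [measurable] = f(1) g(1)
  have [measurable]: "\<rho> \<in> borel_measurable borel" and nn: "\<And>x. 0 \<le> \<rho> x"
    using \<rho> by (auto simp: prob_density_def)
  have [measurable]: "tensor_pow k \<rho> \<in> borel_measurable (lborel_pow k)" by (rule measurable_tensor_pow) simp
  have tnn: "0 \<le> tensor_pow k \<rho> x" for x using nn by (simp add: tensor_pow_def prod_nonneg)
  let ?Q = "measure_of_density k (tensor_pow k \<rho>)"
  interpret D: prob_space "density lborel (\<lambda>x. ennreal (\<rho> x))" using \<rho> by (rule prob_space_density_prob_density)
  interpret Q: prob_space ?Q
    unfolding PiM_density_tensor_pow[OF \<rho>, symmetric] by (rule prob_space_PiM) (rule D.prob_space_axioms)
  have "density (lborel_pow k) (\<lambda>x. ennreal (f x)) = density (lborel_pow k) (\<lambda>x. ennreal (tensor_pow k \<rho> x) * ennreal (g x))"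
    using eq unfolding measure_of_density_def by (subst (asm) density_density_eq) auto
  then have "AE x in lborel_pow k. ennreal (f x) = ennreal (tensor_pow k \<rho> x) * ennreal (g x)"
    by (subst (asm) Lk.density_unique_iff) auto
  then have AE: "AE x in lborel_pow k. f x = tensor_pow k \<rho> x * g x"
    using AE_space
  proof eventually_elim
    case (elim x)
    then show ?case using f(2) g(2)[of x] tnn[of x]
      by (simp flip: ennreal_mult add: ennreal_inj)
  qed
  have "(\<integral>\<^sup>+x. ennreal \<bar>f x - tensor_pow k \<rho> x\<bar> \<partial>lborel_pow k)
     = (\<integral>\<^sup>+x. ennreal (tensor_pow k \<rho> x) * ennreal \<bar>g x - 1\<bar> \<partial>lborel_pow k)"
  proof (rule nn_integral_cong_AE, use AE in eventually_elim)
    case (elim x)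
    have "tensor_pow k \<rho> x * g x - tensor_pow k \<rho> x = tensor_pow k \<rho> x * (g x - 1)" by (simp add: algebra_simps)
    then show ?case using tnn[of x] by (simp add: elim abs_mult ennreal_mult)
  qed
  also have "\<dots> = (\<integral>\<^sup>+x. ennreal \<bar>g x - 1\<bar> \<partial>?Q)"
    unfolding measure_of_density_def by (rule nn_integral_density[symmetric]) auto
  also have "\<dots> = ennreal (\<integral>x. \<bar>g x - 1\<bar> \<partial>?Q)"
    using int by (intro nn_integral_eq_integral) auto
  finally show ?thesis by (simp add: tv_dist_def)
qed

text \<open>The coupling keeps the common part \<open>min f 1\<close> on the diagonal and couples the
  excess \<open>p = (f - 1)\<^sup>+\<close> and the deficit \<open>q = (1 - f)\<^sup>+\<close> independently. It is the image of a density on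
  triples \<open>(x, y, d)\<close>, where \<open>d\<close> selects the diagonal part.\<close>

lemma wasserstein1_density_le:
  fixes M :: "'a::euclidean_space measure" and f :: "'a \<Rightarrow> real"
  assumes M: "prob_space M" and sM: "sets M = sets borel" and f_meas: "f \<in> borel_measurable borel"
    and f0: "\<And>x. 0 \<le> f x" and f\<epsilon>: "\<And>x. \<bar>f x - 1\<bar> \<le> \<epsilon>" and f1: "(\<integral>x. f x \<partial>M) = 1"
  shows "wasserstein1 (density M (\<lambda>x. ennreal (f x))) M \<le> ennreal \<epsilon> * (\<integral>\<^sup>+x. ennreal (norm x) \<partial>M)"
proof -
  interpret M: prob_space M by fact
  note sM[measurable_cong] f_meas[measurable]
  have spM: "space M = UNIV" using sets_eq_imp_space_eq[OF sM] by simp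
  have int_f: "integrable M f"
  proof (rule M.integrable_bounded)
    show "\<bar>f x\<bar> \<le> 1 + \<epsilon>" for x using f\<epsilon>[of x] by linarith
  qed measurable
  define p q where "p x = max (f x - 1) 0" and "q x = max (1 - f x) 0" for x
  have [measurable]: "p \<in> borel_measurable borel" "q \<in> borel_measurable borel"
    unfolding p_def q_def by measurable
  have p0: "0 \<le> p x" and q0: "0 \<le> q x" for x by (auto simp: p_def q_def)
  have pq: "p x + q x = \<bar>f x - 1\<bar>" "min (f x) 1 + p x = f x" "min (f x) 1 + q x = 1" for x
    by (auto simp: p_def q_def)
  have pq_le: "\<bar>p x\<bar> \<le> \<epsilon>" "\<bar>q x\<bar> \<le> \<epsilon>" for x using f\<epsilon>[of x] by (auto simp: p_def q_def)
  have int_p: "integrable M p" "integrable M q"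
    by (rule M.integrable_bounded[where B = \<epsilon>]; use pq_le in simp)+
  define m where "m = (\<integral>x. p x \<partial>M)"
  \<comment> \<open>Excess and deficit have the same mass, because \<open>f\<close> has mean 1;
    without this they could not be coupled to each other.\<close>
  have "(\<integral>x. p x - q x \<partial>M) = (\<integral>x. f x - 1 \<partial>M)"
    by (rule Bochner_Integration.integral_cong) (auto simp: p_def q_def)
  then have mq: "(\<integral>x. q x \<partial>M) = m"
    using int_p int_f f1 by (simp add: m_def M.prob_space)
  have m0: "0 \<le> m" unfolding m_def by (rule Bochner_Integration.integral_nonneg) (rule p0)
  show ?thesis
  proof (cases "m = 0")
    case True
    have "AE x in M. p x = 0" "AE x in M. q x = 0"
      using True mq int_p p0 q0 integral_nonneg_eq_0_iff_AE[of M p] integral_nonneg_eq_0_iff_AE[of M q]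
      by (auto simp: m_def)
    then have "AE x in M. ennreal (f x) = 1"
      by eventually_elim (use pq(1) in \<open>smt (verit) ennreal_1\<close>)
    then have D: "density M (\<lambda>x. ennreal (f x)) = M"
      using density_cong[of "\<lambda>x. ennreal (f x)" M "\<lambda>_. 1"] by (simp add: density_1)
    define \<gamma> where "\<gamma> = distr M (borel \<Otimes>\<^sub>M borel) (\<lambda>x. (x, x))"
    have "distr M borel (\<lambda>x. x) = M" by (rule distr_id2) (simp add: sM)
    then have "\<gamma> \<in> couplings M M"
      unfolding couplings_def \<gamma>_def by (auto simp: distr_distr comp_def)
    then have "wasserstein1 M M \<le> (\<integral>\<^sup>+z. ennreal (dist (fst z) (snd z)) \<partial>\<gamma>)"
      unfolding wasserstein1_def by (rule INF_lower)
    also have "\<dots> = 0" unfolding \<gamma>_def by (subst nn_integral_distr) auto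
    finally show ?thesis by (simp add: D)
  next
    case False
    with m0 have m: "0 < m" by simp
    let ?w = "\<lambda>x y. ennreal (p x) * ennreal (q y) * ennreal (1 / m)"
    define B where "B = count_space (UNIV :: bool set)"
    interpret B: sigma_finite_measure B unfolding B_def by (rule sigma_finite_measure_count_space_countable) simp
    interpret MB: pair_sigma_finite M B ..
    interpret MMB: pair_sigma_finite M "M \<Otimes>\<^sub>M B" ..
    have [measurable_cong]: "sets B = sets (count_space UNIV)" by (simp add: B_def)
    define h where "h x y d = (if d then ennreal (min (f x) 1) else ?w x y)"
      for x y and d :: bool
    define h' where "h' = (\<lambda>(x, y, d). h x y d)"
    define T where "T = (\<lambda>(x, y, d). (x, if d then x else y) :: 'a \<times> 'a)"
    have h'_meas[measurable]: "h' \<in> borel_measurable (M \<Otimes>\<^sub>M (M \<Otimes>\<^sub>M B))"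
      unfolding h'_def h_def case_prod_beta by measurable
    have T_meas[measurable]: "T \<in> measurable (M \<Otimes>\<^sub>M (M \<Otimes>\<^sub>M B)) (borel \<Otimes>\<^sub>M borel)"
      unfolding T_def case_prod_beta by measurable
    define \<gamma> where "\<gamma> = distr (density (M \<Otimes>\<^sub>M (M \<Otimes>\<^sub>M B)) h') (borel \<Otimes>\<^sub>M borel) T"
    have int_q: "(\<integral>\<^sup>+y. ennreal (q y) \<partial>M) = ennreal m"
      using int_p q0 mq by (subst nn_integral_eq_integral) auto
    have int_p': "(\<integral>\<^sup>+y. ennreal (p y) \<partial>M) = ennreal m"
      using int_p p0 by (subst nn_integral_eq_integral) (auto simp: m_def)
    have mm: "ennreal m * ennreal (1 / m) = 1" using m by (simp flip: ennreal_mult)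
    have \<gamma>_int: "(\<integral>\<^sup>+z. F z \<partial>\<gamma>) = (\<integral>\<^sup>+x. ennreal (min (f x) 1) * F (x, x) \<partial>M)
       + (\<integral>\<^sup>+x. \<integral>\<^sup>+y. ?w x y * F (x, y) \<partial>M \<partial>M)"
      if F[measurable]: "F \<in> borel_measurable (borel \<Otimes>\<^sub>M borel)" for F
    proof -
      have "(\<integral>\<^sup>+z. F z \<partial>\<gamma>) = (\<integral>\<^sup>+w. h' w * F (T w) \<partial>(M \<Otimes>\<^sub>M (M \<Otimes>\<^sub>M B)))"
        unfolding \<gamma>_def by (subst nn_integral_distr; simp add: nn_integral_density)
      also have "\<dots> = (\<integral>\<^sup>+x. \<integral>\<^sup>+y. \<integral>\<^sup>+d. h' (x, y, d) * F (T (x, y, d)) \<partial>B \<partial>M \<partial>M)"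
      proof -
        have H: "(\<lambda>w. h' w * F (T w)) \<in> borel_measurable (M \<Otimes>\<^sub>M (M \<Otimes>\<^sub>M B))" by measurable
        have Hx: "(\<lambda>w. h' (x, w) * F (T (x, w))) \<in> borel_measurable (M \<Otimes>\<^sub>M B)" for x
          using measurable_compose[OF measurable_Pair1'[of x M "M \<Otimes>\<^sub>M B"] H] by (simp add: spM)
        show ?thesis
          unfolding MB.P.nn_integral_fst[OF H, symmetric] using B.nn_integral_fst[OF Hx] by simp
      qed
      also have "\<dots> = (\<integral>\<^sup>+x. \<integral>\<^sup>+y. ennreal (min (f x) 1) * F (x, x) + ?w x y * F (x, y) \<partial>M \<partial>M)"
        by (simp add: B_def nn_integral_count_space_finite UNIV_bool h'_def h_def T_def add.commute)
      also have "\<dots> = (\<integral>\<^sup>+x. ennreal (min (f x) 1) * F (x, x) + (\<integral>\<^sup>+y. ?w x y * F (x, y) \<partial>M) \<partial>M)"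
        by (subst nn_integral_add) (simp_all add: M.emeasure_space_1)
      also have "\<dots> = (\<integral>\<^sup>+x. ennreal (min (f x) 1) * F (x, x) \<partial>M)
       + (\<integral>\<^sup>+x. \<integral>\<^sup>+y. ?w x y * F (x, y) \<partial>M \<partial>M)"
        by (rule nn_integral_add) measurable
      finally show ?thesis .
    qed
    have fst_part: "(\<integral>\<^sup>+x. \<integral>\<^sup>+y. ?w x y * g x \<partial>M \<partial>M) = (\<integral>\<^sup>+x. ennreal (p x) * g x \<partial>M)"
      if [measurable]: "g \<in> borel_measurable borel" for g
    proof (rule nn_integral_cong)
      fix x
      have "(\<integral>\<^sup>+y. ?w x y * g x \<partial>M)
         = (\<integral>\<^sup>+y. (ennreal (p x) * ennreal (1 / m) * g x) * ennreal (q y) \<partial>M)"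
        by (simp add: mult_ac)
      also have "\<dots> = (ennreal (p x) * ennreal (1 / m) * g x) * ennreal m"
        by (subst nn_integral_cmult) (auto simp: int_q)
      also have "\<dots> = ennreal (p x) * g x * (ennreal m * ennreal (1 / m))" by (simp only: mult_ac)
      finally show "(\<integral>\<^sup>+y. ?w x y * g x \<partial>M) = ennreal (p x) * g x"
        by (simp add: mm)
    qed
    have snd_part: "(\<integral>\<^sup>+x. \<integral>\<^sup>+y. ?w x y * g y \<partial>M \<partial>M) = (\<integral>\<^sup>+x. ennreal (q x) * g x \<partial>M)"
      if [measurable]: "g \<in> borel_measurable borel" for g
    proof -
      have "(\<integral>\<^sup>+x. \<integral>\<^sup>+y. ?w x y * g y \<partial>M \<partial>M)
        = (\<integral>\<^sup>+x. ennreal (p x) * (ennreal (1 / m) * (\<integral>\<^sup>+y. ennreal (q y) * g y \<partial>M)) \<partial>M)"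
        by (subst nn_integral_cmult[symmetric], measurable, subst nn_integral_cmult[symmetric], measurable, simp only: mult_ac)
      also have "\<dots> = ennreal m * (ennreal (1 / m) * (\<integral>\<^sup>+y. ennreal (q y) * g y \<partial>M))"
        by (subst nn_integral_multc) (auto simp: int_p')
      also have "\<dots> = (ennreal m * ennreal (1 / m)) * (\<integral>\<^sup>+y. ennreal (q y) * g y \<partial>M)" by (simp only: mult_ac)
      finally show ?thesis by (simp add: mm)
    qed
    have "\<gamma> \<in> couplings (density M (\<lambda>x. ennreal (f x))) M"
      unfolding couplings_def
    proof (intro CollectI conjI)
      show "sets \<gamma> = sets (borel \<Otimes>\<^sub>M borel)" by (simp add: \<gamma>_def)
      have [measurable_cong]: "sets \<gamma> = sets (borel \<Otimes>\<^sub>M borel)" by (simp add: \<gamma>_def)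
      show "distr \<gamma> borel fst = density M (\<lambda>x. ennreal (f x))"
      proof (rule measure_eqI)
        fix A :: "'a set" assume "A \<in> sets (distr \<gamma> borel fst)"
        then have [measurable]: "A \<in> sets borel" by simp
        have "emeasure (distr \<gamma> borel fst) A = (\<integral>\<^sup>+z. indicator A (fst z) \<partial>\<gamma>)"
          by (simp add: nn_integral_distr flip: nn_integral_indicator)
        also have "\<dots> = (\<integral>\<^sup>+x. ennreal (min (f x) 1) * indicator A x \<partial>M) + (\<integral>\<^sup>+x. ennreal (p x) * indicator A x \<partial>M)"
          by (subst \<gamma>_int) (simp_all add: fst_part)
        also have "\<dots> = (\<integral>\<^sup>+x. ennreal (f x) * indicator A x \<partial>M)"
          using f0 p0 pq(2)
          by (subst nn_integral_add[symmetric]) (auto simp flip: distrib_right ennreal_plus)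
        also have "\<dots> = emeasure (density M (\<lambda>x. ennreal (f x))) A"
          by (simp add: emeasure_density sM)
        finally show "emeasure (distr \<gamma> borel fst) A = emeasure (density M (\<lambda>x. ennreal (f x))) A" .
      qed (simp add: sM)
      show "distr \<gamma> borel snd = M"
      proof (rule measure_eqI)
        fix A :: "'a set" assume "A \<in> sets (distr \<gamma> borel snd)"
        then have [measurable]: "A \<in> sets borel" by simp
        have "emeasure (distr \<gamma> borel snd) A = (\<integral>\<^sup>+z. indicator A (snd z) \<partial>\<gamma>)"
          by (simp add: nn_integral_distr flip: nn_integral_indicator)
        also have "\<dots> = (\<integral>\<^sup>+x. ennreal (min (f x) 1) * indicator A x \<partial>M) + (\<integral>\<^sup>+x. ennreal (q x) * indicator A x \<partial>M)"
          by (subst \<gamma>_int) (simp_all add: snd_part)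
        also have "\<dots> = (\<integral>\<^sup>+x. indicator A x \<partial>M)"
          using f0 q0 pq(3)
          by (subst nn_integral_add[symmetric]) (auto simp flip: distrib_right ennreal_plus)
        also have "\<dots> = emeasure M A"
          by (simp add: sM)
        finally show "emeasure (distr \<gamma> borel snd) A = emeasure M A" .
      qed (simp add: sM)
    qed
    then have "wasserstein1 (density M (\<lambda>x. ennreal (f x))) M \<le> (\<integral>\<^sup>+z. ennreal (dist (fst z) (snd z)) \<partial>\<gamma>)"
      unfolding wasserstein1_def by (rule INF_lower)
    also have "\<dots> = (\<integral>\<^sup>+x. \<integral>\<^sup>+y. ?w x y * ennreal (dist x y) \<partial>M \<partial>M)"
      by (subst \<gamma>_int) simp_all
    \<comment> \<open>The diagonal part costs nothing. Off it, the distance is bounded through the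
      origin, which separates the variables and leaves first moments weighted by excess and deficit;
      their sum is |f - 1|.\<close>
    also have "\<dots> \<le> (\<integral>\<^sup>+x. \<integral>\<^sup>+y. ?w x y * ennreal (norm x)
       + ?w x y * ennreal (norm y) \<partial>M \<partial>M)"
      unfolding distrib_left[symmetric]
      by (intro nn_integral_mono mult_left_mono) (auto simp: dist_norm norm_triangle_ineq4 simp flip: ennreal_plus)
    also have "\<dots> = (\<integral>\<^sup>+x. ennreal (p x) * ennreal (norm x) \<partial>M) + (\<integral>\<^sup>+x. ennreal (q x) * ennreal (norm x) \<partial>M)"
      unfolding fst_part[of "\<lambda>x. ennreal (norm x)", simplified, symmetric] snd_part[of "\<lambda>x. ennreal (norm x)", simplified, symmetric]
      by (subst nn_integral_add[symmetric], measurable, subst nn_integral_add[symmetric], measurable)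
    also have "\<dots> = (\<integral>\<^sup>+x. ennreal \<bar>f x - 1\<bar> * ennreal (norm x) \<partial>M)"
      using p0 q0 by (subst nn_integral_add[symmetric]) (auto simp flip: distrib_right ennreal_plus pq(1))
    also have "\<dots> \<le> (\<integral>\<^sup>+x. ennreal \<epsilon> * ennreal (norm x) \<partial>M)"
      by (intro nn_integral_mono mult_right_mono ennreal_leI f\<epsilon>) auto
    also have "\<dots> = ennreal \<epsilon> * (\<integral>\<^sup>+x. ennreal (norm x) \<partial>M)"
      by (rule nn_integral_cmult) measurable
    finally show ?thesis .
  qed
qed

section \<open>The Euler-Lagrange equation of a minimizer\<close>

locale bounded_interaction =
  fixes \<beta> :: real and U W :: "'a::euclidean_space \<Rightarrow> real" and L :: real
  assumes \<beta>_pos: "0 < \<beta>"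
    and U_meas[measurable]: "U \<in> borel_measurable borel"
    and W_meas[measurable]: "W \<in> borel_measurable borel"
    and W_bound: "\<And>x. \<bar>W x\<bar> \<le> L" and W_even: "\<And>x. W (- x) = W x"
    and confining: "integrable lborel (\<lambda>x. exp (- \<beta> * U x))"
begin

lemma L_nonneg: "0 \<le> L" using W_bound[of 0] by linarith

abbreviation dens :: "('a \<Rightarrow> real) \<Rightarrow> 'a measure" where
  "dens \<rho> \<equiv> density lborel (\<lambda>x. ennreal (\<rho> x))"

lemma convol_dens: "prob_density \<rho> \<Longrightarrow> convol W \<rho> x = (\<integral>y. W (x - y) \<partial>dens \<rho>)"
  unfolding convol_def prob_density_def by (subst integral_density) (auto simp: mult.commute)

lemma convol_bound:
  assumes \<rho>: "prob_density \<rho>"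
  shows "\<bar>convol W \<rho> x\<bar> \<le> L"
proof -
  interpret prob_space "dens \<rho>" using \<rho> by (rule prob_space_density_prob_density)
  have int: "integrable (dens \<rho>) (\<lambda>y. W (x - y))"
    by (rule integrable_bounded[where B = L]) (use W_bound in auto)
  have "\<bar>convol W \<rho> x\<bar> \<le> (\<integral>y. \<bar>W (x - y)\<bar> \<partial>dens \<rho>)"
    unfolding convol_dens[OF \<rho>] by (rule integral_abs_bound)
  also have "\<dots> \<le> L" by (rule integral_le_const') (use int W_bound in auto)
  finally show ?thesis .
qed

lemma convol_measurable[measurable]: "\<rho> \<in> borel_measurable borel \<Longrightarrow> convol W \<rho> \<in> borel_measurable borel"
  unfolding convol_def
  using lborel.borel_measurable_lebesgue_integral[of "\<lambda>x y. W (x - y) * \<rho> y" "borel :: 'a measure"]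
  by (simp add: case_prod_beta)

lemma integrable_density_mult:
  assumes \<rho>: "prob_density \<rho>" and g: "g \<in> borel_measurable borel" "\<And>x. \<bar>g x\<bar> \<le> C"
  shows "integrable lborel (\<lambda>x. \<rho> x * g x)"
proof -
  have r: "integrable lborel \<rho>" "\<And>x. 0 \<le> \<rho> x" using \<rho> by (auto simp: prob_density_def)
  show ?thesis
  proof (rule Bochner_Integration.integrable_bound[OF integrable_mult_right[OF r(1), of C]])
    show "(\<lambda>x. \<rho> x * g x) \<in> borel_measurable lborel" using r(1) g(1) by measurable
    have "norm (\<rho> x * g x) \<le> norm (C * \<rho> x)" for x
    proof -
      have "\<bar>\<rho> x\<bar> * \<bar>g x\<bar> \<le> \<rho> x * C" using r(2)[of x] g(2)[of x] by (simp add: mult_left_mono)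
      also have "\<dots> \<le> \<bar>C * \<rho> x\<bar>" by (simp add: mult.commute)
      finally show ?thesis by (simp add: abs_mult)
    qed
    then show "AE x in lborel. norm (\<rho> x * g x) \<le> norm (C * \<rho> x)" by simp
  qed
qed

lemma integrable_convol: "prob_density \<rho> \<Longrightarrow> prob_density \<rho>' \<Longrightarrow> integrable lborel (\<lambda>x. \<rho> x * convol W \<rho>' x)"
  by (rule integrable_density_mult[OF _ convol_measurable convol_bound]) (auto simp: prob_density_def)

definition bil :: "('a \<Rightarrow> real) \<Rightarrow> ('a \<Rightarrow> real) \<Rightarrow> real" where
  "bil \<rho> \<rho>' = (LINT x|lborel. \<rho> x * convol W \<rho>' x)"

lemma bil_sym:
  assumes \<rho>: "prob_density \<rho>" and \<rho>': "prob_density \<rho>'"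
  shows "bil \<rho> \<rho>' = bil \<rho>' \<rho>"
proof -
  interpret A: prob_space "dens \<rho>" using \<rho> by (rule prob_space_density_prob_density)
  interpret B: prob_space "dens \<rho>'" using \<rho>' by (rule prob_space_density_prob_density)
  interpret AB: pair_prob_space "dens \<rho>" "dens \<rho>'" ..
  have bil_eq: "bil f g = (\<integral>x. \<integral>y. W (x - y) \<partial>dens g \<partial>dens f)" if "prob_density f" "prob_density g" for f g
  proof -
    have "convol W g \<in> borel_measurable borel" using that by (auto simp: prob_density_def)
    then show ?thesis
      unfolding bil_def convol_dens[OF that(2), symmetric]
      using that(1) by (subst integral_density) (auto simp: prob_density_def)
  qed
  have "integrable (dens \<rho> \<Otimes>\<^sub>M dens \<rho>') (\<lambda>(x, y). W (x - y))"
    by (rule AB.P.integrable_bounded[where B = L]) (use W_bound in auto)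
  from AB.Fubini_integral[OF this]
  have "(\<integral>y. \<integral>x. W (x - y) \<partial>dens \<rho> \<partial>dens \<rho>') = (\<integral>x. \<integral>y. W (x - y) \<partial>dens \<rho>' \<partial>dens \<rho>)" by simp
  moreover have "(\<integral>x. \<integral>y. W (x - y) \<partial>dens \<rho> \<partial>dens \<rho>') = (\<integral>y. \<integral>x. W (x - y) \<partial>dens \<rho> \<partial>dens \<rho>')"
  proof (intro Bochner_Integration.integral_cong refl)
    show "W (x - y) = W (y - x)" for x y using W_even[of "x - y"] by simp
  qed
  ultimately show ?thesis unfolding bil_eq[OF \<rho> \<rho>'] bil_eq[OF \<rho>' \<rho>] by simp
qed

definition mf_norm :: "('a \<Rightarrow> real) \<Rightarrow> real" where
  "mf_norm \<rho> = (LINT x|lborel. exp (- \<beta> * (U x + convol W \<rho> x)))"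

definition mf_gibbs :: "('a \<Rightarrow> real) \<Rightarrow> 'a \<Rightarrow> real" where
  "mf_gibbs \<rho> x = exp (- \<beta> * (U x + convol W \<rho> x)) / mf_norm \<rho>"

lemma mf_norm_pos:
  assumes \<rho>: "prob_density \<rho>"
  shows "0 < mf_norm \<rho>" "integrable lborel (\<lambda>x. exp (- \<beta> * (U x + convol W \<rho> x)))"
proof -
  have [measurable]: "\<rho> \<in> borel_measurable borel" using \<rho> by (auto simp: prob_density_def)
  show int: "integrable lborel (\<lambda>x. exp (- \<beta> * (U x + convol W \<rho> x)))"
  proof (rule Bochner_Integration.integrable_bound[OF integrable_mult_right[OF confining, of "exp (\<beta> * L)"]])
    have "exp (- \<beta> * (U x + convol W \<rho> x)) \<le> exp (\<beta> * L) * exp (- \<beta> * U x)" for x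
    proof -
      have "\<beta> * (- convol W \<rho> x) \<le> \<beta> * L"
        using convol_bound[OF \<rho>, of x] \<beta>_pos by (intro mult_left_mono) auto
      then show ?thesis by (simp add: algebra_simps flip: exp_add)
    qed
    then show "AE x in lborel. norm (exp (- \<beta> * (U x + convol W \<rho> x))) \<le> norm (exp (\<beta> * L) * exp (- \<beta> * U x))"
      by (simp add: abs_mult)
  qed measurable
  have "mf_norm \<rho> \<noteq> 0"
  proof
    assume "mf_norm \<rho> = 0"
    then have "AE x in lborel. exp (- \<beta> * (U x + convol W \<rho> x)) = 0"
      using integral_nonneg_eq_0_iff_AE[OF int] by (simp add: mf_norm_def)
    then have "AE x in (lborel :: 'a measure). False" by simp
    then show False by (simp add: AE_iff_null null_sets_def)
  qed
  moreover have "0 \<le> mf_norm \<rho>" unfolding mf_norm_def by (rule Bochner_Integration.integral_nonneg) simp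
  ultimately show "0 < mf_norm \<rho>" by simp
qed

lemma mf_gibbs_pos: "prob_density \<rho> \<Longrightarrow> 0 < mf_gibbs \<rho> x"
  using mf_norm_pos(1) by (simp add: mf_gibbs_def)

lemma prob_density_mf_gibbs:
  assumes \<rho>: "prob_density \<rho>"
  shows "prob_density (mf_gibbs \<rho>)"
proof -
  have [measurable]: "\<rho> \<in> borel_measurable borel" using \<rho> by (auto simp: prob_density_def)
  show ?thesis
    unfolding prob_density_def
  proof (intro conjI allI)
    show "mf_gibbs \<rho> \<in> borel_measurable borel" unfolding mf_gibbs_def by measurable
    show "0 \<le> mf_gibbs \<rho> x" for x using mf_gibbs_pos[OF \<rho>] by (rule less_imp_le)
    show "integrable lborel (mf_gibbs \<rho>)"
      unfolding mf_gibbs_def using mf_norm_pos(2)[OF \<rho>] by simp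
    show "integral\<^sup>L lborel (mf_gibbs \<rho>) = 1"
      unfolding mf_gibbs_def using mf_norm_pos(1)[OF \<rho>] by (simp add: mf_norm_def)
  qed
qed

text \<open>Potential and entropy stay in one integrand, since their separate integrals could be
  infinite with opposite signs.\<close>

definition loc :: "('a \<Rightarrow> real) \<Rightarrow> 'a \<Rightarrow> real" where
  "loc \<tau> x = U x * \<tau> x + 1 / \<beta> * (\<tau> x * ln (\<tau> x))"

lemma loc_measurable[measurable]:
  assumes [measurable]: "\<tau> \<in> borel_measurable borel"
  shows "loc \<tau> \<in> borel_measurable borel"
  unfolding loc_def by measurable

lemma free_energy_eq: "free_energy \<beta> U W \<tau> = ext_integral lborel (loc \<tau>) + ereal (1 / 2 * bil \<tau> \<tau>)"
  unfolding free_energy_def bil_def loc_def[abs_def] ..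

text \<open>Solving the definition of \<open>mf_gibbs\<close> for U trades the possibly unbounded
  potential for a relative entropy integrand plus terms that are integrable. At \<tau> x = 0 both
  sides vanish by the convention on ln 0.\<close>

lemma loc_mf:
  assumes \<rho>: "prob_density \<rho>" and \<tau>: "0 \<le> \<tau> x"
  shows "loc \<tau> x = 1 / \<beta> * (\<tau> x * ln (\<tau> x / mf_gibbs \<rho> x)) - ln (mf_norm \<rho>) / \<beta> * \<tau> x - \<tau> x * convol W \<rho> x"
proof (cases "\<tau> x = 0")
  case False
  with \<tau> have t: "0 < \<tau> x" by simp
  have "ln (mf_gibbs \<rho> x) = - \<beta> * (U x + convol W \<rho> x) - ln (mf_norm \<rho>)"
    unfolding mf_gibbs_def using mf_norm_pos(1)[OF \<rho>] by (simp add: ln_div)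
  then have "ln (\<tau> x / mf_gibbs \<rho> x) = ln (\<tau> x) + \<beta> * (U x + convol W \<rho> x) + ln (mf_norm \<rho>)"
    using t mf_gibbs_pos[OF \<rho>, of x] by (simp add: ln_div)
  then show ?thesis using \<beta>_pos by (simp add: loc_def field_simps)
qed (simp add: loc_def)

lemma xlnx_ge: "0 \<le> a \<Longrightarrow> 0 < s \<Longrightarrow> a - s \<le> a * ln (a / s)" for a s :: real
proof -
  assume a: "0 \<le> a" and s: "0 < s"
  show ?thesis
  proof (cases "a = 0")
    case False
    with a have "a > 0" by simp
    then show ?thesis using young_exp_ineq[OF a, of "ln s"] s by (simp add: ln_div algebra_simps)
  qed (use s in simp)
qed

text \<open>The minorant comes from a ln (a / s) >= a - s with s the mean-field density. It keeps
  the negative part of the local energy integrable, so a free energy is never of the form infinity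
  minus infinity.\<close>

lemma loc_lower:
  fixes \<rho> \<tau> :: "'a \<Rightarrow> real"
  assumes \<rho>: "prob_density \<rho>" and \<tau>: "prob_density \<tau>"
  obtains l where "integrable lborel l" "\<And>x. l x \<le> loc \<tau> x"
proof -
  let ?l = "\<lambda>x. 1 / \<beta> * (\<tau> x - mf_gibbs \<rho> x) - ln (mf_norm \<rho>) / \<beta> * \<tau> x - \<tau> x * convol W \<rho> x"
  have i: "integrable lborel \<tau>" "integrable lborel (mf_gibbs \<rho>)" and nn: "\<And>x. 0 \<le> \<tau> x"
    using \<tau> prob_density_mf_gibbs[OF \<rho>] by (auto simp: prob_density_def)
  have 1: "integrable lborel ?l"
    by (intro Bochner_Integration.integrable_diff integrable_mult_right i integrable_convol[OF \<tau> \<rho>])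
  have 2: "?l x \<le> loc \<tau> x" for x
    unfolding loc_mf[OF \<rho> nn] using xlnx_ge[OF nn[of x] mf_gibbs_pos[OF \<rho>, of x]] \<beta>_pos
    by (intro diff_right_mono mult_left_mono) auto
  show thesis by (rule that[OF 1 2])
qed

lemma integrable_loc:
  assumes \<tau>: "prob_density \<tau>" and fin: "ext_integral lborel (loc \<tau>) < \<infinity>"
  shows "integrable lborel (loc \<tau>)"
proof -
  obtain l where l: "integrable lborel l" "\<And>x. l x \<le> loc \<tau> x" using loc_lower[OF \<tau> \<tau>] by blast
  have [measurable]: "\<tau> \<in> borel_measurable borel" using \<tau> by (auto simp: prob_density_def)
  have "(\<integral>\<^sup>+x. ennreal (- loc \<tau> x) \<partial>lborel) \<le> (\<integral>\<^sup>+x. ennreal (- l x) \<partial>lborel)"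
    using l(2) by (intro nn_integral_mono ennreal_leI) auto
  also have "\<dots> < \<infinity>" using l(1) by (auto simp: real_integrable_def top.not_eq_extremum)
  finally have neg: "(\<integral>\<^sup>+x. ennreal (- loc \<tau> x) \<partial>lborel) < \<infinity>" .
  then obtain b where b: "(\<integral>\<^sup>+x. ennreal (- loc \<tau> x) \<partial>lborel) = ennreal b" "0 \<le> b"
    by (cases "\<integral>\<^sup>+x. ennreal (- loc \<tau> x) \<partial>lborel") auto
  have "(\<integral>\<^sup>+x. ennreal (loc \<tau> x) \<partial>lborel) \<noteq> \<infinity>"
  proof
    assume "(\<integral>\<^sup>+x. ennreal (loc \<tau> x) \<partial>lborel) = \<infinity>"
    then show False using fin b by (simp add: ext_integral_def)
  qed
  with neg show ?thesis by (auto simp: real_integrable_def)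
qed

section \<open>Convexity of the local part and first variation of the free energy\<close>

lemma bil_mix:
  assumes \<rho>: "prob_density \<rho>" and \<sigma>: "prob_density \<sigma>"
  defines "\<tau> t \<equiv> (\<lambda>x. (1 - t) * \<rho> x + t * \<sigma> x)"
  shows "bil (\<tau> t) (\<tau> t) = (1 - t)\<^sup>2 * bil \<rho> \<rho> + 2 * t * (1 - t) * bil \<rho> \<sigma> + t\<^sup>2 * bil \<sigma> \<sigma>"
proof -
  have int: "integrable lborel (\<lambda>y. \<rho>' y * W (x - y))" if "prob_density \<rho>'" for \<rho>' x
    by (rule integrable_density_mult[OF that]) (use W_bound in auto)
  have conv: "convol W (\<tau> t) x = (1 - t) * convol W \<rho> x + t * convol W \<sigma> x" for x
  proof -
    have "convol W (\<tau> t) x = (LINT y|lborel. (1 - t) * (\<rho> y * W (x - y)) + t * (\<sigma> y * W (x - y)))"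
      unfolding convol_def \<tau>_def by (rule Bochner_Integration.integral_cong) (auto simp: algebra_simps)
    then show ?thesis using int[OF \<rho>] int[OF \<sigma>] by (simp add: convol_def mult.commute)
  qed
  have "bil (\<tau> t) (\<tau> t) = (LINT x|lborel. (1 - t)\<^sup>2 * (\<rho> x * convol W \<rho> x) + t * (1 - t) * (\<rho> x * convol W \<sigma> x)
     + t * (1 - t) * (\<sigma> x * convol W \<rho> x) + t\<^sup>2 * (\<sigma> x * convol W \<sigma> x))"
    unfolding bil_def conv unfolding \<tau>_def
    by (rule Bochner_Integration.integral_cong) (auto simp: algebra_simps power2_eq_square)
  also have "\<dots> = (1 - t)\<^sup>2 * bil \<rho> \<rho> + t * (1 - t) * bil \<rho> \<sigma> + t * (1 - t) * bil \<sigma> \<rho> + t\<^sup>2 * bil \<sigma> \<sigma>"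
    using integrable_convol \<rho> \<sigma> by (simp add: bil_def)
  finally show ?thesis using bil_sym[OF \<sigma> \<rho>] by simp
qed

text \<open>The tangent inequality at the mixture \<open>c\<close>, taken at both endpoints and
  averaged. No derivative is formed, so the endpoint value 0, where the slope of x ln x is infinite,
  needs no special treatment.\<close>

lemma xlnx_convex:
  fixes a b t :: real
  assumes "0 \<le> a" "0 \<le> b" "0 < t" "t < 1"
  shows "((1 - t) * a + t * b) * ln ((1 - t) * a + t * b) \<le> (1 - t) * (a * ln a) + t * (b * ln b)"
proof (cases "a = 0 \<and> b = 0")
  case False
  define c where "c = (1 - t) * a + t * b"
  have c: "0 < c"
    unfolding c_def using assms False
    by (cases "a = 0") (auto intro: add_pos_nonneg)
  have "(1 - t) * (a * ln c) \<le> (1 - t) * (a * ln a - a + c)"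
    using young_exp_ineq[OF assms(1), of "ln c"] c assms by (intro mult_left_mono) auto
  moreover have "t * (b * ln c) \<le> t * (b * ln b - b + c)"
    using young_exp_ineq[OF assms(2), of "ln c"] c assms by (intro mult_left_mono) auto
  moreover have "c * ln c = (1 - t) * (a * ln c) + t * (b * ln c)"
    by (simp add: c_def algebra_simps)
  moreover have "(1 - t) * (a * ln a - a + c) + t * (b * ln b - b + c) = (1 - t) * (a * ln a) + t * (b * ln b)"
    by (simp add: c_def algebra_simps)
  ultimately show ?thesis by (simp add: c_def)
qed auto

lemma loc_convex:
  assumes "0 \<le> \<rho> x" "0 \<le> \<sigma> x" "0 < t" "t < 1"
  shows "loc (\<lambda>x. (1 - t) * \<rho> x + t * \<sigma> x) x \<le> (1 - t) * loc \<rho> x + t * loc \<sigma> x"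
proof -
  define m where "m = (1 - t) * \<rho> x + t * \<sigma> x"
  have "m * ln m \<le> (1 - t) * (\<rho> x * ln (\<rho> x)) + t * (\<sigma> x * ln (\<sigma> x))"
    unfolding m_def by (rule xlnx_convex[OF assms])
  then have "1 / \<beta> * (m * ln m) \<le> 1 / \<beta> * ((1 - t) * (\<rho> x * ln (\<rho> x)) + t * (\<sigma> x * ln (\<sigma> x)))"
    using \<beta>_pos by (intro mult_left_mono) auto
  moreover have "U x * m = (1 - t) * (U x * \<rho> x) + t * (U x * \<sigma> x)" by (simp add: m_def algebra_simps)
  ultimately have "U x * m + 1 / \<beta> * (m * ln m) \<le> (1 - t) * loc \<rho> x + t * loc \<sigma> x"
    by (simp add: loc_def algebra_simps diff_divide_distrib add_divide_distrib)
  then show ?thesis by (simp add: loc_def m_def)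
qed

text \<open>Moving from \<open>\<rho>\<close> towards \<open>\<sigma> = mf_gibbs \<rho>\<close> changes the free energy to first order by at most
  \<open>- H(\<rho> | \<sigma>) / \<beta>\<close>, so a minimizer has \<open>H(\<rho> | \<sigma>) = 0\<close>.\<close>

theorem minimizer_eq_mf_gibbs:
  assumes min: "free_energy_minimizer \<beta> U W \<rho>"
  shows "AE x in lborel. \<rho> x = mf_gibbs \<rho> x"
proof -
  let ?I = "integral\<^sup>L lborel :: ('a \<Rightarrow> real) \<Rightarrow> real"
  have \<rho>: "prob_density \<rho>" using min by (simp add: free_energy_minimizer_def)
  have le: "free_energy \<beta> U W \<rho> \<le> free_energy \<beta> U W \<tau>" if "prob_density \<tau>" for \<tau>
    using min that by (simp add: free_energy_minimizer_def)
  define \<sigma> where "\<sigma> = mf_gibbs \<rho>"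
  have \<sigma>: "prob_density \<sigma>" unfolding \<sigma>_def by (rule prob_density_mf_gibbs[OF \<rho>])
  have nn: "0 \<le> \<rho> x" "0 < \<sigma> x" "0 \<le> \<sigma> x" for x
    using \<rho> mf_gibbs_pos[OF \<rho>, of x] by (auto simp: prob_density_def \<sigma>_def)
  have i: "integrable lborel \<rho>" "integrable lborel \<sigma>" "?I \<rho> = 1" "?I \<sigma> = 1"
    and [measurable]: "\<rho> \<in> borel_measurable borel" "\<sigma> \<in> borel_measurable borel"
    using \<rho> \<sigma> by (auto simp: prob_density_def)
  define \<kappa> where "\<kappa> = ln (mf_norm \<rho>) / \<beta>"
  have loc\<sigma>: "loc \<sigma> x = - \<kappa> * \<sigma> x - \<sigma> x * convol W \<rho> x" for x
    using loc_mf[OF \<rho>, of \<sigma> x] nn[of x] by (simp add: \<kappa>_def \<sigma>_def)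
  have int\<sigma>: "integrable lborel (loc \<sigma>)"
    unfolding loc\<sigma>[abs_def] by (intro Bochner_Integration.integrable_diff integrable_mult_right i integrable_convol \<rho> \<sigma>)
  have loc\<sigma>_int: "?I (loc \<sigma>) = - \<kappa> - bil \<rho> \<sigma>"
  proof -
    have "?I (loc \<sigma>) = - \<kappa> - bil \<sigma> \<rho>"
      unfolding loc\<sigma>[abs_def] bil_def
      using i integrable_convol[OF \<sigma> \<rho>] by simp
    then show ?thesis by (simp add: bil_sym[OF \<rho> \<sigma>])
  qed
  \<comment> \<open>The competitor \<open>\<sigma>\<close> has finite free energy, hence so does the
    minimizer; this is where integrability of its local part comes from.\<close>
  have "free_energy \<beta> U W \<rho> < \<infinity>"
    using le[OF \<sigma>] int\<sigma> by (auto simp: free_energy_eq[of \<sigma>] ext_integral_integrable)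
  then have "ext_integral lborel (loc \<rho>) < \<infinity>"
    unfolding free_energy_eq by (cases "ext_integral lborel (loc \<rho>)") auto
  then have int\<rho>: "integrable lborel (loc \<rho>)" by (rule integrable_loc[OF \<rho>])
  define h where "h x = \<rho> x * ln (\<rho> x / \<sigma> x)" for x
  have h_loc: "h x = \<beta> * (loc \<rho> x + \<kappa> * \<rho> x + \<rho> x * convol W \<rho> x)" for x
    using loc_mf[OF \<rho>, of \<rho> x] nn[of x] \<beta>_pos by (simp add: h_def \<kappa>_def \<sigma>_def)
  have int_h: "integrable lborel h"
    unfolding h_loc[abs_def]
    by (intro integrable_mult_right Bochner_Integration.integrable_add int\<rho> i integrable_convol \<rho>)
  have H: "?I h = \<beta> * (?I (loc \<rho>) + \<kappa> + bil \<rho> \<rho>)"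
    unfolding h_loc[abs_def] bil_def using int\<rho> i integrable_convol[OF \<rho> \<rho>] by simp
  \<comment> \<open>Minimality along the segment, with the convex local part replaced by its chord,
    reads t X <= t^2 Y. Here X is H(\<rho> | \<sigma>) / \<beta>, by the formula for
    \<open>loc \<sigma>\<close>, and Y is half the interaction energy of the difference of the two
    densities.\<close>
  define X where "X = ?I (loc \<rho>) + bil \<rho> \<rho> - ?I (loc \<sigma>) - bil \<rho> \<sigma>"
  define Y where "Y = (bil \<rho> \<rho> - 2 * bil \<rho> \<sigma> + bil \<sigma> \<sigma>) / 2"
  have step: "X \<le> t * Y" if t: "0 < t" "t < 1" for t
  proof -
    define \<tau> where "\<tau> x = (1 - t) * \<rho> x + t * \<sigma> x" for x
    have \<tau>: "prob_density \<tau>"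
      unfolding prob_density_def
    proof (intro conjI allI)
      show "\<tau> \<in> borel_measurable borel" unfolding \<tau>_def by measurable
      show "0 \<le> \<tau> x" for x using t nn by (simp add: \<tau>_def)
      show "integrable lborel \<tau>" unfolding \<tau>_def using i by simp
      show "?I \<tau> = 1" unfolding \<tau>_def using i by simp
    qed
    then have [measurable]: "\<tau> \<in> borel_measurable borel" by (simp add: prob_density_def)
    obtain l where l: "integrable lborel l" "\<And>x. l x \<le> loc \<tau> x" using loc_lower[OF \<rho> \<tau>] by blast
    have up: "loc \<tau> x \<le> (1 - t) * loc \<rho> x + t * loc \<sigma> x" for x
      using loc_convex[of \<rho> x \<sigma> t, OF nn(1) nn(3) t] unfolding \<tau>_def[abs_def, symmetric] .
    have iu: "integrable lborel (\<lambda>x. (1 - t) * loc \<rho> x + t * loc \<sigma> x)" using int\<rho> int\<sigma> by simp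
    \<comment> \<open>The local part of the mixture lies between the integrable minorant
      \<open>l\<close> and the integrable chord.\<close>
    have int\<tau>: "integrable lborel (loc \<tau>)"
    proof (rule Bochner_Integration.integrable_bound[OF Bochner_Integration.integrable_add[OF integrable_abs[OF l(1)] integrable_abs[OF iu]]])
      show "AE x in lborel. norm (loc \<tau> x) \<le> norm (\<bar>l x\<bar> + \<bar>(1 - t) * loc \<rho> x + t * loc \<sigma> x\<bar>)"
      proof (rule AE_I2)
        fix x
        show "norm (loc \<tau> x) \<le> norm (\<bar>l x\<bar> + \<bar>(1 - t) * loc \<rho> x + t * loc \<sigma> x\<bar>)"
          using l(2)[of x] up[of x] by simp
      qed
      show "loc \<tau> \<in> borel_measurable lborel" using \<tau> by (simp add: prob_density_def loc_measurable)
    qed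
    have "?I (loc \<tau>) \<le> (1 - t) * ?I (loc \<rho>) + t * ?I (loc \<sigma>)"
      using integral_mono[OF int\<tau> iu up] int\<rho> int\<sigma> by simp
    moreover have "?I (loc \<rho>) + 1 / 2 * bil \<rho> \<rho> \<le> ?I (loc \<tau>) + 1 / 2 * bil \<tau> \<tau>"
      using le[OF \<tau>] by (simp add: free_energy_eq ext_integral_integrable int\<rho> int\<tau>)
    moreover have "bil \<tau> \<tau> = (1 - t)\<^sup>2 * bil \<rho> \<rho> + 2 * t * (1 - t) * bil \<rho> \<sigma> + t\<^sup>2 * bil \<sigma> \<sigma>"
      unfolding \<tau>_def[abs_def] by (rule bil_mix[OF \<rho> \<sigma>])
    ultimately have "t * X \<le> t * (t * Y)"
      by (simp add: X_def Y_def power2_eq_square field_simps)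
    with t show ?thesis by simp
  qed
  have "X \<le> 0"
  proof (rule ccontr)
    assume "\<not> X \<le> 0"
    then have X: "0 < X" by simp
    \<comment> \<open>The second entry forces t Y <= X / 2 < X, contradicting \<open>step\<close>;
      the first keeps t below 1.\<close>
    define t where "t = min (1 / 2) (X / (2 * (\<bar>Y\<bar> + 1)))"
    have t: "0 < t" "t < 1" using X by (auto simp: t_def)
    have "t * Y \<le> t * (\<bar>Y\<bar> + 1)" using t by (intro mult_left_mono) auto
    also have "\<dots> \<le> X / (2 * (\<bar>Y\<bar> + 1)) * (\<bar>Y\<bar> + 1)" by (intro mult_right_mono) (auto simp: t_def)
    also have "\<dots> = X / 2" by (simp add: field_simps)
    finally show False using step[OF t] X by simp
  qed
  then have "?I (loc \<rho>) + \<kappa> + bil \<rho> \<rho> \<le> 0" by (simp add: X_def loc\<sigma>_int)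
  then have H0: "?I h \<le> 0" unfolding H using \<beta>_pos by (simp add: mult_nonneg_nonpos)
  interpret Q: prob_space "dens \<sigma>" using \<sigma> by (rule prob_space_density_prob_density)
  define r where "r x = \<rho> x / \<sigma> x" for x
  have [measurable]: "r \<in> borel_measurable borel" unfolding r_def by measurable
  have r\<sigma>: "\<sigma> x * r x = \<rho> x" for x using nn(2)[of x] by (simp add: r_def)
  have int_dens: "integrable (dens \<sigma>) g \<longleftrightarrow> integrable lborel (\<lambda>x. \<sigma> x * g x)"
    "(\<integral>x. g x \<partial>dens \<sigma>) = (LINT x|lborel. \<sigma> x * g x)" if "g \<in> borel_measurable borel" for g :: "'a \<Rightarrow> real"
    using that nn by (simp_all add: integrable_density integral_density)
  have \<sigma>h: "\<sigma> x * (r x * ln (r x)) = h x" for x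
    using r\<sigma>[of x] by (simp add: h_def r_def mult.assoc[symmetric])
  \<comment> \<open>Pinsker's inequality supplies the equality case: nonpositive entropy forces r =
    1 almost everywhere for \<open>dens \<sigma>\<close>, and hence for Lebesgue measure because
    \<open>\<sigma>\<close> is positive.\<close>
  have "(Q.expectation (\<lambda>x. \<bar>r x - 1\<bar>))\<^sup>2 \<le> 2 * Q.expectation (\<lambda>x. r x * ln (r x))"
  proof (rule Q.pinsker)
    show "integrable (dens \<sigma>) r" using i by (subst int_dens) (simp_all add: r\<sigma>)
    show "Q.expectation r = 1" using i by (subst int_dens) (simp_all add: r\<sigma>)
    show "0 \<le> r x" for x using nn by (simp add: r_def)
    show "integrable (dens \<sigma>) (\<lambda>x. r x * ln (r x))" using int_h by (subst int_dens) (simp_all add: \<sigma>h)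
  qed
  also have "\<dots> \<le> 0" using H0 by (subst int_dens) (simp_all add: \<sigma>h)
  finally have zero: "Q.expectation (\<lambda>x. \<bar>r x - 1\<bar>) = 0" by simp
  have "integrable (dens \<sigma>) (\<lambda>x. \<bar>r x - 1\<bar>)"
    using i by (intro integrable_abs Bochner_Integration.integrable_diff) (auto simp: int_dens r\<sigma>)
  with zero have "AE x in dens \<sigma>. \<bar>r x - 1\<bar> = 0"
    by (subst (asm) integral_nonneg_eq_0_iff_AE) auto
  then have "AE x in lborel. 0 < ennreal (\<sigma> x) \<longrightarrow> \<bar>r x - 1\<bar> = 0"
    by (subst (asm) AE_density) auto
  then have "AE x in lborel. \<rho> x = \<sigma> x"
    by eventually_elim (use nn(2) in \<open>auto simp: r_def field_simps less_imp_neq[symmetric]\<close>)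
  then show ?thesis by (simp add: \<sigma>_def)
qed

end

section \<open>Propagation of chaos for the Gibbs measure\<close>

lemma (in iid) nn_integral_eq_integral_bounded:
  fixes f :: "(nat \<Rightarrow> 'b) \<Rightarrow> real"
  assumes "f \<in> borel_measurable P" "\<And>x. x \<in> space P \<Longrightarrow> 0 \<le> f x" "\<And>x. x \<in> space P \<Longrightarrow> f x \<le> C"
  shows "(\<integral>\<^sup>+x. ennreal (f x) \<partial>P) = ennreal (\<integral>x. f x \<partial>P)"
  using assms by (intro nn_integral_eq_integral Pr.integrable_bounded[where B = C]) auto

lemma (in bounded_density) cexp_restrict: "S \<subseteq> I \<Longrightarrow> cexp S r (restrict x S) = cexp S r x"
  by (rule cexp_cong) auto

text \<open>An event in the \<open>S\<close>-coordinates has the same mass under the densities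
  \<open>r\<close> and \<open>cexp S r\<close>. The latter factors through the restriction, so the
  density of its image can be read off.\<close>

lemma (in bounded_density) distr_restrict_density:
  assumes S: "S \<subseteq> I"
  shows "distr (density P (\<lambda>x. ennreal (r x))) (PiM S (\<lambda>_. M)) (\<lambda>x. restrict x S)
    = density (PiM S (\<lambda>_. M)) (\<lambda>x. ennreal (cexp S r x))"
proof -
  let ?PS = "PiM S (\<lambda>_. M)"
  let ?R = "\<lambda>f. distr (density P (\<lambda>x. ennreal (f x))) ?PS (\<lambda>x. restrict x S)"
  have rm[measurable]: "(\<lambda>x. restrict x S) \<in> measurable P ?PS" by (rule measurable_restrict_subset[OF S])
  have dr: "distr P ?PS (\<lambda>x. restrict x S) = ?PS" using Pr.distr_restrict[OF S fin] by simp
  have [measurable]: "cexp S r \<in> borel_measurable P" by (rule measurable_marg[OF S])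
  have gm: "(\<lambda>x. ennreal (cexp S r x)) \<in> borel_measurable ?PS" using measurable_marg[of S S] by measurable
  have "density ?PS (\<lambda>x. ennreal (cexp S r x)) = ?R (cexp S r)"
    using density_distr[OF gm rm] by (simp add: dr cexp_restrict S)
  moreover have "?R r
     = ?R (cexp S r)"
  proof (rule measure_eqI)
    fix A assume "A \<in> sets (?R r)"
    then have A[measurable]: "A \<in> sets ?PS" by simp
    define g where "g x = (indicator A (restrict x S) :: real)" for x
    have g_meas[measurable]: "g \<in> borel_measurable P" unfolding g_def by measurable
    have g01: "0 \<le> g x" "g x \<le> 1" "\<bar>g x\<bar> \<le> 1" for x by (auto simp: g_def indicator_def)
    have g_mix: "g (mix I S x y) = g x" for x y
    proof -
      have "restrict (mix I S x y) S = restrict x S" using S by (auto simp: mix_def fun_eq_iff)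
      then show ?thesis by (simp add: g_def)
    qed
    have em: "emeasure (?R f) A = ennreal (\<integral>x. g x * f x \<partial>P)"
      if f: "f \<in> borel_measurable P" "\<And>x. x \<in> space P \<Longrightarrow> 0 \<le> f x" "\<And>x. x \<in> space P \<Longrightarrow> f x \<le> C" for f
    proof -
      note f(1)[measurable]
      have "emeasure (?R f) A
         = (\<integral>\<^sup>+x. indicator A (restrict x S) \<partial>density P (\<lambda>x. ennreal (f x)))"
        by (simp add: nn_integral_distr flip: nn_integral_indicator)
      also have "\<dots> = (\<integral>\<^sup>+x. ennreal (f x) * indicator A (restrict x S) \<partial>P)"
        by (rule nn_integral_density) measurable
      also have "\<dots> = (\<integral>\<^sup>+x. ennreal (g x * f x) \<partial>P)"
        by (rule nn_integral_cong) (auto simp: g_def indicator_def)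
      also have "\<dots> = ennreal (\<integral>x. g x * f x \<partial>P)"
      proof (rule nn_integral_eq_integral_bounded)
        show "g x * f x \<le> C" if "x \<in> space P" for x
          using mult_mono[OF g01(2)[of x] f(3)[OF that]] f(2)[OF that] by simp
      qed (use f g01 in \<open>auto intro!: mult_nonneg_nonneg\<close>)
      finally show ?thesis .
    qed
    have "emeasure (?R r) A = ennreal (\<integral>x. g x * r x \<partial>P)"
      by (rule em) (use r_ge r_le c_pos in \<open>auto intro: less_imp_le less_le_trans\<close>)
    also have "(\<integral>x. g x * r x \<partial>P) = (\<integral>x. g x * cexp S r x \<partial>P)"
      by (rule integral_cexp_mult[OF S r_meas r_abs g_meas g01(3) g_mix])
    also have "ennreal \<dots> = emeasure (?R (cexp S r)) A"
      by (rule em[symmetric]) (use marg_bounds[OF S] in \<open>auto intro: less_imp_le\<close>)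
    finally show "emeasure (?R r) A
      = emeasure (?R (cexp S r)) A" .
  qed simp
  ultimately show ?thesis by simp
qed

lemma (in bounded_density) integral_marginal_restrict:
  fixes F :: "real \<Rightarrow> real"
  assumes S: "S \<subseteq> I" and F: "F \<in> borel_measurable borel"
  shows "(\<integral>x. F (cexp S r x) \<partial>PiM S (\<lambda>_. M)) = (\<integral>x. F (cexp S r x) \<partial>P)"
proof -
  have rm[measurable]: "(\<lambda>x. restrict x S) \<in> measurable P (PiM S (\<lambda>_. M))" by (rule measurable_restrict_subset[OF S])
  have dr: "distr P (PiM S (\<lambda>_. M)) (\<lambda>x. restrict x S) = PiM S (\<lambda>_. M)" using Pr.distr_restrict[OF S fin] by simp
  have m: "(\<lambda>x. F (cexp S r x)) \<in> borel_measurable (PiM S (\<lambda>_. M))"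
    by (rule measurable_compose[OF measurable_marg F]) simp
  show ?thesis
    using integral_distr[OF rm m] by (simp add: dr cexp_restrict S)
qed

section \<open>The Gibbs measure as a mean-field density over the minimizer\<close>

context bounded_interaction
begin

text \<open>Minus the completely degenerate part of W (x - y) in its Hoeffding decomposition under
  \<rho>; the sign is that of the Gibbs exponent.\<close>

definition fluct :: "('a \<Rightarrow> real) \<Rightarrow> 'a \<Rightarrow> 'a \<Rightarrow> real" where
  "fluct \<rho> x y = - (W (x - y) - convol W \<rho> x - convol W \<rho> y + (\<integral>x. convol W \<rho> x \<partial>dens \<rho>))"

text \<open>The two constants \<open>4 * L\<close> have different origins: four terms of size L for
  the bound, and for the oscillation in y the two terms W (x - y) and the convolution at y, each
  ranging over an interval of length 2 L.\<close>

lemma mean_field_fluct: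
  assumes \<rho>: "prob_density \<rho>" and N: "0 < N" and s: "0 \<le> s" "s\<^sup>2 * (real N)\<^sup>2 * (4 * L)\<^sup>2 \<le> 1 / 10"
  shows "mean_field (dens \<rho>) N (fluct \<rho>) (4 * L) (4 * L) s"
proof -
  interpret D: prob_space "dens \<rho>" using \<rho> by (rule prob_space_density_prob_density)
  define w where "w = convol W \<rho>"
  define c where "c = (\<integral>x. w x \<partial>dens \<rho>)"
  have [measurable]: "\<rho> \<in> borel_measurable borel" using \<rho> by (auto simp: prob_density_def)
  have w_meas[measurable]: "w \<in> borel_measurable borel" unfolding w_def by measurable
  have wb: "\<bar>w x\<bar> \<le> L" for x unfolding w_def by (rule convol_bound[OF \<rho>])
  have int_w: "integrable (dens \<rho>) w" by (rule D.integrable_bounded[where B = L]) (use wb in auto)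
  have int_W: "integrable (dens \<rho>) (\<lambda>y. W (x - y))" for x
    by (rule D.integrable_bounded[where B = L]) (use W_bound in auto)
  have cb: "\<bar>c\<bar> \<le> L"
  proof -
    have "\<bar>c\<bar> \<le> (\<integral>x. \<bar>w x\<bar> \<partial>dens \<rho>)" unfolding c_def by (rule integral_abs_bound)
    also have "\<dots> \<le> L" by (rule D.integral_le_const') (use int_w wb in auto)
    finally show ?thesis .
  qed
  have f: "fluct \<rho> x y = - W (x - y) + w x + w y - c" for x y by (simp add: fluct_def w_def c_def)
  have sym: "fluct \<rho> x y = fluct \<rho> y x" for x y using W_even[of "x - y"] by (simp add: f)
  have mean: "(\<integral>y. fluct \<rho> x y \<partial>dens \<rho>) = 0" for x
  proof -
    have "(\<integral>y. fluct \<rho> x y \<partial>dens \<rho>) = - (\<integral>y. W (x - y) \<partial>dens \<rho>) + w x + c - c"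
      unfolding f c_def using int_w int_W D.prob_space by simp
    then show ?thesis by (simp add: w_def convol_dens[OF \<rho>])
  qed
  show ?thesis
  proof
    show "case_prod (fluct \<rho>) \<in> borel_measurable (dens \<rho> \<Otimes>\<^sub>M dens \<rho>)"
      unfolding case_prod_beta' f by measurable
    show "\<bar>fluct \<rho> x y\<bar> \<le> 4 * L" for x y
      unfolding f using W_bound[of "x - y"] wb[of x] wb[of y] cb by linarith
    show "\<exists>c. \<forall>y. fluct \<rho> x y \<in> {c..c + 4 * L}" for x
    proof (intro exI allI)
      fix y
      show "fluct \<rho> x y \<in> {w x - c - 2 * L..w x - c - 2 * L + 4 * L}"
        unfolding f using W_bound[of "x - y"] wb[of y] by auto
    qed
    show "(\<integral>x. fluct \<rho> x y \<partial>dens \<rho>) = 0" for y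
      using mean[of y] by (simp add: sym[of _ y])
  qed (use sym mean N s in auto)
qed

lemma dens_mf_gibbs:
  assumes "free_energy_minimizer \<beta> U W \<rho>"
  shows "dens \<rho> = dens (mf_gibbs \<rho>)"
proof -
  have \<rho>: "prob_density \<rho>" using assms by (simp add: free_energy_minimizer_def)
  have [measurable]: "\<rho> \<in> borel_measurable borel" "mf_gibbs \<rho> \<in> borel_measurable borel"
    using \<rho> prob_density_mf_gibbs[OF \<rho>] by (auto simp: prob_density_def)
  show ?thesis
    by (rule density_cong) (use minimizer_eq_mf_gibbs[OF assms] in auto)
qed

text \<open>Summed over ordered pairs, the linear terms of the Hoeffding decomposition occur 2 (N -
  1) times per particle, and the prefactor of the energy makes this exactly \<beta> times the mean
  field. They complete the tensor power of \<open>mf_gibbs \<rho>\<close>; the constants go into K.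
  No minimality is involved yet.\<close>

lemma energy_fluct:
  fixes N :: nat
  assumes \<rho>: "prob_density \<rho>" and N: "2 \<le> N"
  defines "s \<equiv> \<beta> / (2 * (real N - 1))"
  shows "\<exists>K>0. \<forall>x. exp (- \<beta> * energy U W N x)
    = K * (tensor_pow N (mf_gibbs \<rho>) x * exp (s * (\<Sum>i<N. \<Sum>j\<in>{..<N} - {i}. fluct \<rho> (x i) (x j))))"
proof -
  define c where "c = (\<integral>x. convol W \<rho> x \<partial>dens \<rho>)"
  define w where "w = convol W \<rho>"
  define K where "K = mf_norm \<rho> ^ N * exp (s * (N * ((real N - 1) * c)))"
  have "0 < K" using mf_norm_pos(1)[OF \<rho>] by (simp add: K_def)
  moreover have "exp (- \<beta> * energy U W N x)
    = K * (tensor_pow N (mf_gibbs \<rho>) x * exp (s * (\<Sum>i<N. \<Sum>j\<in>{..<N} - {i}. fluct \<rho> (x i) (x j))))" for x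
  proof -
    define SW where "SW = (\<Sum>i<N. \<Sum>j\<in>{..<N} - {i}. W (x i - x j))"
    define Sw where "Sw = (\<Sum>i<N. w (x i))"
    define SU where "SU = (\<Sum>i<N. U (x i))"
    have card: "real (card ({..<N} - {i})) = real N - 1" if "i < N" for i using that N by simp
    have row: "(\<Sum>j\<in>{..<N} - {i}. w (x j)) = Sw - w (x i)" if "i < N" for i
      using that by (simp add: Sw_def sum_diff1)
    have "(\<Sum>i<N. \<Sum>j\<in>{..<N} - {i}. fluct \<rho> (x i) (x j))
       = (\<Sum>i<N. - (\<Sum>j\<in>{..<N} - {i}. W (x i - x j)) + (real N - 1) * w (x i) + (Sw - w (x i)) - (real N - 1) * c)"
    proof (rule sum.cong)
      fix i assume "i \<in> {..<N}"
      then have i: "i < N" by simp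
      have "(\<Sum>j\<in>{..<N} - {i}. fluct \<rho> (x i) (x j))
        = (\<Sum>j\<in>{..<N} - {i}. - W (x i - x j) + w (x i) + w (x j) - c)"
        by (rule sum.cong) (simp_all add: fluct_def w_def c_def)
      also have "\<dots> = - (\<Sum>j\<in>{..<N} - {i}. W (x i - x j)) + real (card ({..<N} - {i})) * w (x i)
         + (\<Sum>j\<in>{..<N} - {i}. w (x j)) - real (card ({..<N} - {i})) * c"
        by (simp only: sum.distrib sum_subtractf sum_negf sum_constant)
      finally show "(\<Sum>j\<in>{..<N} - {i}. fluct \<rho> (x i) (x j))
        = - (\<Sum>j\<in>{..<N} - {i}. W (x i - x j)) + (real N - 1) * w (x i) + (Sw - w (x i)) - (real N - 1) * c"
        unfolding row[OF i] card[OF i] .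
    qed simp
    also have "\<dots> = - SW + (real N - 1) * Sw + (N * Sw - Sw) - N * ((real N - 1) * c)"
      by (simp add: sum.distrib sum_subtractf sum_negf SW_def Sw_def flip: sum_distrib_left)
    finally have S: "(\<Sum>i<N. \<Sum>j\<in>{..<N} - {i}. fluct \<rho> (x i) (x j))
      = - SW + 2 * (real N - 1) * Sw - N * ((real N - 1) * c)" by (simp add: algebra_simps)
    have N1: "real N - 1 > 0" using N by simp
    have sN: "s * (2 * (real N - 1)) = \<beta>" using N1 by (simp add: s_def)
    have "s * (- SW + 2 * (real N - 1) * Sw - N * ((real N - 1) * c))
       = - s * SW + (s * (2 * (real N - 1))) * Sw - s * (N * ((real N - 1) * c))"
      by algebra
    then have sS: "s * (\<Sum>i<N. \<Sum>j\<in>{..<N} - {i}. fluct \<rho> (x i) (x j)) = - s * SW + \<beta> * Sw - s * (N * ((real N - 1) * c))"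
      unfolding S sN .
    have t: "tensor_pow N (mf_gibbs \<rho>) x = exp (- \<beta> * (SU + Sw)) / mf_norm \<rho> ^ N"
    proof -
      have "- \<beta> * (SU + Sw) = (\<Sum>i<N. - \<beta> * (U (x i) + convol W \<rho> (x i)))"
        unfolding sum_distrib_left[symmetric] SU_def Sw_def w_def sum.distrib ..
      then have "exp (- \<beta> * (SU + Sw)) = (\<Prod>i<N. exp (- \<beta> * (U (x i) + convol W \<rho> (x i))))"
        by (simp only: exp_sum finite_lessThan)
      then show ?thesis
        unfolding tensor_pow_def mf_gibbs_def prod_dividef prod_constant card_lessThan by simp
    qed
    have "\<beta> * energy U W N x = \<beta> * SU + s * SW"
      unfolding energy_def SU_def SW_def s_def by (simp add: algebra_simps)
    then have "exp (- \<beta> * energy U W N x) = exp (s * (N * ((real N - 1) * c)) + (- \<beta> * (SU + Sw))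
         + (- s * SW + \<beta> * Sw - s * (N * ((real N - 1) * c))))"
      by (simp add: algebra_simps)
    also have "\<dots> = K * (tensor_pow N (mf_gibbs \<rho>) x * exp (s * (\<Sum>i<N. \<Sum>j\<in>{..<N} - {i}. fluct \<rho> (x i) (x j))))"
      unfolding sS t K_def exp_add using mf_norm_pos(1)[OF \<rho>] by simp
    finally show ?thesis .
  qed
  ultimately show ?thesis by blast
qed

text \<open>The Euler-Lagrange equation enters here, replacing \<open>mf_gibbs \<rho>\<close> by
  \<rho> as reference measure; K cancels against the partition function. The claim is about
  measures, since the equation holds only almost everywhere.\<close>

lemma gibbs_mean_field:
  fixes N :: nat
  assumes min: "free_energy_minimizer \<beta> U W \<rho>" and N: "2 \<le> N"
    and small: "(\<beta> / (2 * (real N - 1)))\<^sup>2 * (real N)\<^sup>2 * (4 * L)\<^sup>2 \<le> 1 / 10"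
  shows "measure_of_density N (gibbs \<beta> U W N) = density (PiM {..<N} (\<lambda>_. dens \<rho>))
      (\<lambda>x. ennreal (mean_field.r (dens \<rho>) N (fluct \<rho>) (\<beta> / (2 * (real N - 1))) x))"
proof -
  have \<rho>: "prob_density \<rho>" using min by (simp add: free_energy_minimizer_def)
  define s where "s = \<beta> / (2 * (real N - 1))"
  interpret mean_field "dens \<rho>" N "fluct \<rho>" "4 * L" "4 * L" s
    by (rule mean_field_fluct[OF \<rho>]) (use N small \<beta>_pos in \<open>auto simp: s_def\<close>)
  define \<sigma> where "\<sigma> = mf_gibbs \<rho>"
  have \<sigma>: "prob_density \<sigma>" unfolding \<sigma>_def by (rule prob_density_mf_gibbs[OF \<rho>])
  have P_eq: "P = measure_of_density N (tensor_pow N \<sigma>)"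
    unfolding dens_mf_gibbs[OF min] \<sigma>_def[symmetric] by (rule PiM_density_tensor_pow[OF \<sigma>])
  have [measurable]: "tensor_pow N \<sigma> \<in> borel_measurable (lborel_pow N)"
    using \<sigma> by (intro measurable_tensor_pow) (auto simp: prob_density_def)
  have tnn: "0 \<le> tensor_pow N \<sigma> x" for x
    using \<sigma> by (auto simp: tensor_pow_def prob_density_def intro: prod_nonneg)
  have sets_P: "sets P = sets (lborel_pow N)" by (simp add: P_eq measure_of_density_def)
  have G_meas: "G {..<N} \<in> borel_measurable (lborel_pow N)"
    using G_measurable[of "{..<N}"] by (simp add: measurable_cong_sets[OF sets_P refl])
  have r_meas': "r \<in> borel_measurable (lborel_pow N)"
    using r_meas by (simp add: measurable_cong_sets[OF sets_P refl])
  from energy_fluct[OF \<rho> N, folded s_def \<sigma>_def]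
  obtain K where K0: "0 < K" and K1: "\<forall>x. exp (- \<beta> * energy U W N x)
      = K * (tensor_pow N \<sigma> x * exp (s * (\<Sum>i<N. \<Sum>j\<in>{..<N} - {i}. fluct \<rho> (x i) (x j))))"
    by (elim exE conjE)
  have K: "0 < K" "exp (- \<beta> * energy U W N x) = K * (tensor_pow N \<sigma> x * exp (G {..<N} x))" for x
    unfolding G_def by (rule K0) (rule K1[rule_format])
  have "partition_fn \<beta> U W N = K * (LINT x|lborel_pow N. tensor_pow N \<sigma> x * exp (G {..<N} x))"
    unfolding partition_fn_def K(2) by simp
  also have "(LINT x|lborel_pow N. tensor_pow N \<sigma> x * exp (G {..<N} x)) = Z"
    unfolding Z_def P_eq measure_of_density_def
    using tnn G_meas by (subst integral_density) auto
  finally have pf: "partition_fn \<beta> U W N = K * Z" .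
  have gibbs: "gibbs \<beta> U W N x = tensor_pow N \<sigma> x * r x" for x
    unfolding gibbs_def pf K(2) r_def using K(1) Z_ge_1 by simp
  have "measure_of_density N (gibbs \<beta> U W N) = density (lborel_pow N) (\<lambda>x. ennreal (tensor_pow N \<sigma> x) * ennreal (r x))"
    unfolding measure_of_density_def gibbs using tnn by (simp add: ennreal_mult')
  also have "\<dots> = density P (\<lambda>x. ennreal (r x))"
    unfolding P_eq measure_of_density_def using r_meas' by (subst density_density_eq) auto
  finally show ?thesis by (simp add: s_def)
qed

text \<open>\<open>f\<close> stands for the Gibbs density of the original kernel, which agrees with
  that of the pointwise bounded kernel as a measure but not as a function, while
  \<open>marginal\<close> acts on functions.\<close>

lemma entropy_chain:
  fixes N k :: nat
  assumes min: "free_energy_minimizer \<beta> U W \<rho>" and N: "2 \<le> N" "k \<le> N"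
    and small: "(\<beta> / (2 * (real N - 1)))\<^sup>2 * (real N)\<^sup>2 * (4 * L)\<^sup>2 \<le> 1 / 10"
    and f: "integrable (lborel_pow N) f" "\<And>x. 0 \<le> f x"
    and f_gibbs: "measure_of_density N f = measure_of_density N (gibbs \<beta> U W N)"
  shows "\<exists>(h::real) (H::real). rel_entropy (measure_of_density k (marginal N k f)) (measure_of_density k (tensor_pow k \<rho>)) = ereal h
    \<and> rel_entropy (measure_of_density N f) (measure_of_density N (tensor_pow N \<rho>)) = ereal H
    \<and> tv_dist k (marginal N k f) (tensor_pow k \<rho>) \<le> ereal (sqrt (2 * h)) \<and> N * h \<le> k * H \<and> H \<le> 3"
proof -
  have \<rho>: "prob_density \<rho>" using min by (simp add: free_energy_minimizer_def)
  define s where "s = \<beta> / (2 * (real N - 1))"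
  interpret mean_field "dens \<rho>" N "fluct \<rho>" "4 * L" "4 * L" s
    by (rule mean_field_fluct[OF \<rho>]) (use N small \<beta>_pos in \<open>auto simp: s_def\<close>)
  have S: "{..<k} \<subseteq> {..<N}" using N by auto
  let ?Q = "PiM {..<k} (\<lambda>_. dens \<rho>)"
  have Pk: "?Q = measure_of_density k (tensor_pow k \<rho>)"
    and PN: "P = measure_of_density N (tensor_pow N \<rho>)"
    by (rule PiM_density_tensor_pow[OF \<rho>])+
  interpret Qk: prob_space "?Q" by (rule prob_space_PiM) (rule M.prob_space_axioms)
  have fN: "measure_of_density N f = density P (\<lambda>x. ennreal (r x))"
    unfolding f_gibbs using gibbs_mean_field[OF min N(1) small] by (simp add: s_def)
  have sets_k: "sets ?Q = sets (lborel_pow k)" by (simp add: Pk measure_of_density_def)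
  define g where "g = cexp {..<k} r"
  have fk: "measure_of_density k (marginal N k f) = density ?Q (\<lambda>x. ennreal (g x))"
  proof -
    have "measure_of_density k (marginal N k f) = distr (measure_of_density N f) (lborel_pow k) (\<lambda>x. restrict x {..<k})"
      by (rule measure_of_density_marginal(1)[OF N(2) f])
    also have "\<dots> = distr (measure_of_density N f) ?Q (\<lambda>x. restrict x {..<k})"
      by (rule distr_cong) (simp_all add: sets_k)
    finally show ?thesis unfolding fN g_def by (simp add: distr_restrict_density[OF S])
  qed
  have g_meas[measurable]: "g \<in> borel_measurable ?Q"
    unfolding g_def by (rule measurable_marg) simp
  note gb = marg_bounds[where S = "{..<k}" and J = "{..<k}", folded g_def, OF order_refl]
  have g1: "(\<integral>x. g x \<partial>?Q) = 1"
    using integral_marginal_restrict[OF S, of "\<lambda>x. x"] integral_marg[OF S] by (simp add: g_def)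
  have gent: "(\<integral>x. g x * ln (g x) \<partial>?Q) = ent {..<k}"
    using integral_marginal_restrict[OF S, of "\<lambda>x. x * ln x"] by (simp add: g_def ent_def)
  have Hk: "rel_entropy (measure_of_density k (marginal N k f)) (measure_of_density k (tensor_pow k \<rho>)) = ereal (ent {..<k})"
    unfolding fk Pk[symmetric] gent[symmetric]
    by (rule rel_entropy_density[OF Qk.prob_space_axioms g_meas gb(1) gb(2) c_pos g1])
  have HN: "rel_entropy (measure_of_density N f) (measure_of_density N (tensor_pow N \<rho>)) = ereal (ent {..<N})"
    unfolding fN PN[symmetric] ent_full
    by (rule rel_entropy_density[OF _ r_meas r_ge r_le c_pos r_int]) (rule prob_space_PiM, rule M.prob_space_axioms)
  have int_g: "integrable ?Q g" by (rule Qk.integrable_bounded[OF g_meas gb(5)])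
  have tv: "tv_dist k (marginal N k f) (tensor_pow k \<rho>) = ereal (\<integral>x. \<bar>g x - 1\<bar> \<partial>?Q)"
    unfolding Pk
  proof (rule tv_dist_density[OF \<rho>])
    show "marginal N k f \<in> borel_measurable (lborel_pow k)" by (rule measure_of_density_marginal(2)[OF N(2) f])
    show "0 \<le> marginal N k f x" for x unfolding marginal_def by (rule Bochner_Integration.integral_nonneg) (rule f(2))
    show "g \<in> borel_measurable (lborel_pow k)" using g_meas by (simp add: measurable_cong_sets[OF sets_k refl])
    show "0 \<le> g x" if "x \<in> space (lborel_pow k)" for x
      using gb(3)[of x] that sets_eq_imp_space_eq[OF sets_k] by simp
  qed (use fk int_g in \<open>simp_all add: Pk\<close>)
  \<comment> \<open>\<open>pinsker\<close> asks for nonnegativity at every argument, whereas the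
    bounds on \<open>g\<close> hold on the space of the product measure; truncation changes nothing
    there.\<close>
  define g' where "g' x = max (g x) 0" for x
  have gg: "g' x = g x" if "x \<in> space ?Q" for x
    using gb(3)[OF that] by (simp add: g'_def)
  have "(\<integral>x. \<bar>g' x - 1\<bar> \<partial>?Q)\<^sup>2 \<le> 2 * (\<integral>x. g' x * ln (g' x) \<partial>?Q)"
  proof (rule Qk.pinsker)
    show "integrable ?Q g'"
      using int_g by (subst Bochner_Integration.integrable_cong[OF refl gg]) auto
    show "Qk.expectation g' = 1" using g1 by (subst Bochner_Integration.integral_cong[OF refl gg]) auto
    have "integrable ?Q (\<lambda>x. g x * ln (g x))"
    proof (rule Qk.integrable_bounded)
      show "\<bar>g x * ln (g x)\<bar> \<le> (exp (s * (N * (N * (4 * L)))) / Z)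
         * (\<bar>ln (exp (- (s * (N * (N * (4 * L))))) / Z)\<bar> + \<bar>ln (exp (s * (N * (N * (4 * L)))) / Z)\<bar>)"
        if "x \<in> space ?Q" for x
        unfolding abs_mult using gb(4,5)[OF that] by (intro mult_mono') auto
    qed measurable
    then show "integrable ?Q (\<lambda>x. g' x * ln (g' x))"
      by (rule Bochner_Integration.integrable_cong[THEN iffD1, rotated 2]) (simp_all add: gg)
  qed (simp add: g'_def)
  also have "(\<integral>x. g' x * ln (g' x) \<partial>?Q) = ent {..<k}"
    unfolding gent[symmetric] by (rule Bochner_Integration.integral_cong) (simp_all add: gg)
  also have "(\<integral>x. \<bar>g' x - 1\<bar> \<partial>?Q) = (\<integral>x. \<bar>g x - 1\<bar> \<partial>?Q)"
    by (rule Bochner_Integration.integral_cong) (simp_all add: gg)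
  finally have "(\<integral>x. \<bar>g x - 1\<bar> \<partial>?Q) \<le> sqrt (2 * ent {..<k})"
    by (rule real_le_rsqrt)
  then show ?thesis
    using Hk HN tv ent_marginal[OF N(2)] ent_le_3 by auto
qed

lemma wasserstein_one_marginal:
  fixes N :: nat
  assumes min: "free_energy_minimizer \<beta> U W \<rho>" and N: "2 \<le> N"
    and small: "(\<beta> / (2 * (real N - 1)))\<^sup>2 * (real N)\<^sup>2 * (4 * L)\<^sup>2 \<le> 1 / 10"
    and f: "integrable (lborel_pow N) f" "\<And>x. 0 \<le> f x"
    and f_gibbs: "measure_of_density N f = measure_of_density N (gibbs \<beta> U W N)"
  shows "wasserstein1 (distr (measure_of_density 1 (marginal N 1 f)) borel (\<lambda>x. x 0)) (dens \<rho>)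
    \<le> ennreal (12 * exp (8 * \<beta> * L) / sqrt N) * (\<integral>\<^sup>+x. ennreal (norm x) \<partial>dens \<rho>)"
proof -
  have \<rho>: "prob_density \<rho>" using min by (simp add: free_energy_minimizer_def)
  define s where "s = \<beta> / (2 * (real N - 1))"
  interpret mean_field "dens \<rho>" N "fluct \<rho>" "4 * L" "4 * L" s
    by (rule mean_field_fluct[OF \<rho>]) (use N small \<beta>_pos in \<open>auto simp: s_def\<close>)
  interpret J: iid "dens \<rho>" "{..<1}" by unfold_locales simp
  have S: "{..<1} \<subseteq> {..<N}" using N by auto
  let ?P1 = "PiM {..<1::nat} (\<lambda>_. dens \<rho>)"
  have P1: "?P1 = measure_of_density 1 (tensor_pow 1 \<rho>)" by (rule PiM_density_tensor_pow[OF \<rho>])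
  have sets_1: "sets ?P1 = sets (lborel_pow 1)"
    unfolding P1 measure_of_density_def by simp
  define g where "g = cexp {..<1} r"
  have g_meas: "g \<in> borel_measurable ?P1" unfolding g_def by (rule measurable_marg) simp
  \<comment> \<open>A one-particle configuration is a function on the index set {0};
    \<open>h\<close> reads the marginal density as a function on the Euclidean space itself.\<close>
  define h where "h v = g (\<lambda>i\<in>{..<1}. v)" for v
  have cst: "(\<lambda>v. \<lambda>i\<in>{..<1::nat}. v) \<in> measurable (dens \<rho>) ?P1" by (rule measurable_restrict) simp
  have h_meas: "h \<in> borel_measurable (dens \<rho>)" unfolding h_def by (rule measurable_compose[OF cst g_meas])
  then have h_borel: "h \<in> borel_measurable borel" by simp
  have gh: "g x = h (x 0)" if "x \<in> space ?P1" for x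
  proof -
    have "x = (\<lambda>i\<in>{..<1}. x 0)" using that by (auto simp: space_PiM PiE_iff extensional_def fun_eq_iff)
    then show ?thesis unfolding h_def by simp
  qed
  have sp: "(\<lambda>i\<in>{..<1::nat}. v) \<in> space ?P1" for v using measurable_space[OF cst, of v] by simp
  have c0: "(\<lambda>x. x 0) \<in> measurable ?P1 (dens \<rho>)" by (rule measurable_component_singleton) simp
  have f1: "measure_of_density 1 (marginal N 1 f) = density ?P1 (\<lambda>x. ennreal (h (x 0)))"
  proof -
    have fN: "measure_of_density N f = density P (\<lambda>x. ennreal (r x))"
      unfolding f_gibbs using gibbs_mean_field[OF min N(1) small] by (simp add: s_def)
    have "measure_of_density 1 (marginal N 1 f) = distr (measure_of_density N f) (lborel_pow 1) (\<lambda>x. restrict x {..<1})"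
      by (rule measure_of_density_marginal(1)[OF _ f]) (use N in simp)
    also have "\<dots> = distr (measure_of_density N f) ?P1 (\<lambda>x. restrict x {..<1})"
      by (rule distr_cong[OF refl sets_1[symmetric] refl])
    also have "\<dots> = density ?P1 (\<lambda>x. ennreal (g x))"
      unfolding fN g_def by (rule distr_restrict_density[OF S])
    also have "\<dots> = density ?P1 (\<lambda>x. ennreal (h (x 0)))"
    proof (rule density_cong)
      show "(\<lambda>x. ennreal (h (x 0))) \<in> borel_measurable ?P1"
        using measurable_compose[OF c0 h_meas] by simp
      show "(\<lambda>x. ennreal (g x)) \<in> borel_measurable ?P1" using g_meas by simp
    qed (rule AE_I2, simp only: gh)
    finally show ?thesis .
  qed
  have "distr (measure_of_density 1 (marginal N 1 f)) borel (\<lambda>x. x 0)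
     = distr (density ?P1 (\<lambda>x. ennreal (h (x 0)))) (dens \<rho>) (\<lambda>x. x 0)"
    unfolding f1 by (rule distr_cong) simp_all
  also have "\<dots> = density (distr ?P1 (dens \<rho>) (\<lambda>x. x 0)) (\<lambda>v. ennreal (h v))"
    using h_meas by (intro density_distr[OF _ c0, symmetric]) simp
  also have "distr ?P1 (dens \<rho>) (\<lambda>x. x 0) = dens \<rho>"
    using distr_PiM_component[of "{..<1::nat}" "\<lambda>_. dens \<rho>" 0] M.prob_space_axioms by simp
  finally have D: "distr (measure_of_density 1 (marginal N 1 f)) borel (\<lambda>x. x 0) = density (dens \<rho>) (\<lambda>v. ennreal (h v))" .
  \<comment> \<open>Since N <= 2 (N - 1) for N >= 2, the exponent in
    \<open>one_marginal_bound\<close> is at most 8 \<beta> L, which removes N from the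
    constant.\<close>
  have "s * N \<le> \<beta>"
  proof -
    have "real N \<le> 2 * (real N - 1)" using N by simp
    then have "\<beta> * N \<le> \<beta> * (2 * (real N - 1))" using \<beta>_pos by (intro mult_left_mono) auto
    then show ?thesis using N by (simp add: s_def divide_le_eq)
  qed
  then have "s * N * (8 * L) \<le> \<beta> * (8 * L)" using L_nonneg by (intro mult_right_mono) auto
  then have expD: "exp (2 * s * (N * (4 * L))) \<le> exp (8 * \<beta> * L)" by (simp add: mult_ac)
  have hb: "\<bar>h v - 1\<bar> \<le> 12 * exp (8 * \<beta> * L) / sqrt N" for v
  proof -
    have "\<bar>h v - 1\<bar> \<le> 12 * exp (2 * s * (N * (4 * L))) / sqrt N"
      unfolding h_def g_def by (rule one_marginal_bound[OF sp])
    also have "\<dots> \<le> 12 * exp (8 * \<beta> * L) / sqrt N"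
      using expD by (intro divide_right_mono mult_left_mono) auto
    finally show ?thesis .
  qed
  have h0: "0 \<le> h v" for v
    unfolding h_def g_def using marg_bounds(3)[OF order_refl sp, of v] by simp
  have h1: "(\<integral>v. h v \<partial>dens \<rho>) = 1"
  proof -
    have "(\<integral>v. h v \<partial>dens \<rho>) = (\<integral>x. h (x 0) \<partial>?P1)"
      using J.integral_component[of 0 h] h_meas by simp
    also have "\<dots> = (\<integral>x. g x \<partial>?P1)" by (rule Bochner_Integration.integral_cong) (simp_all add: gh)
    also have "\<dots> = 1"
      using integral_marginal_restrict[OF S, of "\<lambda>x. x"] integral_marg[OF S] by (simp add: g_def)
    finally show ?thesis .
  qed
  show ?thesis
    unfolding D by (rule wasserstein1_density_le[OF M.prob_space_axioms _ h_borel h0 hb h1]) simp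
qed

end

section \<open>Reduction to a bounded interaction\<close>

lemma pred_eq_borel:
  fixes f g :: "'a::topological_space \<Rightarrow> real"
  assumes [measurable]: "f \<in> borel_measurable borel" "g \<in> borel_measurable borel"
  shows "Measurable.pred borel (\<lambda>x. f x = g x)"
  by measurable

lemma energy_cong_AE:
  fixes W W' :: "'a::euclidean_space \<Rightarrow> real"
  assumes meas: "W \<in> borel_measurable borel" "W' \<in> borel_measurable borel" and AE: "AE x in lborel. W x = W' x"
  shows "AE x in lborel_pow N. energy U W N x = energy U W' N x"
proof -
  have "AE x in lborel_pow N. \<forall>i\<in>{..<N}. \<forall>j\<in>{..<N} - {i}. W (x i - x j) = W' (x i - x j)"
  proof (intro AE_finite_allI)
    fix i j assume "i \<in> {..<N}" "j \<in> {..<N} - {i}"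
    then show "AE x in lborel_pow N. W (x i - x j) = W' (x i - x j)"
      by (intro AE_lborel_pow_diff[OF pred_eq_borel[OF meas] AE]) auto
  qed auto
  then show ?thesis by eventually_elim (simp add: energy_def)
qed

lemma energy_measurable:
  assumes "U \<in> borel_measurable borel" "W \<in> borel_measurable borel"
  shows "energy U W N \<in> borel_measurable (lborel_pow N)"
  unfolding energy_def
  by (intro borel_measurable_add borel_measurable_times borel_measurable_const borel_measurable_sum
      measurable_compose[OF measurable_lborel_component assms(1)]
      measurable_compose[OF borel_measurable_diff[OF measurable_lborel_component measurable_lborel_component] assms(2)]) auto

lemma gibbs_cong_AE:
  fixes W W' :: "'a::euclidean_space \<Rightarrow> real"
  assumes U: "U \<in> borel_measurable borel" and meas: "W \<in> borel_measurable borel" "W' \<in> borel_measurable borel"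
    and AE: "AE x in lborel. W x = W' x"
  shows "measure_of_density N (gibbs \<beta> U W N) = measure_of_density N (gibbs \<beta> U W' N)"
proof -
  note [measurable] = energy_measurable[OF U meas(1)] energy_measurable[OF U meas(2)]
  have E: "AE x in lborel_pow N. energy U W N x = energy U W' N x" by (rule energy_cong_AE[OF meas AE])
  have "partition_fn \<beta> U W N = partition_fn \<beta> U W' N"
    unfolding partition_fn_def by (rule integral_cong_AE) (use E in auto)
  then show ?thesis
    unfolding measure_of_density_def gibbs_def
    by (intro density_cong) (use E in auto)
qed

lemma convol_cong_AE:
  fixes W W' :: "'a::euclidean_space \<Rightarrow> real"
  assumes meas: "W \<in> borel_measurable borel" "W' \<in> borel_measurable borel" and AE: "AE x in lborel. W x = W' x"
    and \<rho>[measurable]: "\<rho> \<in> borel_measurable borel"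
  shows "convol W \<rho> = convol W' \<rho>"
proof
  fix x
  note [measurable] = meas
  have "AE y in lborel. W (x + (- 1) *\<^sub>R y) = W' (x + (- 1) *\<^sub>R y)"
    by (rule AE_lborel_affine[OF _ pred_eq_borel[OF meas] AE]) simp
  then show "convol W \<rho> x = convol W' \<rho> x"
    unfolding convol_def by (intro integral_cong_AE) auto
qed

lemma free_energy_minimizer_cong_AE:
  fixes W W' :: "'a::euclidean_space \<Rightarrow> real"
  assumes meas: "W \<in> borel_measurable borel" "W' \<in> borel_measurable borel" and AE: "AE x in lborel. W x = W' x"
    and min: "free_energy_minimizer \<beta> U W \<rho>"
  shows "free_energy_minimizer \<beta> U W' \<rho>"
proof -
  have "free_energy \<beta> U W \<tau> = free_energy \<beta> U W' \<tau>" if "prob_density \<tau>" for \<tau> :: "'a \<Rightarrow> real"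
    unfolding free_energy_def using convol_cong_AE[OF meas AE, of \<tau>] that by (simp add: prob_density_def)
  with min show ?thesis unfolding free_energy_minimizer_def by metis
qed

text \<open>Two particles suffice: a bounded interaction changes the two-body energy by at most L,
  so the square of the one-body integral is finite.\<close>

lemma confining_potential:
  fixes U W :: "'a::euclidean_space \<Rightarrow> real"
  assumes \<beta>: "0 < \<beta>" and U[measurable]: "U \<in> borel_measurable borel" and W[measurable]: "W \<in> borel_measurable borel"
    and Wb: "\<And>x. \<bar>W x\<bar> \<le> L" and int: "integrable (lborel_pow 2) (\<lambda>x. exp (- \<beta> * energy U W 2 x))"
  shows "integrable lborel (\<lambda>x. exp (- \<beta> * U x))"
proof -
  interpret PS: product_sigma_finite "\<lambda>_::nat. lborel :: 'a measure" by (rule product_sigma_finite_lborel)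
  let ?I = "\<integral>\<^sup>+u. ennreal (exp (- \<beta> * U u)) \<partial>lborel"
  have set2: "{..<2::nat} = {0, 1}" by auto
  have "?I * ?I = (\<Prod>i<2::nat. ?I)" by (simp add: set2)
  also have "\<dots> = (\<integral>\<^sup>+x. (\<Prod>i<2. ennreal (exp (- \<beta> * U (x i)))) \<partial>lborel_pow 2)"
    by (rule PS.product_nn_integral_prod[symmetric]) auto
  also have "\<dots> \<le> (\<integral>\<^sup>+x. ennreal (exp (\<beta> * L)) * ennreal (exp (- \<beta> * energy U W 2 x)) \<partial>lborel_pow 2)"
  proof (rule nn_integral_mono)
    fix x :: "nat \<Rightarrow> 'a"
    have d: "{0, Suc 0} - {0} = {Suc 0}" "{0, Suc 0} - {Suc 0} = {0}" by auto
    have e: "energy U W 2 x = U (x 0) + U (x 1) + (W (x 0 - x 1) + W (x 1 - x 0)) / 2"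
      by (simp add: energy_def set2 d)
    have "W (x 0 - x 1) + W (x 1 - x 0) \<le> 2 * L"
      using Wb[of "x 0 - x 1"] Wb[of "x 1 - x 0"] by linarith
    then have "\<beta> * ((W (x 0 - x 1) + W (x 1 - x 0)) / 2) \<le> \<beta> * L" using \<beta> by (intro mult_left_mono) auto
    moreover have "- \<beta> * energy U W 2 x = - \<beta> * U (x 0) + - \<beta> * U (x 1) - \<beta> * ((W (x 0 - x 1) + W (x 1 - x 0)) / 2)"
      unfolding e by algebra
    ultimately have "- \<beta> * U (x 0) + - \<beta> * U (x 1) \<le> \<beta> * L + - \<beta> * energy U W 2 x"
      by linarith
    then have "exp (- \<beta> * U (x 0)) * exp (- \<beta> * U (x 1)) \<le> exp (\<beta> * L) * exp (- \<beta> * energy U W 2 x)"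
      unfolding exp_add[symmetric] exp_le_cancel_iff .
    then show "(\<Prod>i<2. ennreal (exp (- \<beta> * U (x i)))) \<le> ennreal (exp (\<beta> * L)) * ennreal (exp (- \<beta> * energy U W 2 x))"
      by (simp add: set2 ennreal_mult[symmetric] ennreal_leI)
  qed
  also have "\<dots> = ennreal (exp (\<beta> * L)) * (\<integral>\<^sup>+x. ennreal (exp (- \<beta> * energy U W 2 x)) \<partial>lborel_pow 2)"
    by (rule nn_integral_cmult) (use int in auto)
  also have "\<dots> < \<infinity>"
  proof -
    have "(\<integral>\<^sup>+x. ennreal (exp (- \<beta> * energy U W 2 x)) \<partial>lborel_pow 2) < \<infinity>"
      using int by (simp add: integrable_iff_bounded)
    then show ?thesis by (simp add: ennreal_mult_less_top)
  qed
  finally have "?I * ?I < \<infinity>" .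
  then have "?I < \<infinity>" by (auto simp: ennreal_mult_less_top)
  then show ?thesis by (subst integrable_iff_bounded) simp
qed

text \<open>The constant uses e >= 5/2: the square of 2 e sqrt 2 is 8 e^2, at least 50. For L = 0
  the claim is trivial.\<close>

lemma temperature_bound:
  assumes \<beta>: "0 < \<beta>" and L: "0 \<le> L" and small: "ereal \<beta> < inverse (ereal (2 * exp 1 * sqrt 2) * ereal L)"
  shows "50 * (\<beta> * L)\<^sup>2 \<le> 1"
proof (cases "L = 0")
  case False
  with L have L0: "0 < L" by simp
  define c :: real where "c = 2 * exp 1 * sqrt 2"
  have c: "0 < c" by (simp add: c_def)
  have "\<beta> < inverse (c * L)" using small L0 c by (simp add: c_def[symmetric])
  then have "\<beta> * L * c < 1" using L0 c by (simp add: field_simps)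
  then have "(\<beta> * L * c)\<^sup>2 \<le> 1" using \<beta> L0 c by (intro power_le_one) auto
  then have le: "(\<beta> * L)\<^sup>2 * c\<^sup>2 \<le> 1" by (simp add: power_mult_distrib)
  have "5 / 2 \<le> exp (1 :: real)" using exp_lower_Taylor_quadratic[of "1 :: real"] by simp
  then have "(5 / 2)\<^sup>2 \<le> (exp (1 :: real))\<^sup>2" by (rule power_mono) simp
  then have "50 \<le> c\<^sup>2" by (simp add: c_def power_mult_distrib power2_eq_square)
  then have "(\<beta> * L)\<^sup>2 * 50 \<le> (\<beta> * L)\<^sup>2 * c\<^sup>2" by (rule mult_left_mono) simp
  with le show ?thesis by simp
qed simp

text \<open>The left-hand side is 4 (\<beta> L)^2 (N / (N - 1))^2. From N = 10 on the last factor is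
  at most 100/81, and (4 / 50) (100 / 81) = 8/81 is below 1/10.\<close>

lemma scaling_bound:
  fixes N :: nat
  assumes "50 * (\<beta> * L)\<^sup>2 \<le> 1" "10 \<le> N"
  shows "(\<beta> / (2 * (real N - 1)))\<^sup>2 * (real N)\<^sup>2 * (4 * L)\<^sup>2 \<le> 1 / 10"
proof -
  define n where "n = real N - 1"
  have n: "0 < n" "9 * real N \<le> 10 * n" using assms(2) by (auto simp: n_def)
  have "(9 * real N)\<^sup>2 \<le> (10 * n)\<^sup>2" using n by (intro power_mono) auto
  then have N2: "81 * (real N)\<^sup>2 \<le> 100 * n\<^sup>2" by (simp add: power_mult_distrib)
  have "(\<beta> / (2 * n))\<^sup>2 * (real N)\<^sup>2 * (4 * L)\<^sup>2 = 4 * (\<beta> * L)\<^sup>2 * ((real N)\<^sup>2 / n\<^sup>2)"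
    using n by (simp add: power_mult_distrib power_divide)
  also have "\<dots> \<le> 4 * (1 / 50) * (100 / 81)"
    using assms(1) N2 n by (intro mult_mono) (auto simp: field_simps)
  also have "\<dots> \<le> 1 / 10" by simp
  finally show ?thesis unfolding n_def .
qed

theorem corollary3p1:
  fixes \<beta> :: real
    and U W \<rho> :: "'a::euclidean_space \<Rightarrow> real"
    and k :: nat
  assumes "\<beta> > 0"
    and "U \<in> borel_measurable borel"
    and "W \<in> borel_measurable borel"
    and "Linf_norm W < \<infinity>"
    and "AE x in lborel. W (- x) = W x"
    and "\<And>N. N \<ge> 2 \<Longrightarrow> integrable (lborel_pow N) (\<lambda>x. exp (- \<beta> * energy U W N x))"
    and "free_energy_minimizer \<beta> U W \<rho>"
    and "ereal \<beta> < inverse (ereal (2 * exp 1 * sqrt 2) * Linf_norm W)"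
    and "k \<ge> 1"
  shows "(\<exists>C::real. \<forall>\<^sub>F N in sequentially.
           (let \<rho>\<^sub>N = gibbs \<beta> U W N;
                \<rho>\<^sub>N\<^sub>k = marginal N k \<rho>\<^sub>N;
                H\<^sub>k = rel_entropy (measure_of_density k \<rho>\<^sub>N\<^sub>k) (measure_of_density k (tensor_pow k \<rho>));
                H\<^sub>N = rel_entropy (measure_of_density N \<rho>\<^sub>N) (measure_of_density N (tensor_pow N \<rho>))
            in tv_dist k \<rho>\<^sub>N\<^sub>k (tensor_pow k \<rho>) \<le> sqrt_ereal (2 * H\<^sub>k) \<and>
               sqrt_ereal (2 * H\<^sub>k) \<le> sqrt_ereal (ereal (2 * real k / real N) * H\<^sub>N) \<and>
               sqrt_ereal (ereal (2 * real k / real N) * H\<^sub>N) \<le> ereal (C * sqrt (real k / real N))))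
       \<and> (finite_first_moment (density lborel (\<lambda>x. ennreal (\<rho> x))) \<longrightarrow>
          (\<exists>C::real. \<forall>\<^sub>F N in sequentially.
             wasserstein1
               (distr (measure_of_density 1 (marginal N 1 (gibbs \<beta> U W N))) borel (\<lambda>x. x 0))
               (density lborel (\<lambda>x. ennreal (\<rho> x)))
             \<le> ennreal (C * sqrt (real k / real N))))"
proof -
  define L where "L = real_of_ereal (Linf_norm W)"
  obtain W' where W': "W' \<in> borel_measurable borel" "\<And>x. \<bar>W' x\<bar> \<le> L" "\<And>x. W' (- x) = W' x"
    "AE x in lborel. W x = W' x" "0 \<le> Linf_norm W"
    using Linf_bounded_version[OF assms(3-5)] unfolding L_def by blast
  have LW: "Linf_norm W = ereal L" using W'(5) assms(4) by (cases "Linf_norm W") (auto simp: L_def)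
  have L0: "0 \<le> L" using W'(5) by (simp add: LW)
  have \<beta>L: "50 * (\<beta> * L)\<^sup>2 \<le> 1"
    by (rule temperature_bound[OF assms(1) L0]) (use assms(8) in \<open>simp only: LW\<close>)
  have int': "integrable (lborel_pow 2) (\<lambda>x. exp (- \<beta> * energy U W' 2 x))"
  proof (rule integrable_cong_AE_imp[OF assms(6)[OF order_refl]])
    show "(\<lambda>x. exp (- \<beta> * energy U W' 2 x)) \<in> borel_measurable (lborel_pow 2)"
      using energy_measurable[OF assms(2) W'(1), of 2] by measurable
    show "AE x in lborel_pow 2. exp (- \<beta> * energy U W 2 x) = exp (- \<beta> * energy U W' 2 x)"
      using energy_cong_AE[OF assms(3) W'(1) W'(4), of U 2] by eventually_elim simp
  qed
  interpret bounded_interaction \<beta> U W' L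
    by (rule bounded_interaction.intro[OF assms(1,2) W'(1,2,3) confining_potential[OF assms(1,2) W'(1,2) int']])
  have min: "free_energy_minimizer \<beta> U W' \<rho>"
    by (rule free_energy_minimizer_cong_AE[OF assms(3) W'(1) W'(4) assms(7)])
  have Z0: "0 \<le> partition_fn \<beta> U W N" for N
    unfolding partition_fn_def by (rule Bochner_Integration.integral_nonneg) simp
  have gibbs_nn: "0 \<le> gibbs \<beta> U W N x" for N x using Z0 by (simp add: gibbs_def)
  have gibbs_int: "integrable (lborel_pow N) (gibbs \<beta> U W N)" if "2 \<le> N" for N
    unfolding gibbs_def using assms(6)[OF that] by simp
  have gibbs_W': "measure_of_density N (gibbs \<beta> U W N) = measure_of_density N (gibbs \<beta> U W' N)" for N
    by (rule gibbs_cong_AE[OF assms(2,3) W'(1) W'(4)])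
  \<comment> \<open>The threshold 10 serves \<open>scaling_bound\<close>; k <= N is needed for the
    k-marginal to make sense.\<close>
  have large: "\<forall>\<^sub>F N in sequentially. max 10 k \<le> N" by (rule eventually_ge_at_top)
  show ?thesis
  proof (intro conjI impI)
    show "\<exists>C::real. \<forall>\<^sub>F N in sequentially.
           (let \<rho>\<^sub>N = gibbs \<beta> U W N;
                \<rho>\<^sub>N\<^sub>k = marginal N k \<rho>\<^sub>N;
                H\<^sub>k = rel_entropy (measure_of_density k \<rho>\<^sub>N\<^sub>k) (measure_of_density k (tensor_pow k \<rho>));
                H\<^sub>N = rel_entropy (measure_of_density N \<rho>\<^sub>N) (measure_of_density N (tensor_pow N \<rho>))
            in tv_dist k \<rho>\<^sub>N\<^sub>k (tensor_pow k \<rho>) \<le> sqrt_ereal (2 * H\<^sub>k) \<and>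
               sqrt_ereal (2 * H\<^sub>k) \<le> sqrt_ereal (ereal (2 * real k / real N) * H\<^sub>N) \<and>
               sqrt_ereal (ereal (2 * real k / real N) * H\<^sub>N) \<le> ereal (C * sqrt (real k / real N)))"
    \<comment> \<open>The constant is sqrt 6 because the full relative entropy is at most 3 and is
      multiplied by 2 k / N.\<close>
    proof (intro exI[of _ "sqrt 6"], use large in eventually_elim)
      case (elim N)
      then have N: "10 \<le> N" "2 \<le> N" "k \<le> N" by auto
      from entropy_chain[OF min N(2,3) scaling_bound[OF \<beta>L N(1)] gibbs_int[OF N(2)] gibbs_nn gibbs_W']
      obtain h H :: real where
        h: "rel_entropy (measure_of_density k (marginal N k (gibbs \<beta> U W N))) (measure_of_density k (tensor_pow k \<rho>)) = ereal h"
        and H: "rel_entropy (measure_of_density N (gibbs \<beta> U W N)) (measure_of_density N (tensor_pow N \<rho>)) = ereal H"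
        and tv: "tv_dist k (marginal N k (gibbs \<beta> U W N)) (tensor_pow k \<rho>) \<le> ereal (sqrt (2 * h))"
        and hH: "N * h \<le> k * H" "H \<le> 3"
        by (elim exE conjE)
      have N0: "0 < real N" using N by simp
      have sq: "sqrt_ereal (ereal a) = ereal (sqrt a)" for a by (simp add: sqrt_ereal_def)
      have e1: "2 * ereal h = ereal (2 * h)" by simp
      have e2: "ereal (2 * real k / real N) * ereal H = ereal (2 * real k / real N * H)" by simp
      have "2 * h \<le> 2 * real k / real N * H" using hH(1) N0 by (simp add: field_simps)
      moreover have "2 * real k / real N * H \<le> 6 * (real k / real N)"
      proof -
        have "2 * real k / real N * H \<le> 2 * real k / real N * 3" using hH(2) by (intro mult_left_mono) auto
        then show ?thesis by simp
      qed
      then have "sqrt (2 * real k / real N * H) \<le> sqrt 6 * sqrt (real k / real N)"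
        unfolding real_sqrt_mult[symmetric] by (rule real_sqrt_le_mono)
      ultimately show ?case
        unfolding Let_def h H e1 e2 sq using tv by simp
    qed
  next
    assume moment: "finite_first_moment (dens \<rho>)"
    define m where "m = enn2real (\<integral>\<^sup>+x. ennreal (norm x) \<partial>dens \<rho>)"
    have m: "(\<integral>\<^sup>+x. ennreal (norm x) \<partial>dens \<rho>) = ennreal m"
      using moment by (simp add: m_def finite_first_moment_def)
    have m0: "0 \<le> m" by (simp add: m_def)
    show "\<exists>C::real. \<forall>\<^sub>F N in sequentially.
             wasserstein1
               (distr (measure_of_density 1 (marginal N 1 (gibbs \<beta> U W N))) borel (\<lambda>x. x 0)) (dens \<rho>)
             \<le> ennreal (C * sqrt (real k / real N))"
    proof (intro exI[of _ "12 * exp (8 * \<beta> * L) * m"], use large in eventually_elim)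
      case (elim N)
      then have N: "10 \<le> N" "2 \<le> N" by auto
      have "wasserstein1 (distr (measure_of_density 1 (marginal N 1 (gibbs \<beta> U W N))) borel (\<lambda>x. x 0)) (dens \<rho>)
        \<le> ennreal (12 * exp (8 * \<beta> * L) / sqrt N) * ennreal m"
        using wasserstein_one_marginal[OF min N(2) scaling_bound[OF \<beta>L N(1)] gibbs_int[OF N(2)] gibbs_nn gibbs_W']
        unfolding m .
      also have "\<dots> = ennreal (12 * exp (8 * \<beta> * L) * m * (1 / sqrt N))"
        using m0 by (subst ennreal_mult[symmetric]) auto
      also have "\<dots> \<le> ennreal (12 * exp (8 * \<beta> * L) * m * sqrt (real k / real N))"
      proof (intro ennreal_leI mult_left_mono)
        \<comment> \<open>The estimate obtained is 1 / sqrt N; k >= 1 weakens it to the stated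
          form.\<close>
        show "1 / sqrt N \<le> sqrt (real k / real N)"
          using assms(9) unfolding real_sqrt_divide by (intro divide_right_mono) auto
      qed (use m0 in auto)
      finally show ?case .
    qed
  qed
qed

end
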